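(* Consider the drifted Brownian motion inventory model with reflection at $\{0\}$ described in the context, with $k_5=k_2+\tilde k_5$, $\tilde k_5>0$. The optimal policy among the $(y,z)$ ordering policies has levels $y_*=0$, $z_*=\sqrt{2k_1\mu/c_h}$ and cost $F_*=\sqrt{2k_1c_h\mu}+k_2\mu+\frac{\sigma^2c_h}{2\mu}$. The solely just-in-time policy has long-term average cost $\widehat F=\frac{\sigma^2c_h}{2\mu}+k_5\mu$. The solely just-in-time policy is better than the optimal $(y_*,z_* )$ policy (i.e. $\widehat F<F_*$) if and only if $$\tilde k_5<\frac{c_hz_*}{\mu}.$$
   Context: Model. Let $\mu,\sigma,c_h,k_1,k_2>0$. In the absence of (regular) orders the inventory is a Brownian motion with drift $-\mu$ and diffusion coefficient $\sigma$ reflected at $\{0\}$, with state space $[0,\infty)$ and initial value $x_0>0$. An ordering policy $(\tau,Y)$ is an increasing sequence of stopping times $\tau_k$ (of the augmented filtration of the uncontrolled process) with nonnegative $\mathcal F_{\tau_k}$-measurable order sizes $Y_k$; the resulting inventory $X$ jumps up by $Y_k$ at $\tau_k$ and $L_0$ denotes its local time at $\{0\}$ (so $dX=-\mu\,dt+\sigma\,dW+dL_0+$ jumps). With $c_0(x)=c_hx$ and $c_1(y,z)=k_1+k_2(z-y)$, the long-term average cost is $$J(\tau,Y)=\limsup_{t\to\infty}\frac1t\,\mathbb E_{x_0}\Big[\int_0^tc_0(X(s))\,ds+\sum_{k=1}^\infty I_{\{\tau_k\le t\}}c_1(X(\tau_k-),X(\tau_k))+k_5L_0(t)\Big].$$ Here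 $k_5$ is the cost per unit of reflection, interpreted as the per-unit cost of an emergency (just-in-time) order, and $\tilde k_5=k_5-k_2$ is the premium per unit. The $(y,z)$ ordering policy ($0\le y<z$) is: $\tau_0=0$, $\tau_k=\inf\{t>\tau_{k-1}:X(t-)\le y\}$, $Y_k=z-X(\tau_k-)$; when $y=0$ the order occurs before any reflection, so no reflection cost is incurred. The solely just-in-time policy places no orders $(\tau_k,Y_k)$ at all and only uses the reflection at $\{0\}$; the inventory process is then the reflected drifted Brownian motion. *)

theory Defs
  imports "HOL-Probability.Probability"
begin

definition standard_brownian_motion :: "'a measure \<Rightarrow> (real \<Rightarrow> 'a \<Rightarrow> real) \<Rightarrow> bool" where
  "standard_brownian_motion M W \<longleftrightarrow>
     prob_space M \<and>
     (\<forall>t\<ge>0. W t \<in> borel_measurable M) \<and>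
     (\<forall>\<omega>\<in>space M. W 0 \<omega> = 0) \<and>
     (\<forall>\<omega>\<in>space M. continuous_on {0..} (\<lambda>t. W t \<omega>)) \<and>
     (\<forall>s t. 0 \<le> s \<and> s < t \<longrightarrow>
        distributed M lborel (\<lambda>\<omega>. W t \<omega> - W s \<omega>)
          (\<lambda>x. ennreal (normal_density 0 (sqrt (t - s)) x))) \<and>
     (\<forall>(n::nat) (t::nat \<Rightarrow> real). 0 \<le> t 0 \<and> (\<forall>i<n. t i \<le> t (Suc i)) \<longrightarrow>
        prob_space.indep_vars M (\<lambda>_. borel) (\<lambda>i \<omega>. W (t (Suc i)) \<omega> - W (t i) \<omega>) {..<n})"

definition drifted_bm ::
    "real \<Rightarrow> real \<Rightarrow> real \<Rightarrow> (real \<Rightarrow> 'a \<Rightarrow> real) \<Rightarrow> real \<Rightarrow> 'a \<Rightarrow> real" where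
  "drifted_bm x0 \<mu> \<sigma> W t \<omega> = x0 - \<mu> * t + \<sigma> * W t \<omega>"

text \<open>
  The driving process \<open>B = x0 - \<mu> t + \<sigma> W\<close> generates the filtration.  The reflected process without
  orders is \<open>B + L\<close> with \<open>L\<close> its local time at 0; since \<open>L\<close> is, up to null sets, a functional of
  the reflected process, the augmented filtrations of \<open>B\<close> and of the reflected process coincide.
  The time index is extended by \<open>\<infinity>\<close> because stopping times may be infinite.
\<close>

definition augmented_filtration ::
    "'a measure \<Rightarrow> (real \<Rightarrow> 'a \<Rightarrow> real) \<Rightarrow> ennreal \<Rightarrow> 'a measure" where
  "augmented_filtration M B t =
     sigma (space M)
       ({B s -` A \<inter> space M | s A. 0 \<le> s \<and> ennreal s \<le> t \<and> A \<in> sets borel} \<union> null_sets M)"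

subsection \<open>Reflection at 0 and the controlled inventory, path by path\<close>

text \<open>
  \<open>l\<close> is the local time at 0 of the path \<open>f + l\<close> (on \<open>t \<ge> 0\<close>): it is continuous, nondecreasing,
  starts at 0, keeps \<open>f + l\<close> nonnegative, and \<open>dl\<close> does not charge \<open>{t. f t + l t > 0}\<close>.
  It is set to 0 on the negative half-line only so that \<open>interval_measure l\<close> is the measure \<open>dl\<close>.
\<close>

definition is_reflection_term :: "(real \<Rightarrow> real) \<Rightarrow> (real \<Rightarrow> real) \<Rightarrow> bool" where
  "is_reflection_term f l \<longleftrightarrow>
     (\<forall>t\<le>0. l t = 0) \<and> mono l \<and> continuous_on UNIV l \<and>
     (\<forall>t\<ge>0. 0 \<le> f t + l t) \<and>
     (AE t in interval_measure l. 0 \<le> t \<longrightarrow> f t + l t = 0)"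

definition reflection_term :: "(real \<Rightarrow> real) \<Rightarrow> real \<Rightarrow> real" where
  "reflection_term f = (THE l. is_reflection_term f l)"

text \<open>
  One realization of a sequence of orders: order times (\<open>\<infinity>\<close> if the order is never placed) and
  order sizes.  Orders are numbered from 1, the entries at index 0 are not orders.
\<close>

type_synonym orders = "(nat \<Rightarrow> ennreal) \<times> (nat \<Rightarrow> real)"

definition order_jumps :: "orders \<Rightarrow> real \<Rightarrow> real" where
  "order_jumps p t = (\<Sum>k. if fst p (Suc k) \<le> ennreal t then snd p (Suc k) else 0)"

definition local_time :: "(real \<Rightarrow> real) \<Rightarrow> orders \<Rightarrow> real \<Rightarrow> real" where
  "local_time b p = reflection_term (\<lambda>t. b t + order_jumps p t)"

definition inventory :: "(real \<Rightarrow> real) \<Rightarrow> orders \<Rightarrow> real \<Rightarrow> real" where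
  "inventory b p t = b t + order_jumps p t + local_time b p t"

text \<open>\<open>X(t-)\<close>, with \<open>X(0-)\<close> the initial inventory.\<close>

definition inventory_left :: "(real \<Rightarrow> real) \<Rightarrow> orders \<Rightarrow> real \<Rightarrow> real" where
  "inventory_left b p t = (if t \<le> 0 then b 0 else Lim (at_left t) (inventory b p))"

definition no_orders :: orders where
  "no_orders = ((\<lambda>k. if k = 0 then 0 else \<infinity>), (\<lambda>_. 0))"

text \<open>
  In \<open>\<tau>\<^sub>k = inf {t > \<tau>\<^sub>k\<^sub>-\<^sub>1. X(t-) \<le> y}\<close> the process \<open>X\<close> is the inventory subject to the first
  \<open>k - 1\<close> orders, which are the ones present in stage \<open>k - 1\<close>.
\<close>

primrec yz_stage :: "(real \<Rightarrow> real) \<Rightarrow> real \<Rightarrow> real \<Rightarrow> nat \<Rightarrow> orders" where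
  "yz_stage b y z 0 = no_orders"
| "yz_stage b y z (Suc n) =
     (let p = yz_stage b y z n;
          T = (INF t\<in>{t. 0 \<le> t \<and> fst p n < ennreal t \<and> inventory_left b p t \<le> y}. ennreal t)
      in ((fst p)(Suc n := T),
          (snd p)(Suc n := (if T = \<infinity> then 0 else z - inventory_left b p (enn2real T)))))"

definition yz_orders :: "(real \<Rightarrow> real) \<Rightarrow> real \<Rightarrow> real \<Rightarrow> orders" where
  "yz_orders b y z = ((\<lambda>k. fst (yz_stage b y z k) k), (\<lambda>k. snd (yz_stage b y z k) k))"

subsection \<open>Ordering policies and their long-term average cost\<close>

definition ordering_policy ::
    "'a measure \<Rightarrow> (real \<Rightarrow> 'a \<Rightarrow> real) \<Rightarrow> ('a \<Rightarrow> orders) \<Rightarrow> bool" where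
  "ordering_policy M B P \<longleftrightarrow>
     (\<forall>k\<ge>1.
        stopping_time (augmented_filtration M B) (\<lambda>\<omega>. fst (P \<omega>) k) \<and>
        (\<lambda>\<omega>. snd (P \<omega>) k) \<in> borel_measurable
           (filtration.pre_sigma (space M) (augmented_filtration M B) (\<lambda>\<omega>. fst (P \<omega>) k)) \<and>
        (\<forall>\<omega>\<in>space M. 0 \<le> snd (P \<omega>) k) \<and>
        (\<forall>\<omega>\<in>space M. fst (P \<omega>) k \<le> fst (P \<omega>) (Suc k) \<and>
           (fst (P \<omega>) k < \<infinity> \<longrightarrow> fst (P \<omega>) k < fst (P \<omega>) (Suc k))))"

definition yz_policy :: "(real \<Rightarrow> 'a \<Rightarrow> real) \<Rightarrow> real \<Rightarrow> real \<Rightarrow> 'a \<Rightarrow> orders" where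
  "yz_policy B y z \<omega> = yz_orders (\<lambda>t. B t \<omega>) y z"

definition just_in_time_policy :: "'a \<Rightarrow> orders" where
  "just_in_time_policy \<omega> = no_orders"

definition holding_cost :: "real \<Rightarrow> real \<Rightarrow> real" where
  "holding_cost c_h x = c_h * x"

definition order_cost :: "real \<Rightarrow> real \<Rightarrow> real \<Rightarrow> real \<Rightarrow> real" where
  "order_cost k1 k2 y z = k1 + k2 * (z - y)"

definition cost_up_to ::
    "(real \<Rightarrow> real) \<Rightarrow> (real \<Rightarrow> real \<Rightarrow> real) \<Rightarrow> real \<Rightarrow> (real \<Rightarrow> real) \<Rightarrow> orders \<Rightarrow> real \<Rightarrow> ennreal" where
  "cost_up_to c0 c1 k5 b p t =
     (\<integral>\<^sup>+ s\<in>{0..t}. ennreal (c0 (inventory b p s)) \<partial>lborel) +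
     (\<Sum>k. if fst p (Suc k) \<le> ennreal t
           then ennreal (c1 (inventory_left b p (enn2real (fst p (Suc k))))
                            (inventory b p (enn2real (fst p (Suc k)))))
           else 0) +
     ennreal (k5 * local_time b p t)"

text \<open>All cost terms are nonnegative, so the expectation is taken in \<open>[0, \<infinity>]\<close>.\<close>

definition long_term_average_cost ::
    "'a measure \<Rightarrow> (real \<Rightarrow> 'a \<Rightarrow> real) \<Rightarrow> (real \<Rightarrow> real) \<Rightarrow> (real \<Rightarrow> real \<Rightarrow> real) \<Rightarrow> real
      \<Rightarrow> ('a \<Rightarrow> orders) \<Rightarrow> ennreal" where
  "long_term_average_cost M B c0 c1 k5 P =
     Limsup at_top (\<lambda>t::real.
       (\<integral>\<^sup>+ \<omega>. cost_up_to c0 c1 k5 (\<lambda>s. B s \<omega>) (P \<omega>) t \<partial>M) / ennreal t)"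

end

(*
  With q = z - y and c = min x0 y, the orders of the (y,z) policy are placed when the driving process
  B = x0 - mu t + sigma W first passes the levels c, c - q, c - 2q, ...  Hence the inventory is, up to a
  constant, V = B + q N, where N counts the levels passed by the running minimum m of B.
  Optional stopping of W at these first passage times is the only stochastic calculus needed: summed
  over the levels it gives

    mu E[int_0^t V] = x0^2/2 + sigma^2 t/2 + (c + q/2) (E V_t - x0 + mu t) - E[V_t^2]/2,

  and q E N_t = E V_t - x0 + mu t by definition. The boundary terms are o(t), since V differs from the
  drawup B - m by a bounded amount and a fourth moment maximal inequality gives E[(B_t - m_t)^2] = O(t^(2/3)).
  So the average inventory is sigma^2/(2 mu) + c + q/2, and the average number of orders is mu/q.
  The reflected process B + max 0 (-m) lies within q below V for c = 0 and every q > 0, and letting q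
  tend to 0 gives the just-in-time averages. Minimizing over (y,z) is the economic order quantity problem.
*)
theory Submission
  imports Defs
begin

text \<open>The overview leaves open how the recursive definitions become computable and where null
  sets enter. The reflection term is a definite description, so uniqueness for the Skorokhod problem
  precedes every computation. Stage n of the recursion knows only n orders, and its inventory is
  reflected if it gets to 0 later on; the next order time has the claimed form because this
  reflection is still zero up to that time and never lowers the inventory. Order times are infima
  over t > 0: for x0 = y the first order comes at time 0 only if the path is at or below x0 at
  arbitrarily small times. This holds almost surely, so the cost formula and adaptedness at time 0
  carry an exceptional null set. The mean identity stands in for Ito's formula and for renewal
  cycles: the passed levels form an arithmetic progression, whose sum is a quadratic in N that can
  be rewritten through V^2 - B^2. Fourth moments are used because the second moment of the maximum
  of |W| on [0,t] bounds the squared drawup only by O(t).\<close>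

section \<open>Skorokhod reflection\<close>

text \<open>If l t exceeded l' t, take the last time s before t at which l <= l'. On (s,t] the path
  f + l lies strictly above f + l' >= 0, so dl gives no mass to (s,t]; hence l t = l s <= l' s <= l'
  t, a contradiction.\<close>

lemma is_reflection_term_unique:
  assumes l: "is_reflection_term f l" and l': "is_reflection_term f l'"
  shows "l = l'"
proof -
  have le: "l t \<le> l' t" if l: "is_reflection_term f l" and l': "is_reflection_term f l'" for l l' t
  proof (rule ccontr)
    assume gt: "\<not> l t \<le> l' t"
    from l have l0: "\<And>t. t \<le> 0 \<Longrightarrow> l t = 0" and lm: "mono l" and lc: "continuous_on UNIV l"
      and lA: "AE t in interval_measure l. 0 \<le> t \<longrightarrow> f t + l t = 0"
      by (auto simp: is_reflection_term_def)
    from l' have l0': "\<And>t. t \<le> 0 \<Longrightarrow> l' t = 0" and lm': "mono l'" and lc': "continuous_on UNIV l'"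
      and nn: "\<And>t. t \<ge> 0 \<Longrightarrow> 0 \<le> f t + l' t"
      by (auto simp: is_reflection_term_def)
    have tpos: "0 < t" using gt l0[of t] l0'[of t] by force
    define S where "S = {u \<in> {0..t}. l u - l' u \<le> 0}"
    have "closed S" unfolding S_def
      by (rule continuous_on_closed_Collect_le)
         (auto intro!: continuous_on_diff intro: continuous_on_subset[OF lc] continuous_on_subset[OF lc'])
    moreover have "0 \<in> S" using tpos l0[of 0] l0'[of 0] by (auto simp: S_def)
    moreover have bdd: "bdd_above S" by (auto simp: S_def intro!: bdd_aboveI[of _ t])
    ultimately have sS: "Sup S \<in> S" by (intro closed_contains_Sup) auto
    define s where "s = Sup S"
    have s: "0 \<le> s" "s \<le> t" "l s \<le> l' s" using sS by (auto simp: s_def S_def)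
    have "s < t" using s gt by (cases "s = t") auto
    have above: "l' u < l u" if "s < u" "u \<le> t" for u
    proof (rule ccontr)
      assume "\<not> l' u < l u"
      then have "u \<in> S" using that s by (auto simp: S_def)
      from cSup_upper[OF this bdd] that show False by (auto simp: s_def)
    qed
    have "AE u in interval_measure l. u \<notin> {s<..t}"
      using lA
    proof eventually_elim
      case (elim u)
      show ?case
      proof
        assume u: "u \<in> {s<..t}"
        then have "0 \<le> f u + l' u" "l' u < l u" using nn[of u] above[of u] s by auto
        then show False using elim u s by auto
      qed
    qed
    then have "emeasure (interval_measure l) {s<..t} = 0"
      by (subst (asm) AE_iff_measurable[of "{s<..t}"]) auto
    moreover have "emeasure (interval_measure l) {s<..t} = ennreal (l t - l s)"
      using lm lc \<open>s < t\<close>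
      by (intro emeasure_interval_measure_Ioc)
         (auto simp: mono_def continuous_on_eq_continuous_at intro: continuous_at_imp_continuous_at_within)
    ultimately have "l t \<le> l s" by (auto simp: ennreal_eq_0_iff)
    also have "\<dots> \<le> l' s" by (fact s)
    also have "\<dots> \<le> l' t" using lm' s by (auto simp: mono_def)
    finally show False using gt by simp
  qed
  show ?thesis
    by (intro ext antisym le assms)
qed

lemma reflection_term_eqI: "is_reflection_term f l \<Longrightarrow> reflection_term f = l"
  unfolding reflection_term_def by (blast intro: is_reflection_term_unique)

text \<open>The explicit Skorokhod solution: the running maximum of the negative part of f. Cutting
  the horizon at 0 makes it constant at negative times, with value 0 as soon as f starts at a
  nonnegative value.\<close>

definition skorokhod_term :: "(real \<Rightarrow> real) \<Rightarrow> real \<Rightarrow> real" where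
  "skorokhod_term f t = (SUP s\<in>{0..max 0 t}. max 0 (- f s))"

text \<open>\<open>b\<close> is the driving path and \<open>j\<close> the accumulated orders. Orders
  jump upwards only, and such jumps cannot raise the running maximum of -f; this is why the
  reflection term is continuous although f need not be.\<close>

locale reflected_path =
  fixes b j :: "real \<Rightarrow> real" and f :: "real \<Rightarrow> real"
  assumes cont: "continuous_on {0..} b"
    and mono_j: "\<And>s t. 0 \<le> s \<Longrightarrow> s \<le> t \<Longrightarrow> j s \<le> j t"
    and f0: "0 \<le> b 0 + j 0"
  defines "f \<equiv> \<lambda>t. b t + j t"
begin

lemma bdd_neg: "bdd_above ((\<lambda>s. max 0 (- f s)) ` {0..t})"
proof -
  have "compact (b ` {0..t})"
    by (intro compact_continuous_image continuous_on_subset[OF cont]) auto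
  then have "bdd_below (b ` {0..t})" by (intro bounded_imp_bdd_below compact_imp_bounded)
  then obtain K where K: "\<And>s. s \<in> {0..t} \<Longrightarrow> K \<le> b s" by (meson bdd_below.E imageI)
  show ?thesis
  proof (rule bdd_aboveI2)
    fix s assume "s \<in> {0..t}"
    then show "max 0 (- f s) \<le> max 0 (- K - j 0)"
      using K[of s] mono_j[of 0 s] by (auto simp: f_def)
  qed
qed

lemma skorokhod_upper: "0 \<le> s \<Longrightarrow> s \<le> t \<Longrightarrow> max 0 (- f s) \<le> skorokhod_term f t"
  unfolding skorokhod_term_def using bdd_neg by (intro cSUP_upper) auto

lemma skorokhod_le: "0 \<le> K \<Longrightarrow> (\<And>s. 0 \<le> s \<Longrightarrow> s \<le> max 0 t \<Longrightarrow> - f s \<le> K) \<Longrightarrow> skorokhod_term f t \<le> K"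
  unfolding skorokhod_term_def by (intro cSUP_least) auto

lemma skorokhod_nonneg: "0 \<le> skorokhod_term f t"
  using skorokhod_upper[of 0 "max 0 t"] by (simp add: skorokhod_term_def)

lemma skorokhod_mono: "s \<le> t \<Longrightarrow> skorokhod_term f s \<le> skorokhod_term f t"
  unfolding skorokhod_term_def using bdd_neg by (intro cSUP_subset_mono) auto

lemma skorokhod_nonpos: "t \<le> 0 \<Longrightarrow> skorokhod_term f t = 0"
  using f0 by (simp add: skorokhod_term_def f_def)

lemma skorokhod_eq_0: "(\<And>s. 0 \<le> s \<Longrightarrow> s \<le> max 0 t \<Longrightarrow> 0 \<le> f s) \<Longrightarrow> skorokhod_term f t = 0"
  by (intro antisym skorokhod_le skorokhod_nonneg) auto

lemma skorokhod_increment: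
  assumes "0 \<le> t" "t \<le> u" "0 \<le> e" "\<And>s. t \<le> s \<Longrightarrow> s \<le> u \<Longrightarrow> b t - b s \<le> e"
  shows "skorokhod_term f u \<le> skorokhod_term f t + e"
proof (rule skorokhod_le)
  show "0 \<le> skorokhod_term f t + e" using skorokhod_nonneg assms by simp
  fix s assume s: "0 \<le> s" "s \<le> max 0 u"
  show "- f s \<le> skorokhod_term f t + e"
  proof (cases "s \<le> t")
    case True then show ?thesis using skorokhod_upper[OF s(1) True] assms by simp
  next
    case False
    then have "- f s \<le> - f t + e" using assms(4)[of s] mono_j[of t s] s assms(1-3) by (simp add: f_def)
    then show ?thesis using skorokhod_upper[of t t] assms by auto
  qed
qed

lemma continuous_skorokhod: "continuous_on UNIV (skorokhod_term f)"
proof -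
  have "continuous_on {0..} (skorokhod_term f)"
  proof (rule continuous_on_iff[THEN iffD2], intro ballI allI impI)
    fix t e :: real assume t: "t \<in> {0..}" and e: "0 < e"
    have "uniformly_continuous_on {0..t+1} b"
      by (intro compact_uniformly_continuous continuous_on_subset[OF cont]) auto
    then obtain d where d: "0 < d"
      "\<And>s s'. s \<in> {0..t+1} \<Longrightarrow> s' \<in> {0..t+1} \<Longrightarrow> dist s' s < d \<Longrightarrow> dist (b s') (b s) < e / 2"
      using e by (auto simp: uniformly_continuous_on_def elim!: allE[of _ "e/2"])
    show "\<exists>d>0. \<forall>x'\<in>{0..}. dist x' t < d \<longrightarrow> dist (skorokhod_term f x') (skorokhod_term f t) < e"
    proof (intro exI[of _ "min d 1"] conjI ballI impI)
      fix u :: real assume u: "u \<in> {0..}" "dist u t < min d 1"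
      define p q where "p = min u t" and "q = max u t"
      have "skorokhod_term f q \<le> skorokhod_term f p + e / 2"
      proof (rule skorokhod_increment)
        fix s assume "p \<le> s" "s \<le> q"
        then have "dist (b p) (b s) < e / 2"
          using u t by (intro d(2)) (auto simp: p_def q_def dist_real_def)
        then show "b p - b s \<le> e / 2" unfolding dist_real_def by linarith
      qed (use e u t in \<open>auto simp: p_def q_def\<close>)
      moreover have "skorokhod_term f p \<le> skorokhod_term f q" by (rule skorokhod_mono) (auto simp: p_def q_def)
      ultimately show "dist (skorokhod_term f u) (skorokhod_term f t) < e"
        using e by (auto simp: dist_real_def p_def q_def min_def max_def split: if_splits)
    qed (use d in auto)
  qed
  then have "continuous_on UNIV (\<lambda>t. skorokhod_term f (max 0 t))"
    by (rule continuous_on_compose2[where f="\<lambda>t. max 0 t"]) (auto intro!: continuous_intros)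
  also have "(\<lambda>t. skorokhod_term f (max 0 t)) = skorokhod_term f"
    by (auto simp: skorokhod_term_def fun_eq_iff)
  finally show ?thesis .
qed

text \<open>Where \<open>f + l > 0\<close>, the term \<open>l\<close> is constant up to a rational time to the right; since \<open>l\<close> has
  no atoms, the countably many level intervals met in this way are null sets of \<open>dl\<close>.\<close>

lemma AE_skorokhod:
  "AE t in interval_measure (skorokhod_term f). 0 \<le> t \<longrightarrow> f t + skorokhod_term f t = 0"
proof -
  let ?l = "skorokhod_term f"
  define D where "D q = {t. 0 \<le> t \<and> t \<le> q \<and> ?l t = ?l q}" for q
  have null: "D q \<in> null_sets (interval_measure ?l)" for q
  proof (cases "0 \<le> q")
    case False
    then have "D q = {}" by (auto simp: D_def)
    then show ?thesis by simp
  next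
    case True
    have "closed {t \<in> {0..q}. ?l t = ?l q}"
      by (intro continuous_closed_preimage_constant continuous_on_subset[OF continuous_skorokhod]) auto
    then have cl: "closed (D q)" by (simp add: D_def conj_assoc)
    have qD: "q \<in> D q" using True by (auto simp: D_def)
    have bdd: "bdd_below (D q)" by (auto simp: D_def)
    have aD: "Inf (D q) \<in> D q" using cl qD bdd by (intro closed_contains_Inf) auto
    have sub: "D q \<subseteq> {Inf (D q)..q}" using cInf_lower[OF _ bdd] by (auto simp: D_def)
    have "emeasure (interval_measure ?l) {Inf (D q)..q} = ennreal (?l q - ?l (Inf (D q)))"
      using aD by (intro emeasure_interval_measure_Icc skorokhod_mono continuous_skorokhod) (auto simp: D_def)
    also have "\<dots> = 0" using aD by (auto simp: D_def)
    finally have "{Inf (D q)..q} \<in> null_sets (interval_measure ?l)" by auto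
    then show ?thesis using null_sets_subset[of _ _ "D q"] cl sub by (metis borel_closed sets_interval_measure)
  qed
  have "(\<Union>r. D (of_rat r)) \<in> null_sets (interval_measure ?l)"
    by (intro null_sets_UN null)
  then show ?thesis
  proof (rule AE_I', intro subsetI)
    fix t assume "t \<in> {t \<in> space (interval_measure ?l). \<not> (0 \<le> t \<longrightarrow> f t + ?l t = 0)}"
    then have t: "0 \<le> t" "f t + ?l t \<noteq> 0" by auto
    have "- f t \<le> ?l t" using skorokhod_upper[of t t] t by auto
    then have pos: "0 < f t + ?l t" using t by auto
    have "continuous (at t within {0..}) b" using cont t by (auto simp: continuous_on_eq_continuous_within)
    then obtain d where d: "0 < d" "\<And>s. s \<in> {0..} \<Longrightarrow> dist s t < d \<Longrightarrow> dist (b s) (b t) < f t + ?l t"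
      using pos unfolding continuous_within_eps_delta by meson
    obtain r :: rat where r: "t < of_rat r" "of_rat r < t + d"
      using of_rat_dense[of t "t + d"] d by auto
    have "?l (of_rat r) \<le> ?l t"
    proof (rule skorokhod_le[OF skorokhod_nonneg])
      fix s :: real assume s: "0 \<le> s" "s \<le> max 0 (of_rat r)"
      show "- f s \<le> ?l t"
      proof (cases "s \<le> t")
        case True then show ?thesis using skorokhod_upper[OF s(1) True] by simp
      next
        case False
        then have "dist (b s) (b t) < f t + ?l t" using s r t by (intro d) (auto simp: dist_real_def)
        then show ?thesis using mono_j[of t s] False t by (auto simp: f_def dist_real_def)
      qed
    qed
    with skorokhod_mono[of t "of_rat r"] r t have "t \<in> D (of_rat r)" by (auto simp: D_def)
    then show "t \<in> (\<Union>r. D (of_rat r))" by blast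
  qed
qed

lemma is_reflection_term_skorokhod: "is_reflection_term f (skorokhod_term f)"
  unfolding is_reflection_term_def
proof (intro conjI allI impI)
  show "mono (skorokhod_term f)" by (auto simp: mono_def intro: skorokhod_mono)
  fix t :: real assume "0 \<le> t"
  then show "0 \<le> f t + skorokhod_term f t" using skorokhod_upper[of t t] by auto
qed (auto intro: continuous_skorokhod AE_skorokhod skorokhod_nonpos)

lemma reflection_term_eq: "reflection_term f = skorokhod_term f"
  by (rule reflection_term_eqI[OF is_reflection_term_skorokhod])

end

section \<open>First passage times and the \<open>(y,z)\<close> policy along a path\<close>

text \<open>The strict 0 < t mirrors the condition t > \<tau>_0 = 0 of the policy: for a = b 0 the
  value is 0 only if the path is at or below a at arbitrarily small positive times. A level that is
  never reached has passage time \<infinity>, the infimum of the empty set.\<close>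

definition first_passage :: "(real \<Rightarrow> real) \<Rightarrow> real \<Rightarrow> ennreal" where
  "first_passage b a = (INF t\<in>{t. 0 < t \<and> b t \<le> a}. ennreal t)"

lemma first_passage_lower: "0 < t \<Longrightarrow> b t \<le> a \<Longrightarrow> first_passage b a \<le> ennreal t"
  unfolding first_passage_def by (rule INF_lower) simp

lemma first_passage_greatest:
  "(\<And>t. 0 < t \<Longrightarrow> b t \<le> a \<Longrightarrow> T \<le> ennreal t) \<Longrightarrow> T \<le> first_passage b a"
  unfolding first_passage_def by (rule INF_greatest) simp

lemma first_passage_antimono: "a \<le> a' \<Longrightarrow> first_passage b a' \<le> first_passage b a"
  by (intro first_passage_greatest first_passage_lower) auto

locale continuous_path =
  fixes b :: "real \<Rightarrow> real"
  assumes cont: "continuous_on {0..} b"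
begin

lemma path_bdd_below: "bdd_below (b ` {0..t})"
  by (intro bounded_imp_bdd_below compact_imp_bounded compact_continuous_image continuous_on_subset[OF cont]) auto

lemma path_near:
  assumes "0 \<le> t" "0 < e"
  obtains d where "0 < d" "\<And>s. 0 \<le> s \<Longrightarrow> \<bar>s - t\<bar> < d \<Longrightarrow> \<bar>b s - b t\<bar> < e"
proof -
  have "continuous (at t within {0..}) b" using cont assms by (auto simp: continuous_on_eq_continuous_within)
  then show ?thesis using that assms(2) unfolding continuous_within_eps_delta by (auto simp: dist_real_def)
qed

lemma first_passage_ge_near:
  assumes "0 \<le> t" "a < b t" "\<And>s. 0 < s \<Longrightarrow> s < t \<Longrightarrow> a < b s"
  shows "ennreal t < first_passage b a"
proof -
  obtain d where d: "0 < d" "\<And>s. 0 \<le> s \<Longrightarrow> \<bar>s - t\<bar> < d \<Longrightarrow> \<bar>b s - b t\<bar> < b t - a"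
    using path_near[of t "b t - a"] assms by auto
  have "ennreal (t + d) \<le> first_passage b a"
  proof (rule first_passage_greatest)
    fix s assume s: "0 < s" "b s \<le> a"
    then have "\<not> s < t" using assms(3)[of s] by auto
    moreover have "\<not> \<bar>s - t\<bar> < d" using d(2)[of s] s by auto
    ultimately show "ennreal (t + d) \<le> ennreal s" by (intro ennreal_leI) linarith
  qed
  moreover have "ennreal t < ennreal (t + d)" using d assms by (intro ennreal_lessI) auto
  ultimately show ?thesis by (rule less_le_trans[rotated])
qed

text \<open>For positive t the infimum is a minimum: otherwise the path stays above a on (0,t] and,
  by continuity, a little longer. At t = 0 the equivalence can fail, because the infimum 0 is
  approached without being attained.\<close>

lemma first_passage_le_iff:
  assumes "0 < t"
  shows "first_passage b a \<le> ennreal t \<longleftrightarrow> (\<exists>s. 0 < s \<and> s \<le> t \<and> b s \<le> a)"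
proof
  assume le: "first_passage b a \<le> ennreal t"
  show "\<exists>s. 0 < s \<and> s \<le> t \<and> b s \<le> a"
  proof (rule ccontr)
    assume "\<not> ?thesis"
    then have "ennreal t < first_passage b a" using assms
      by (intro first_passage_ge_near) (auto simp: not_le)
    with le show False by simp
  qed
next
  assume "\<exists>s. 0 < s \<and> s \<le> t \<and> b s \<le> a"
  then obtain s where s: "0 < s" "s \<le> t" "b s \<le> a" by auto
  have "first_passage b a \<le> ennreal s" by (intro first_passage_lower s)
  also have "\<dots> \<le> ennreal t" by (intro ennreal_leI s)
  finally show "first_passage b a \<le> ennreal t" .
qed

lemma first_passage_pos: "a < b 0 \<Longrightarrow> 0 < first_passage b a"
  using first_passage_ge_near[of 0 a] by simp

lemma path_ge_first_passage:
  assumes s: "0 < s" and le: "ennreal s \<le> first_passage b a"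
  shows "a \<le> b s"
proof (rule ccontr)
  assume "\<not> a \<le> b s"
  then obtain d where d: "0 < d" "\<And>u. 0 \<le> u \<Longrightarrow> \<bar>u - s\<bar> < d \<Longrightarrow> \<bar>b u - b s\<bar> < a - b s"
    using path_near[of s "a - b s"] s by auto
  define u where "u = max (s / 2) (s - d / 2)"
  have u: "0 < u" "u < s" "\<bar>u - s\<bar> < d" using s d by (auto simp: u_def max_def)
  then have "b u \<le> a" using d(2)[of u] by auto
  then have "first_passage b a \<le> ennreal u" using u by (intro first_passage_lower)
  also have "\<dots> < ennreal s" using u by (intro ennreal_lessI) auto
  finally show False using le by simp
qed

lemma path_at_first_passage:
  assumes s: "0 < s" and eq: "first_passage b a = ennreal s"
  shows "b s = a"
proof (rule antisym)
  obtain u where u: "0 < u" "u \<le> s" "b u \<le> a" using first_passage_le_iff[OF s, of a] eq by auto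
  have "ennreal s \<le> ennreal u" using first_passage_lower[of u b a] u eq by simp
  then show "b s \<le> a" using u by (cases "u = s") auto
  show "a \<le> b s" using path_ge_first_passage[OF s] eq by simp
qed

lemma first_passage_zero: "b 0 < a \<Longrightarrow> first_passage b a = 0"
proof (rule ccontr)
  assume a: "b 0 < a" and "first_passage b a \<noteq> 0"
  then obtain e' where "0 < e'" "e' < first_passage b a" using dense by (metis not_gr_zero)
  then obtain e where e: "0 < e" "ennreal e < first_passage b a"
    by (cases e') (auto simp: ennreal_less_zero_iff)
  obtain d where d: "0 < d" "\<And>u. 0 \<le> u \<Longrightarrow> \<bar>u - 0\<bar> < d \<Longrightarrow> \<bar>b u - b 0\<bar> < a - b 0"
    using path_near[of 0 "a - b 0"] a by auto
  have "first_passage b a \<le> ennreal (min e (d / 2))"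
    using d(2)[of "min e (d/2)"] d(1) e by (intro first_passage_lower) (auto simp: min_def abs_if split: if_splits)
  also have "\<dots> \<le> ennreal e" by (intro ennreal_leI) simp
  finally show False using e by simp
qed

text \<open>Equal finite passage times would be one positive time at which the continuous path takes
  both values a and a'. The condition \<open>a < b 0\<close> is what makes that time
  positive.\<close>

lemma first_passage_strict:
  assumes "a < a'" "a < b 0" "first_passage b a' < \<infinity>"
  shows "first_passage b a' < first_passage b a"
proof (rule le_neq_trans)
  show "first_passage b a' \<le> first_passage b a" using assms by (intro first_passage_antimono) simp
  show "first_passage b a' \<noteq> first_passage b a"
  proof
    assume eq: "first_passage b a' = first_passage b a"
    obtain s where s: "first_passage b a = ennreal s" "0 \<le> s" using assms eq by (cases "first_passage b a") auto
    then have "0 < s" using first_passage_pos[OF assms(2)] by (auto simp: ennreal_less_zero_iff)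
    then show False using path_at_first_passage[of s a] path_at_first_passage[of s a'] eq s assms(1) by auto
  qed
qed

lemma left_limit:
  assumes "0 \<le> r" "r < t" "continuous_on UNIV l"
    and K: "\<And>s. r < s \<Longrightarrow> s < t \<Longrightarrow> j s = K"
  shows "Lim (at_left t) (\<lambda>s. b s + j s + l s) = b t + K + l t"
proof (rule tendsto_Lim)
  have "isCont b t" using cont assms
    by (intro continuous_on_interior[of "{0..}"]) auto
  then have b: "(b \<longlongrightarrow> b t) (at_left t)"
    by (auto simp: isCont_def intro: tendsto_mono[OF at_le])
  have "isCont l t" using assms(3) by (auto simp: continuous_on_eq_continuous_at)
  then have l: "(l \<longlongrightarrow> l t) (at_left t)"
    by (auto simp: isCont_def intro: tendsto_mono[OF at_le])
  have "eventually (\<lambda>s. s \<in> {r<..<t}) (at_left t)"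
    using eventually_at_left_real[OF assms(2)] .
  then have "eventually (\<lambda>s. j s = K) (at_left t)" by eventually_elim (use K in auto)
  then have j: "(j \<longlongrightarrow> K) (at_left t)" by (rule tendsto_eventually)
  show "((\<lambda>s. b s + j s + l s) \<longlongrightarrow> b t + K + l t) (at_left t)"
    by (intro tendsto_add b j l)
qed simp

end

section \<open>The (y,z) recursion solved by first passage times\<close>

locale yz_path = continuous_path +
  fixes y z :: real
  assumes b0: "0 < b 0" and y: "0 \<le> y" and yz: "y < z"
begin

text \<open>Indices are shifted by one: \<open>\<tau> k\<close> and \<open>size k\<close> belong to order \<open>Suc k\<close>.\<close>

definition size :: "nat \<Rightarrow> real" where
  "size k = (if k = 0 then z - min (b 0) y else z - y)"

text \<open>After n orders the jumps add up to \<open>y - level n\<close>, so the controlled path is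
  down to y when b is down to \<open>level n\<close>. The first order refills from
  \<open>min (b 0) y\<close>, and the later levels lie at multiples of z - y below that
  point.\<close>

definition level :: "nat \<Rightarrow> real" where
  "level n = y - (\<Sum>k<n. size k)"

definition \<tau> :: "nat \<Rightarrow> ennreal" where
  "\<tau> n = first_passage b (level n)"

definition jumps :: "nat \<Rightarrow> real \<Rightarrow> real" where
  "jumps n t = (\<Sum>k<n. if \<tau> k \<le> ennreal t then size k else 0)"

lemma size_pos: "0 < size k"
  using yz by (auto simp: size_def min_def)

lemma level_0: "level 0 = y"
  by (simp add: level_def)

lemma level_Suc: "level (Suc n) = min (b 0) y - real (Suc n) * (z - y)"
  by (induction n) (auto simp: level_def size_def algebra_simps)

lemma level_less: "level (Suc n) < level n"
  using size_pos[of n] by (simp add: level_def)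

lemma level_Suc_less: "level (Suc n) < b 0"
proof -
  have "0 < real (Suc n) * (z - y)" using yz by simp
  then show ?thesis unfolding level_Suc by linarith
qed

lemma \<tau>_Suc: "\<tau> n < \<infinity> \<Longrightarrow> \<tau> n < \<tau> (Suc n)"
  unfolding \<tau>_def by (intro first_passage_strict level_less level_Suc_less)

lemma \<tau>_Suc_le: "\<tau> n \<le> \<tau> (Suc n)"
  unfolding \<tau>_def using level_less[of n] by (intro first_passage_antimono) simp

lemma \<tau>_mono: "m \<le> n \<Longrightarrow> \<tau> m \<le> \<tau> n"
  using \<tau>_Suc_le by (rule lift_Suc_mono_le)

lemma \<tau>_Suc_pos: "0 < \<tau> (Suc n)"
  unfolding \<tau>_def by (intro first_passage_pos level_Suc_less)

lemma \<tau>_zero: "\<tau> n = 0 \<Longrightarrow> n = 0 \<and> b 0 \<le> y"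
  using \<tau>_Suc_pos[of "n - 1"] first_passage_pos[of y] by (cases n) (auto simp: \<tau>_def level_0 not_le[symmetric])

lemma \<tau>_not_zero: "0 < \<tau> n \<Longrightarrow> level n \<le> b 0 \<and> size n = z - y"
proof (cases n)
  case 0
  assume "0 < \<tau> n"
  then have "y \<le> b 0" using first_passage_zero[of y] 0 by (force simp: \<tau>_def level_0)
  then show ?thesis using 0 by (simp add: level_0 size_def)
next
  case (Suc m)
  then show ?thesis using level_Suc_less[of m] by (simp add: size_def)
qed

lemma jumps_mono: "s \<le> t \<Longrightarrow> jumps n s \<le> jumps n t"
  unfolding jumps_def using size_pos
  by (intro sum_mono) (auto dest: order_trans[OF _ ennreal_leI] intro: less_imp_le)

lemma jumps_nonneg: "0 \<le> jumps n t"
  unfolding jumps_def using size_pos by (intro sum_nonneg) (auto intro: less_imp_le)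

lemma jumps_all: "(\<And>k. k < n \<Longrightarrow> \<tau> k \<le> ennreal t) \<Longrightarrow> jumps n t = y - level n"
  by (simp add: jumps_def level_def)

text \<open>If jump n is already present at time s, the jumps total \<open>y - level (Suc n)\<close>
  while b has not yet gone below \<open>level (Suc n)\<close>; if not, one jump fewer counts and the
  induction hypothesis applies. Time 0 is excluded because the start may lie below y.\<close>

lemma jumps_ge:
  assumes "0 < s" "ennreal s \<le> \<tau> n"
  shows "y \<le> b s + jumps n s"
  using assms
proof (induction n)
  case 0
  then show ?case using path_ge_first_passage[of s y] by (simp add: \<tau>_def level_0 jumps_def)
next
  case (Suc n)
  show ?case
  proof (cases "\<tau> n \<le> ennreal s")
    case True
    then have "jumps (Suc n) s = y - level (Suc n)"
      using \<tau>_mono by (intro jumps_all) (metis less_Suc_eq_le order_trans)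
    moreover have "level (Suc n) \<le> b s"
      using Suc.prems by (intro path_ge_first_passage) (auto simp: \<tau>_def)
    ultimately show ?thesis by simp
  next
    case False
    then show ?thesis using Suc by (simp add: jumps_def)
  qed
qed

text \<open>The reason why reflection has not acted up to and including the time of the next order:
  the controlled path is at least y >= 0 at positive times, and it starts above 0.\<close>

lemma controlled_nonneg: "0 \<le> s \<Longrightarrow> ennreal s \<le> \<tau> n \<Longrightarrow> 0 \<le> b s + jumps n s"
  using jumps_ge[of s n] y b0 jumps_nonneg[of n 0] by (cases "s = 0") auto

sublocale stage: reflected_path b "jumps n" "\<lambda>t. b t + jumps n t" for n
  by unfold_locales (use cont jumps_mono b0 jumps_nonneg[of n 0] in auto)

text \<open>The closed form of \<open>yz_stage\<close>. Entry 0 and the default values for orders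
  not yet placed or never placed are those of \<open>no_orders\<close> and of the recursion, so that
  equality holds for the orders as functions.\<close>

definition stage_orders :: "nat \<Rightarrow> orders" where
  "stage_orders n = ((\<lambda>k. if k = 0 then 0 else if k \<le> n then \<tau> (k - 1) else \<infinity>),
     (\<lambda>k. if 1 \<le> k \<and> k \<le> n \<and> \<tau> (k - 1) \<noteq> \<infinity> then size (k - 1) else 0))"

lemma order_jumps_stage: "order_jumps (stage_orders n) t = jumps n t"
proof -
  have "order_jumps (stage_orders n) t
     = (\<Sum>k<n. if fst (stage_orders n) (Suc k) \<le> ennreal t then snd (stage_orders n) (Suc k) else 0)"
    unfolding order_jumps_def by (rule suminf_finite) (auto simp: stage_orders_def)
  also have "\<dots> = jumps n t"
    unfolding jumps_def stage_orders_def by (rule sum.cong) (auto simp: top_unique)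
  finally show ?thesis .
qed

lemma inventory_stage:
  "inventory b (stage_orders n) = (\<lambda>t. b t + jumps n t + skorokhod_term (\<lambda>t. b t + jumps n t) t)"
  by (simp add: inventory_def local_time_def order_jumps_stage stage.reflection_term_eq fun_eq_iff)

lemma orders_before:
  assumes t: "0 < t" and lt: "\<And>k. k < n \<Longrightarrow> \<tau> k < ennreal t"
  obtains r where "0 \<le> r" "r < t" "\<And>k. k < n \<Longrightarrow> \<tau> k \<le> ennreal r"
proof (cases n)
  case 0
  then show ?thesis using that[of 0] t by auto
next
  case (Suc m)
  then have "\<tau> m < ennreal t" using lt by auto
  moreover from this obtain r where r: "\<tau> m = ennreal r" "0 \<le> r" by (cases "\<tau> m") auto
  ultimately show ?thesis
    using that[of r] \<tau>_mono[of _ m] Suc by (simp add: ennreal_less_iff less_Suc_eq_le)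
qed

lemma \<tau>_before:
  assumes "\<tau> n = ennreal t" "k < n"
  shows "\<tau> k < ennreal t"
proof -
  have "\<tau> k < \<tau> (Suc k)"
    using \<tau>_mono[of k n] assms by (intro \<tau>_Suc) (auto simp: less_top[symmetric] top_unique)
  then show ?thesis using \<tau>_mono[of "Suc k" n] assms by auto
qed

lemma inventory_left_stage:
  assumes t: "0 < t" and r: "\<And>k. k < n \<Longrightarrow> \<tau> k < ennreal t"
  shows "inventory_left b (stage_orders n) t = b t + (y - level n) + skorokhod_term (\<lambda>t. b t + jumps n t) t"
proof -
  obtain r where r: "0 \<le> r" "r < t" "\<And>k. k < n \<Longrightarrow> \<tau> k \<le> ennreal r" using orders_before[OF assms] by blast
  have "jumps n s = y - level n" if "r < s" for s
    using that r(3) by (intro jumps_all) (meson ennreal_leI less_imp_le order_trans)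
  then show ?thesis
    unfolding inventory_left_def inventory_stage using t
    by (simp add: left_limit[OF r(1,2) stage.continuous_skorokhod])
qed

text \<open>The reflection term of stage n is nonnegative, so it cannot trigger an order before b is
  down to \<open>level n\<close>. Up to \<tau> n it is zero, so there the trigger does
  occur.\<close>

lemma stage_time:
  "(INF t\<in>{t. 0 \<le> t \<and> fst (stage_orders n) n < ennreal t \<and> inventory_left b (stage_orders n) t \<le> y}. ennreal t)
     = \<tau> n" (is "(INF t\<in>?A. ennreal t) = _")
proof -
  let ?l = "skorokhod_term (\<lambda>t. b t + jumps n t)"
  define T where "T = fst (stage_orders n) n"
  have before: "k < n \<Longrightarrow> ennreal t > T \<Longrightarrow> \<tau> k < ennreal t" for k t
    using \<tau>_mono[of k "n - 1"] le_less_trans[of "\<tau> k" T "ennreal t"]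
    by (auto simp: stage_orders_def T_def split: if_splits)
  have A: "?A = {t. 0 < t \<and> T < ennreal t \<and> b t + ?l t \<le> level n}"
  proof (intro Collect_cong)
    fix t
    have "0 < t" if "T < ennreal t"
      using le_less_trans[OF zero_le that] by (simp add: ennreal_less_zero_iff)
    moreover have "inventory_left b (stage_orders n) t = b t + (y - level n) + ?l t" if "T < ennreal t" "0 < t"
      using that before by (intro inventory_left_stage)
    ultimately show "(0 \<le> t \<and> fst (stage_orders n) n < ennreal t \<and> inventory_left b (stage_orders n) t \<le> y)
      \<longleftrightarrow> (0 < t \<and> T < ennreal t \<and> b t + ?l t \<le> level n)"
      unfolding T_def[symmetric] by auto
  qed
  have T\<tau>: "T < \<infinity> \<Longrightarrow> n \<noteq> 0 \<Longrightarrow> T < \<tau> n"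
    using \<tau>_Suc[of "n - 1"] by (auto simp: T_def stage_orders_def)
  show ?thesis
  proof (rule antisym)
    show "\<tau> n \<le> (INF t\<in>?A. ennreal t)"
    proof (rule INF_greatest)
      fix t assume "t \<in> ?A"
      then show "\<tau> n \<le> ennreal t"
        unfolding A \<tau>_def using stage.skorokhod_nonneg[of n t] by (intro first_passage_lower) auto
    qed
    have zero: "?l s = 0" if "0 \<le> s" "ennreal s \<le> \<tau> n" for s
    proof (rule stage.skorokhod_eq_0)
      fix u assume "0 \<le> u" "u \<le> max 0 s"
      then show "0 \<le> b u + jumps n u"
        using that by (intro controlled_nonneg order_trans[OF ennreal_leI that(2)]) auto
    qed
    show "(INF t\<in>?A. ennreal t) \<le> \<tau> n"
    proof (cases "\<tau> n")
      case (real s)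
      show ?thesis
      proof (cases "s = 0")
        case False
        then have s: "0 < s" using real by auto
        have "T < ennreal s"
        proof (cases "n = 0")
          case True then show ?thesis using s by (simp add: T_def stage_orders_def)
        next
          case False
          have "T \<le> \<tau> n" using \<tau>_mono[of "n - 1" n] False by (auto simp: T_def stage_orders_def)
          then have "T < \<infinity>" using real by (auto simp: top_unique less_top[symmetric])
          then show ?thesis using T\<tau> False real by simp
        qed
        then have "s \<in> ?A" unfolding A
          using s zero[of s] real path_at_first_passage[of s "level n"] by (auto simp: \<tau>_def)
        then have "(INF t\<in>?A. ennreal t) \<le> ennreal s" by (rule INF_lower)
        then show ?thesis using real by simp
      next
        case True
        then have n: "n = 0" "\<tau> 0 = 0" using real \<tau>_zero[of n] by auto
        then have T: "T = 0" by (simp add: T_def stage_orders_def)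
        \<comment> \<open>The infimum 0 is not attained, so arbitrarily small members of the set
          have to be exhibited. Within distance d of time 0 the path is positive and the reflection
          term is still zero.\<close>
        obtain d where d: "0 < d" "\<And>s. 0 \<le> s \<Longrightarrow> \<bar>s - 0\<bar> < d \<Longrightarrow> \<bar>b s - b 0\<bar> < b 0"
          using path_near[of 0 "b 0"] b0 by auto
        have l0: "?l s = 0" if "s < d" for s
        proof (rule stage.skorokhod_eq_0)
          fix u assume "0 \<le> u" "u \<le> max 0 s"
          then have "\<bar>b u - b 0\<bar> < b 0" using that d by (intro d(2)) auto
          then show "0 \<le> b u + jumps n u" using jumps_nonneg[of n u] by linarith
        qed
        have small: "(INF t\<in>?A. ennreal t) \<le> ennreal e" if e: "0 < e" for e
        proof -
          have "\<tau> 0 \<le> ennreal (min e (d / 2))" using n by simp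
          then obtain u where u: "0 < u" "u \<le> min e (d / 2)" "b u \<le> level 0"
            using first_passage_le_iff[of "min e (d / 2)" "level 0"] e d by (auto simp: \<tau>_def)
          then have "u \<in> ?A" unfolding A T using l0[of u] d n by auto
          then have "(INF t\<in>?A. ennreal t) \<le> ennreal u" by (rule INF_lower)
          also have "\<dots> \<le> ennreal e" using u by (intro ennreal_leI) auto
          finally show ?thesis .
        qed
        have "(INF t\<in>?A. ennreal t) \<le> 0"
          by (rule ennreal_le_epsilon) (use small in auto)
        then show ?thesis by simp
      qed
    qed simp
  qed
qed

text \<open>At a positive order time the left limit is y by continuity. At time 0 it is the initial
  inventory b 0 <= y, and this is where the exceptional first size \<open>z - min (b 0) y\<close>
  comes from.\<close>

lemma stage_size:
  assumes "\<tau> n \<noteq> \<infinity>"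
  shows "z - inventory_left b (stage_orders n) (enn2real (\<tau> n)) = size n"
proof (cases "\<tau> n")
  case (real s)
  show ?thesis
  proof (cases "s = 0")
    case True
    then have "n = 0" "b 0 \<le> y" using real \<tau>_zero[of n] by auto
    then show ?thesis using real True by (simp add: inventory_left_def size_def)
  next
    case False
    then have s: "0 < s" using real by auto
    note lt = \<tau>_before[OF real(2)]
    have "skorokhod_term (\<lambda>t. b t + jumps n t) s = 0"
      using real by (intro stage.skorokhod_eq_0 controlled_nonneg) (auto intro: ennreal_leI)
    then show ?thesis
      using real s inventory_left_stage[OF s lt] path_at_first_passage[OF s, of "level n"] \<tau>_not_zero[of n]
      by (simp add: \<tau>_def ennreal_less_zero_iff)
  qed
qed (use assms in simp)

lemma yz_stage_eq: "yz_stage b y z n = stage_orders n"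
proof (induction n)
  case 0
  show ?case by (auto simp: no_orders_def stage_orders_def fun_eq_iff)
next
  case (Suc n)
  show ?case
    unfolding yz_stage.simps Suc Let_def stage_time
    using stage_size[of n] by (auto simp: stage_orders_def fun_eq_iff le_Suc_eq)
qed

lemma fst_yz_orders: "fst (yz_orders b y z) (Suc k) = \<tau> k"
  by (simp add: yz_orders_def yz_stage_eq stage_orders_def)

lemma snd_yz_orders: "snd (yz_orders b y z) (Suc k) = (if \<tau> k = \<infinity> then 0 else size k)"
  by (simp add: yz_orders_def yz_stage_eq stage_orders_def)

text \<open>The path is bounded below on a compact interval while the levels decrease linearly, so
  only finitely many orders occur by time t and the series in \<open>order_jumps\<close> is a finite
  sum.\<close>

lemma eventually_\<tau>_greater: obtains K where "\<And>k. K \<le> k \<Longrightarrow> ennreal t < \<tau> k"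
proof -
  \<comment> \<open>The horizon is made positive, as \<open>first_passage_le_iff\<close>
    requires.\<close>
  let ?t = "max t 1"
  obtain m where m: "\<And>s. s \<in> {0..?t} \<Longrightarrow> m \<le> b s" using path_bdd_below[of ?t] by (meson bdd_below.E imageI)
  obtain K :: nat where K: "(min (b 0) y - m) / (z - y) < K" using reals_Archimedean2 by blast
  have "ennreal t < \<tau> (Suc K)"
  proof (rule ccontr)
    assume "\<not> ?thesis"
    then have "\<tau> (Suc K) \<le> ennreal ?t" by (auto simp: not_less intro: order_trans ennreal_leI)
    then obtain s where s: "0 < s" "s \<le> ?t" "b s \<le> level (Suc K)"
      using first_passage_le_iff[of ?t "level (Suc K)"] by (auto simp: \<tau>_def)
    have "min (b 0) y - m < real K * (z - y)" using K yz by (simp add: pos_divide_less_eq)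
    also have "\<dots> \<le> real (Suc K) * (z - y)" using yz by (intro mult_right_mono) auto
    finally have "level (Suc K) < m" unfolding level_Suc by simp
    then show False using s m[of s] by auto
  qed
  then show ?thesis using that[of "Suc K"] \<tau>_mono less_le_trans by blast
qed

lemma order_jumps_yz:
  assumes "\<And>k. K \<le> k \<Longrightarrow> ennreal t < \<tau> k"
  shows "order_jumps (yz_orders b y z) t = jumps K t"
proof -
  have "order_jumps (yz_orders b y z) t
     = (\<Sum>k<K. if \<tau> k \<le> ennreal t then (if \<tau> k = \<infinity> then 0 else size k) else 0)"
    unfolding order_jumps_def fst_yz_orders snd_yz_orders using assms
    by (intro suminf_finite) (auto simp: not_le[symmetric])
  also have "\<dots> = jumps K t" unfolding jumps_def by (rule sum.cong) (auto simp: top_unique)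
  finally show ?thesis .
qed

abbreviation "total_jumps \<equiv> order_jumps (yz_orders b y z)"

lemma total_jumps_mono: "s \<le> t \<Longrightarrow> total_jumps s \<le> total_jumps t"
proof -
  assume st: "s \<le> t"
  obtain K where K: "\<And>k. K \<le> k \<Longrightarrow> ennreal t < \<tau> k" using eventually_\<tau>_greater by blast
  then have "\<And>k. K \<le> k \<Longrightarrow> ennreal s < \<tau> k" using st by (meson ennreal_leI le_less_trans)
  then show ?thesis using jumps_mono[OF st] order_jumps_yz K by metis
qed

lemma total_nonneg: "0 \<le> t \<Longrightarrow> 0 \<le> b t + total_jumps t"
  by (metis controlled_nonneg eventually_\<tau>_greater less_imp_le order_jumps_yz order_refl)

sublocale total: reflected_path b total_jumps "\<lambda>t. b t + total_jumps t"
  by unfold_locales (use cont total_jumps_mono total_nonneg[of 0] in auto)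

text \<open>This covers y = 0: the order is placed at the moment when 0 is reached, so path plus
  jumps never becomes negative and no emergency order arises.\<close>

lemma local_time_yz: "local_time b (yz_orders b y z) t = 0"
  unfolding local_time_def total.reflection_term_eq
  by (intro total.skorokhod_eq_0 total_nonneg)

lemma inventory_yz: "inventory b (yz_orders b y z) t = b t + total_jumps t"
  by (simp add: inventory_def local_time_yz)

text \<open>Supplies both arguments of \<open>order_cost\<close>. An order at time 0 starts from the
  initial inventory, which may be below y; hence \<open>z - size k\<close> instead of y.\<close>

lemma inventory_at_order:
  assumes "\<tau> k = ennreal t" "0 \<le> t"
  shows "inventory b (yz_orders b y z) t = z"
    and "inventory_left b (yz_orders b y z) t = z - size k"
proof -
  have lt: "ennreal t < \<tau> (Suc k)" using \<tau>_Suc[of k] assms by simp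
  have J: "total_jumps s = jumps (Suc k) s" if "s \<le> t" for s
  proof (rule order_jumps_yz)
    fix i assume "Suc k \<le> i"
    then show "ennreal s < \<tau> i" using lt \<tau>_mono[of "Suc k" i] that by (meson ennreal_leI le_less_trans less_le_trans)
  qed
  have all: "jumps (Suc k) t = y - level (Suc k)"
    using \<tau>_mono assms by (intro jumps_all) (metis less_Suc_eq_le)
  then have inv: "inventory b (yz_orders b y z) t = b t + (y - level (Suc k))"
    using J[of t] by (simp add: inventory_yz)
  have lev: "level (Suc k) = level k - size k" by (simp add: level_def)
  consider "t = 0" | "0 < t" using assms by linarith
  then have "inventory b (yz_orders b y z) t = z \<and> inventory_left b (yz_orders b y z) t = z - size k"
  proof cases
    case 1
    then have "k = 0" "b 0 \<le> y" using \<tau>_zero[of k] assms by auto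
    then show ?thesis using inv lev 1 by (auto simp: level_0 size_def inventory_left_def)
  next
    case 2
    have bt: "b t = level k" using path_at_first_passage[OF 2] assms by (simp add: \<tau>_def)
    have sz: "size k = z - y" using \<tau>_not_zero[of k] assms 2 by (simp add: ennreal_less_zero_iff)
    obtain r where r: "0 \<le> r" "r < t" "\<And>i. i < k \<Longrightarrow> \<tau> i \<le> ennreal r"
      using orders_before[OF 2 \<tau>_before[OF assms(1)]] by blast
    have "total_jumps s = y - level k" if "r < s" "s < t" for s
    proof -
      have "\<not> \<tau> k \<le> ennreal s" using assms that r by (simp add: ennreal_less_iff not_le)
      then have "jumps (Suc k) s = jumps k s" by (simp add: jumps_def)
      also have "\<dots> = y - level k" using r(3) that by (intro jumps_all) (meson ennreal_leI less_imp_le order_trans)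
      finally show ?thesis using J[of s] that by simp
    qed
    then have "Lim (at_left t) (\<lambda>s. b s + total_jumps s + 0) = b t + (y - level k) + 0"
      by (intro left_limit[OF r(1,2)]) auto
    moreover have "inventory b (yz_orders b y z) = (\<lambda>s. b s + total_jumps s + 0)"
      by (simp add: fun_eq_iff inventory_yz)
    ultimately show ?thesis using inv lev bt sz 2 by (simp add: inventory_left_def)
  qed
  then show "inventory b (yz_orders b y z) t = z"
    and "inventory_left b (yz_orders b y z) t = z - size k" by auto
qed

end

section \<open>Fourth moments of the oscillation of Brownian motion\<close>

definition grid :: "real \<Rightarrow> real \<Rightarrow> nat \<Rightarrow> nat \<Rightarrow> real" where
  "grid a b n i = a + (b - a) * real i / real (Suc n)"

lemma grid_0 [simp]: "grid a b n 0 = a"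
  by (simp add: grid_def)

lemma grid_Suc_n [simp]: "grid a b n (Suc n) = b"
  by (simp add: grid_def del: of_nat_Suc)

lemma grid_mono: "a \<le> b \<Longrightarrow> i \<le> j \<Longrightarrow> grid a b n i \<le> grid a b n j"
  unfolding grid_def by (intro add_left_mono divide_right_mono mult_left_mono) auto

lemma grid_bounds: "a \<le> b \<Longrightarrow> i \<le> Suc n \<Longrightarrow> a \<le> grid a b n i \<and> grid a b n i \<le> b"
  using grid_mono[of a b 0 i n] grid_mono[of a b i "Suc n" n] by simp

text \<open>Rounding x up to the grid. For a = b all grid points coincide, which accounts for the
  exception in the last clause.\<close>

lemma grid_above:
  assumes "a \<le> x" "x \<le> b"
  obtains i where "i \<le> Suc n" "x \<le> grid a b n i" "grid a b n i < x + (b - a) / real (Suc n) \<or> grid a b n i = x"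
    "\<And>j. x \<le> grid a b n j \<longleftrightarrow> i \<le> j \<or> a = b"
proof (cases "a = b")
  case True
  then show ?thesis using assms by (intro that[of 0]) (auto simp: grid_def)
next
  case False
  then have ab: "a < b" using assms by simp
  define d where "d = (b - a) / real (Suc n)"
  have d: "0 < d" and b: "b = a + d * real (Suc n)" using ab by (auto simp: d_def simp del: of_nat_Suc)
  have grid: "grid a b n j = a + d * real j" for j by (simp add: grid_def d_def)
  define w where "w = (x - a) / d"
  have w: "0 \<le> w" "w \<le> real (Suc n)"
    using assms d by (auto simp: w_def field_simps b simp del: of_nat_Suc)
  have iff: "x \<le> grid a b n j \<longleftrightarrow> w \<le> real j" for j
    using d by (auto simp: w_def grid field_simps)
  have iff': "grid a b n j < x + (b - a) / real (Suc n) \<longleftrightarrow> real j < w + 1" for j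
    unfolding d_def[symmetric] grid using d by (auto simp: w_def field_simps)
  define i where "i = nat \<lceil>w\<rceil>"
  have i: "real i = of_int \<lceil>w\<rceil>" using w by (simp add: i_def)
  show ?thesis
  proof (rule that[of i])
    show "i \<le> Suc n" using w by (simp add: i_def nat_le_iff ceiling_le_iff)
    show "x \<le> grid a b n i" unfolding iff i by linarith
    show "grid a b n i < x + (b - a) / real (Suc n) \<or> grid a b n i = x" unfolding iff' i by linarith
    show "x \<le> grid a b n j \<longleftrightarrow> i \<le> j \<or> a = b" for j
      unfolding iff using False w by (auto simp: i_def nat_le_iff ceiling_le_iff)
  qed
qed

text \<open>Round a maximum point x up to the grid: the values of f there tend to f x, and the grid
  maximum lies between them and f x.\<close>

lemma grid_Max_tendsto:
  fixes f :: "real \<Rightarrow> real"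
  assumes ab: "a \<le> b" and f: "continuous_on {a..b} f"
  shows "(\<lambda>n. MAX i\<in>{..Suc n}. f (grid a b n i)) \<longlonglongrightarrow> (SUP s\<in>{a..b}. f s)"
proof -
  have "compact {a..b}" "{a..b} \<noteq> {}" using ab by auto
  then obtain x where x: "x \<in> {a..b}" "\<And>u. u \<in> {a..b} \<Longrightarrow> f u \<le> f x"
    using continuous_attains_sup[OF _ _ f] by blast
  have sup: "(SUP s\<in>{a..b}. f s) = f x" using x ab by (intro cSup_eq_maximum) auto
  have "\<forall>n. \<exists>i. i \<le> Suc n \<and> x \<le> grid a b n i \<and> grid a b n i \<le> x + (b - a) / real (Suc n)"
  proof
    fix n
    have "a \<le> x" "x \<le> b" using x by auto
    then obtain i where "i \<le> Suc n" "x \<le> grid a b n i"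
      "grid a b n i < x + (b - a) / real (Suc n) \<or> grid a b n i = x" by (rule grid_above)
    then show "\<exists>i. i \<le> Suc n \<and> x \<le> grid a b n i \<and> grid a b n i \<le> x + (b - a) / real (Suc n)"
      using ab by (intro exI[of _ i]) (auto simp: add_increasing2)
  qed
  then obtain i where i: "\<And>n. i n \<le> Suc n" "\<And>n. x \<le> grid a b n (i n)"
      "\<And>n. grid a b n (i n) \<le> x + (b - a) / real (Suc n)" by metis
  have "(\<lambda>n. x + (b - a) / real (Suc n)) \<longlonglongrightarrow> x"
    using tendsto_add[OF tendsto_const[of x] tendsto_mult[OF tendsto_const[of "b-a"] LIMSEQ_inverse_real_of_nat]]
    by (simp add: divide_inverse)
  then have lim: "(\<lambda>n. grid a b n (i n)) \<longlonglongrightarrow> x"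
    by (rule tendsto_sandwich[OF _ _ tendsto_const, rotated -1]) (use i in auto)
  have "(\<lambda>n. f (grid a b n (i n))) \<longlonglongrightarrow> f x"
    using ab i x by (intro continuous_on_tendsto_compose[OF f lim]) (auto simp: grid_bounds)
  then show ?thesis unfolding sup
  proof (rule tendsto_sandwich[OF _ _ _ tendsto_const, rotated 2])
    show "\<forall>\<^sub>F n in sequentially. f (grid a b n (i n)) \<le> (MAX i\<in>{..Suc n}. f (grid a b n i))"
      using i by (intro always_eventually allI Max_ge) auto
    show "\<forall>\<^sub>F n in sequentially. (MAX i\<in>{..Suc n}. f (grid a b n i)) \<le> f x"
      using x grid_bounds[OF ab] by (intro always_eventually allI Max.boundedI) auto
  qed
qed

lemma grid_Min_tendsto:
  fixes f :: "real \<Rightarrow> real"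
  assumes ab: "a \<le> b" and f: "continuous_on {a..b} f"
  shows "(\<lambda>n. MIN i\<in>{..Suc n}. f (grid a b n i)) \<longlonglongrightarrow> (INF s\<in>{a..b}. f s)"
proof -
  have "(\<lambda>n. - (MAX i\<in>{..Suc n}. - f (grid a b n i))) \<longlonglongrightarrow> - (SUP s\<in>{a..b}. - f s)"
    by (intro tendsto_minus grid_Max_tendsto ab continuous_intros f)
  also have "- (SUP s\<in>{a..b}. - f s) = (INF s\<in>{a..b}. f s)"
    by (simp add: Inf_real_def image_image)
  also have "(\<lambda>n. - (MAX i\<in>{..Suc n}. - f (grid a b n i))) = (\<lambda>n. MIN i\<in>{..Suc n}. f (grid a b n i))"
    by (rule ext) (simp add: image_image)
  finally show ?thesis .
qed

lemma Max_atMost_Suc: "(MAX i\<in>{..Suc n}. S i) = max (S (Suc n)) (MAX i\<in>{..n}. (S i :: real))"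
  by (simp add: atMost_Suc)

text \<open>A discrete Azema--Yor inequality for the maximum, in pathwise form: for a martingale \<open>S\<close> the sum on the
  left has expectation zero.\<close>

lemma pathwise_maximal_inequality:
  fixes S :: "nat \<Rightarrow> real"
  assumes S0: "S 0 = 0"
  defines "A \<equiv> \<lambda>n. MAX i\<in>{..n}. S i"
  shows "A n ^ 4 + (\<Sum>i<n. 4 * A i ^ 3 * (S (Suc i) - S i)) \<le> 27 / 8 * S n ^ 4"
proof -
  have A0: "0 \<le> A n" for n
    unfolding A_def using S0 Max_ge[of "S ` {..n}" "S 0"] by auto
  have "3 * A n ^ 4 + (\<Sum>i<n. 4 * A i ^ 3 * (S (Suc i) - S i)) \<le> 4 * A n ^ 3 * S n"
  proof (induction n)
    case 0
    then show ?case by (simp add: A_def S0)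
  next
    case (Suc n)
    have ASuc: "A (Suc n) = max (S (Suc n)) (A n)" unfolding A_def by (rule Max_atMost_Suc)
    show ?case
    proof (cases "S (Suc n) \<le> A n")
      case True
      then show ?thesis using Suc ASuc by (simp add: algebra_simps)
    next
      case False
      define m s where "m = A n" and "s = S (Suc n)"
      \<comment> \<open>A new maximum s is reached. The induction step then needs the
        arithmetic-geometric inequality 4 m^3 s <= 3 m^4 + s^4, seen from the factorization of the
        difference.\<close>
      have "0 \<le> (s - m)\<^sup>2 * ((s + m)\<^sup>2 + 2 * m\<^sup>2)" by simp
      also have "\<dots> = s ^ 4 - 4 * m ^ 3 * s + 3 * m ^ 4" by algebra
      finally have "4 * m ^ 3 * s \<le> s ^ 4 + 3 * m ^ 4" by simp
      moreover have "A (Suc n) = s" using False ASuc by (simp add: s_def)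
      moreover have "4 * s ^ 3 * s = 4 * s ^ 4" by algebra
      ultimately show ?thesis using Suc
        unfolding sum.lessThan_Suc m_def[symmetric] s_def[symmetric] by (simp add: algebra_simps)
    qed
  qed
  moreover have "4 * A n ^ 3 * S n \<le> 2 * A n ^ 4 + 27 / 8 * S n ^ 4"
  proof -
    \<comment> \<open>Young's inequality with equality at 3 S = 2 A. Spending 2 A^4 here leaves one
      A^4 of the three on the left-hand side, and this choice fixes the constant 27/8.\<close>
    have "0 \<le> (S n - 2 / 3 * A n)\<^sup>2 * (9 / 4 * (S n + A n)\<^sup>2 + 9 / 4 * (A n)\<^sup>2 + 9 / 8 * (S n)\<^sup>2)"
      by (intro mult_nonneg_nonneg add_nonneg_nonneg) auto
    also have "\<dots> = 2 * A n ^ 4 + 27 / 8 * S n ^ 4 - 4 * A n ^ 3 * S n"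
      by (simp add: field_simps power2_eq_square power4_eq_xxxx power3_eq_cube)
    finally show ?thesis by simp
  qed
  ultimately show ?thesis by simp
qed

section \<open>Orthogonality of Brownian increments and moments of the oscillation\<close>

locale brownian_motion = prob_space M for M :: "'a measure" +
  fixes W :: "real \<Rightarrow> 'a \<Rightarrow> real"
  assumes bm: "standard_brownian_motion M W"
begin

lemma W_meas [measurable]: "0 \<le> t \<Longrightarrow> W t \<in> borel_measurable M"
  using bm by (auto simp: standard_brownian_motion_def)

lemma W_0: "\<omega> \<in> space M \<Longrightarrow> W 0 \<omega> = 0"
  using bm by (auto simp: standard_brownian_motion_def)

lemma W_cont: "\<omega> \<in> space M \<Longrightarrow> continuous_on {0..} (\<lambda>t. W t \<omega>)"
  using bm by (auto simp: standard_brownian_motion_def)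

lemma increment_moments:
  assumes "0 \<le> s" "s \<le> t"
  shows integrable_increment: "integrable M (\<lambda>\<omega>. (W t \<omega> - W s \<omega>) ^ k)" (is ?I)
    and expectation_increment: "expectation (\<lambda>\<omega>. W t \<omega> - W s \<omega>) = 0" (is ?E1)
    and expectation_increment2: "expectation (\<lambda>\<omega>. (W t \<omega> - W s \<omega>)\<^sup>2) = t - s" (is ?E2)
    and expectation_increment4: "expectation (\<lambda>\<omega>. (W t \<omega> - W s \<omega>) ^ 4) = 3 * (t - s)\<^sup>2" (is ?E4)
proof -
  have "?I \<and> ?E1 \<and> ?E2 \<and> ?E4"
  proof (cases "s = t")
    case True
    then show ?thesis by (cases k) auto
  next
    case False
    define r where "r = sqrt (t - s)"
    have r: "0 < r" and r2: "r\<^sup>2 = t - s" using False assms by (auto simp: r_def)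
    have D: "distributed M lborel (\<lambda>\<omega>. W t \<omega> - W s \<omega>) (\<lambda>x. ennreal (normal_density 0 r x))"
      using bm False assms by (auto simp: standard_brownian_motion_def r_def)
    have int: "(\<integral>x. normal_density 0 r x * x ^ k \<partial>lborel) = expectation (\<lambda>\<omega>. (W t \<omega> - W s \<omega>) ^ k)" for k
      by (rule distributed_integral[OF D]) auto
    have "integrable M (\<lambda>\<omega>. (W t \<omega> - W s \<omega>) ^ k)"
      using integrable_normal_moment[OF r, of 0 k] by (subst distributed_integrable[OF D, symmetric]) auto
    moreover have "expectation (\<lambda>\<omega>. W t \<omega> - W s \<omega>) = 0"
      using int[of 1] integral_normal_moment_odd[OF r, of 0 0] by simp
    moreover have "expectation (\<lambda>\<omega>. (W t \<omega> - W s \<omega>)\<^sup>2) = t - s"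
      using int[of 2] integral_normal_moment_even[OF r, of 0 1] r r2 by simp
    moreover have "expectation (\<lambda>\<omega>. (W t \<omega> - W s \<omega>) ^ 4) = 3 * (t - s)\<^sup>2"
      using int[of 4] integral_normal_moment_even[OF r, of 0 2] r
      by (simp add: r2[symmetric] fact_numeral power2_eq_square power4_eq_xxxx field_simps)
    ultimately show ?thesis by blast
  qed
  then show ?I ?E1 ?E2 ?E4 by blast+
qed

text \<open>The martingale property in the form that finite-dimensional independence yields
  directly: G is a function of the increments up to \<open>u n\<close>, hence independent of the
  next increment, which has mean zero. Independence also makes the product integrable for unbounded
  G.\<close>

lemma increment_orthogonal:
  assumes u: "0 \<le> u 0" "\<And>i. i < n \<Longrightarrow> u i \<le> u (Suc i)" "u n \<le> t"
    and g [measurable]: "g \<in> borel_measurable (PiM {..n} (\<lambda>_. borel))"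
    and G: "\<And>\<omega>. \<omega> \<in> space M \<Longrightarrow> G \<omega> = g (\<lambda>i\<in>{..n}. W (u i) \<omega> - W (u 0) \<omega>)"
    and int: "integrable M G"
  shows "integrable M (\<lambda>\<omega>. G \<omega> * (W t \<omega> - W (u n) \<omega>))"
    and "expectation (\<lambda>\<omega>. G \<omega> * (W t \<omega> - W (u n) \<omega>)) = (0::real)"
proof -
  \<comment> \<open>Appending t after \<open>u n\<close> makes the next increment the one with index
    n; the values relative to \<open>u 0\<close> are partial sums of the earlier increments.\<close>
  define v where "v i = (if i \<le> n then u i else t)" for i
  define X where "X i \<omega> = W (v (Suc i)) \<omega> - W (v i) \<omega>" for i \<omega>
  have "0 \<le> v 0 \<and> (\<forall>i<Suc n. v i \<le> v (Suc i))" using u by (auto simp: v_def le_Suc_eq less_Suc_eq)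
  then have ind: "indep_vars (\<lambda>_. borel) X {..<Suc n}"
    using bm unfolding standard_brownian_motion_def X_def by blast
  have sub: "{..<n} \<inter> {n} = {}" "{..<n} \<subseteq> {..<Suc n}" "{n} \<subseteq> {..<Suc n}" by auto
  have Y1: "(\<lambda>x. g (\<lambda>i\<in>{..n}. \<Sum>j<i. x j)) \<in> borel_measurable (PiM {..<n} (\<lambda>_. borel))"
  proof (rule measurable_compose[OF _ g], rule measurable_restrict)
    fix i assume i: "i \<in> {..n}"
    show "(\<lambda>x. \<Sum>j<i. x j :: real) \<in> borel_measurable (PiM {..<n} (\<lambda>_. borel))"
      using i by (intro borel_measurable_sum measurable_component_singleton) auto
  qed
  have Y2: "(\<lambda>x. x n) \<in> borel_measurable (PiM {n} (\<lambda>_. borel))"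
    by (intro measurable_component_singleton) auto
  note iv = indep_var_compose[OF indep_var_restrict[OF ind sub] Y1 Y2]
  let ?X1 = "(\<lambda>x. g (\<lambda>i\<in>{..n}. \<Sum>j<i. x j)) \<circ> (\<lambda>\<omega>. \<lambda>i\<in>{..<n}. X i \<omega>)"
  let ?X2 = "(\<lambda>x. x n) \<circ> (\<lambda>\<omega>. \<lambda>i\<in>{n}. X i \<omega>)"
  have tel: "(\<Sum>j<i. X j \<omega>) = W (u i) \<omega> - W (u 0) \<omega>" if "i \<le> n" for i \<omega>
    using sum_lessThan_telescope[of "\<lambda>i. W (v i) \<omega>" i] that by (simp add: X_def v_def)
  have X1: "?X1 \<omega> = G \<omega>" if "\<omega> \<in> space M" for \<omega>
  proof -
    have "(\<lambda>i\<in>{..n}. \<Sum>j<i. (\<lambda>i\<in>{..<n}. X i \<omega>) j) = (\<lambda>i\<in>{..n}. W (u i) \<omega> - W (u 0) \<omega>)"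
      by (rule restrict_ext) (auto simp: tel[symmetric] intro!: sum.cong)
    then show ?thesis using G[OF that] by simp
  qed
  have X2: "?X2 = (\<lambda>\<omega>. W t \<omega> - W (u n) \<omega>)"
    by (auto simp: X_def v_def fun_eq_iff)
  have un: "0 \<le> u n"
  proof -
    have "u 0 \<le> u i" if "i \<le> n" for i using that
      by (induction i) (auto intro: order_trans[OF _ u(2)])
    then show ?thesis using u by force
  qed
  have i1: "integrable M ?X1" using int X1 by (subst Bochner_Integration.integrable_cong[OF refl X1]) auto
  have i2: "integrable M ?X2" unfolding X2 using integrable_increment[OF un u(3), of 1] by simp
  have "integrable M (\<lambda>\<omega>. ?X1 \<omega> * ?X2 \<omega>)" by (rule indep_var_integrable[OF iv i1 i2])
  then show "integrable M (\<lambda>\<omega>. G \<omega> * (W t \<omega> - W (u n) \<omega>))"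
    using X1 by (subst Bochner_Integration.integrable_cong[OF refl, of M _ "\<lambda>\<omega>. ?X1 \<omega> * ?X2 \<omega>"]) (auto simp: X2)
  have "expectation (\<lambda>\<omega>. ?X1 \<omega> * ?X2 \<omega>) = expectation ?X1 * expectation ?X2"
    by (rule indep_var_lebesgue_integral[OF iv i1 i2])
  also have "\<dots> = 0" unfolding X2 using expectation_increment[OF un u(3)] by simp
  finally show "expectation (\<lambda>\<omega>. G \<omega> * (W t \<omega> - W (u n) \<omega>)) = 0"
    using X1 by (subst Bochner_Integration.integral_cong[OF refl, of M _ "\<lambda>\<omega>. ?X1 \<omega> * ?X2 \<omega>"]) (auto simp: X2)
qed

text \<open>Expectation of the pathwise inequality: \<open>A n j\<close> depends only on the path up
  to the j-th grid point, so its cube times the next increment has mean zero. The sign c covers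
  maxima and, as c = -1, minima; 81/8 is 27/8 times the fourth moment 3 h^2 of the increment over
  the whole interval.\<close>

lemma grid_maximum_moment:
  assumes s: "0 \<le> s" and h: "0 \<le> h" and c: "\<bar>c\<bar> = 1"
  defines "S \<equiv> \<lambda>n i \<omega>. c * (W (grid s (s + h) n i) \<omega> - W s \<omega>)"
  defines "A \<equiv> \<lambda>n j \<omega>. MAX i\<in>{..j}. S n i \<omega>"
  shows "integrable M (\<lambda>\<omega>. A n (Suc n) \<omega> ^ 4)"
    and "expectation (\<lambda>\<omega>. A n (Suc n) \<omega> ^ 4) \<le> 81 / 8 * h\<^sup>2"
proof -
  have gs: "s \<le> grid s (s + h) n i" "0 \<le> grid s (s + h) n i" for i
    using grid_mono[of s "s + h" 0 i n] h s by auto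
  have S0: "S n 0 \<omega> = 0" for \<omega> by (simp add: S_def)
  have A0: "0 \<le> A n j \<omega>" for j \<omega>
    unfolding A_def using S0[of \<omega>] Max_ge[of "(\<lambda>i. S n i \<omega>) ` {..j}" "S n 0 \<omega>"] by auto
  have S_meas [measurable]: "S n i \<in> borel_measurable M" for i
    unfolding S_def using gs s by measurable
  have A_meas [measurable]: "A n j \<in> borel_measurable M" for j
    unfolding A_def by (intro borel_measurable_Max) auto
  have S_int: "integrable M (\<lambda>\<omega>. S n i \<omega> ^ 4)" for i
    unfolding S_def power_mult_distrib using integrable_increment[OF s gs(1)] by auto
  have A_le: "A n j \<omega> ^ 4 \<le> (\<Sum>i\<le>j. S n i \<omega> ^ 4)" for j \<omega>
  proof -
    have "A n j \<omega> \<in> (\<lambda>i. S n i \<omega>) ` {..j}" unfolding A_def by (intro Max_in) auto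
    then obtain i where "i \<le> j" "A n j \<omega> = S n i \<omega>" by auto
    then show ?thesis using member_le_sum[of i "{..j}" "\<lambda>i. S n i \<omega> ^ 4"] by (auto simp: zero_le_even_power)
  qed
  have A_int: "integrable M (\<lambda>\<omega>. A n j \<omega> ^ 4)" for j
    by (rule Bochner_Integration.integrable_bound[of _ "\<lambda>\<omega>. \<Sum>i\<le>j. S n i \<omega> ^ 4"])
       (use A_le S_int in \<open>auto intro!: AE_I2 order_trans[OF _ abs_ge_self]\<close>)
  then show "integrable M (\<lambda>\<omega>. A n (Suc n) \<omega> ^ 4)" .
  have A3_int: "integrable M (\<lambda>\<omega>. A n j \<omega> ^ 3)" for j
  proof (rule Bochner_Integration.integrable_bound[of _ "\<lambda>\<omega>. 1 + A n j \<omega> ^ 4"])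
    have "x ^ 3 \<le> 1 + x ^ 4" if "0 \<le> x" for x :: real
    proof (cases "x \<le> 1")
      case True
      then have "x ^ 3 \<le> 1" by (rule power_le_one[OF that])
      then show ?thesis by (smt (verit) zero_le_even_power even_numeral)
    next
      case False
      then have "x ^ 3 \<le> x ^ 4" by (intro power_increasing) auto
      then show ?thesis by simp
    qed
    then show "AE \<omega> in M. norm (A n j \<omega> ^ 3) \<le> norm (1 + A n j \<omega> ^ 4)"
      using A0 by (auto simp: abs_of_nonneg add_nonneg_nonneg)
  qed (use A_int in auto)
  have orth: "integrable M (\<lambda>\<omega>. A n j \<omega> ^ 3 * (S n (Suc j) \<omega> - S n j \<omega>))"
    "expectation (\<lambda>\<omega>. A n j \<omega> ^ 3 * (S n (Suc j) \<omega> - S n j \<omega>)) = 0" for j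
  proof -
    let ?g = "\<lambda>x. (MAX i\<in>{..j}. c * x i) ^ 3"
    have g: "?g \<in> borel_measurable (PiM {..j} (\<lambda>_. borel))"
      by (intro borel_measurable_power borel_measurable_Max borel_measurable_times measurable_component_singleton) auto
    have G: "A n j \<omega> ^ 3 = ?g (\<lambda>i\<in>{..j}. W (grid s (s+h) n i) \<omega> - W (grid s (s+h) n 0) \<omega>)" for \<omega>
      unfolding A_def S_def by (intro arg_cong[where f="\<lambda>x. Max x ^ 3"] image_cong) auto
    have u: "0 \<le> grid s (s + h) n 0" "\<And>i. i < j \<Longrightarrow> grid s (s + h) n i \<le> grid s (s + h) n (Suc i)"
      "grid s (s + h) n j \<le> grid s (s + h) n (Suc j)"
      using s h by (auto intro!: grid_mono)
    have eq: "A n j \<omega> ^ 3 * (S n (Suc j) \<omega> - S n j \<omega>)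
      = c * (A n j \<omega> ^ 3 * (W (grid s (s+h) n (Suc j)) \<omega> - W (grid s (s+h) n j) \<omega>))" for \<omega>
      by (simp add: S_def algebra_simps)
    note * = increment_orthogonal[OF u g G A3_int]
    show "integrable M (\<lambda>\<omega>. A n j \<omega> ^ 3 * (S n (Suc j) \<omega> - S n j \<omega>))"
      "expectation (\<lambda>\<omega>. A n j \<omega> ^ 3 * (S n (Suc j) \<omega> - S n j \<omega>)) = 0"
      unfolding eq using * by auto
  qed
  have "expectation (\<lambda>\<omega>. A n (Suc n) \<omega> ^ 4)
     = expectation (\<lambda>\<omega>. A n (Suc n) \<omega> ^ 4 + (\<Sum>i<Suc n. 4 * (A n i \<omega> ^ 3 * (S n (Suc i) \<omega> - S n i \<omega>))))"
    using orth A_int by (subst Bochner_Integration.integral_add) auto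
  also have "\<dots> \<le> expectation (\<lambda>\<omega>. 27 / 8 * S n (Suc n) \<omega> ^ 4)"
  proof (rule integral_mono)
    fix \<omega>
    show "A n (Suc n) \<omega> ^ 4 + (\<Sum>i<Suc n. 4 * (A n i \<omega> ^ 3 * (S n (Suc i) \<omega> - S n i \<omega>))) \<le> 27 / 8 * S n (Suc n) \<omega> ^ 4"
      using pathwise_maximal_inequality[of "\<lambda>i. S n i \<omega>" "Suc n"] S0 by (simp only: A_def mult.assoc)
  qed (use orth A_int S_int in auto)
  also have "\<dots> = 81 / 8 * h\<^sup>2"
  proof -
    have "c ^ 4 = 1" using c by (metis power_even_abs even_numeral power_one)
    then have "S n (Suc n) \<omega> ^ 4 = (W (s + h) \<omega> - W s \<omega>) ^ 4" for \<omega>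
      by (simp add: S_def power_mult_distrib)
    then show ?thesis using expectation_increment4[of s "s + h"] s h by simp
  qed
  finally show "expectation (\<lambda>\<omega>. A n (Suc n) \<omega> ^ 4) \<le> 81 / 8 * h\<^sup>2" .
qed

definition osc :: "real \<Rightarrow> real \<Rightarrow> 'a \<Rightarrow> real" where
  "osc s h \<omega> = (SUP u\<in>{s..s+h}. \<bar>W u \<omega> - W s \<omega>\<bar>)"

lemma osc_upper:
  assumes "\<omega> \<in> space M" "0 \<le> s" "s \<le> u" "u \<le> s + h"
  shows "\<bar>W u \<omega> - W s \<omega>\<bar> \<le> osc s h \<omega>"
proof -
  have "compact ((\<lambda>u. \<bar>W u \<omega> - W s \<omega>\<bar>) ` {s..s+h})" using assms
    by (intro compact_continuous_image continuous_intros continuous_on_subset[OF W_cont]) auto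
  then have "bdd_above ((\<lambda>u. \<bar>W u \<omega> - W s \<omega>\<bar>) ` {s..s+h})"
    by (intro bounded_imp_bdd_above compact_imp_bounded)
  then show ?thesis unfolding osc_def using assms by (intro cSUP_upper) auto
qed

lemma osc_nonneg: "\<omega> \<in> space M \<Longrightarrow> 0 \<le> s \<Longrightarrow> 0 \<le> h \<Longrightarrow> 0 \<le> osc s h \<omega>"
  using osc_upper[of \<omega> s s h] by simp

lemma osc_tendsto:
  assumes "\<omega> \<in> space M" "0 \<le> s" "0 \<le> h"
  shows "(\<lambda>n. MAX i\<in>{..Suc n}. \<bar>W (grid s (s+h) n i) \<omega> - W s \<omega>\<bar>) \<longlonglongrightarrow> osc s h \<omega>"
  unfolding osc_def using assms
  by (intro grid_Max_tendsto continuous_intros continuous_on_subset[OF W_cont]) auto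

text \<open>The grid maximum of |W u - W s| is at most one of the two one-sided maxima, whence twice
  81/8. The bound is uniform in the grid, and Fatou's lemma carries it to the supremum over the
  interval.\<close>

lemma osc_moment:
  assumes s: "0 \<le> s" and h: "0 \<le> h"
  shows osc_meas: "osc s h \<in> borel_measurable M"
    and integrable_osc4: "integrable M (\<lambda>\<omega>. osc s h \<omega> ^ 4)"
    and expectation_osc4: "expectation (\<lambda>\<omega>. osc s h \<omega> ^ 4) \<le> 81 / 4 * h\<^sup>2"
proof -
  let ?d = "\<lambda>n i \<omega>. W (grid s (s+h) n i) \<omega> - W s \<omega>"
  let ?A = "\<lambda>c n \<omega>. MAX i\<in>{..Suc n}. c * (?d n i \<omega>)"
  let ?B = "\<lambda>n \<omega>. MAX i\<in>{..Suc n}. \<bar>?d n i \<omega>\<bar>"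
  have gs: "0 \<le> grid s (s + h) n i" for n i
    using grid_mono[of s "s + h" 0 i n] h s by auto
  have B_meas [measurable]: "?B n \<in> borel_measurable M" for n
    using gs s by (intro borel_measurable_Max borel_measurable_abs borel_measurable_diff W_meas) auto
  show osc_meas [measurable]: "osc s h \<in> borel_measurable M"
    by (rule borel_measurable_LIMSEQ_real[OF osc_tendsto[OF _ s h] B_meas])
  have A_nn: "0 \<le> ?A c n \<omega>" for c n \<omega>
  proof -
    have "c * (W (grid s (s+h) n 0) \<omega> - W s \<omega>) \<le> ?A c n \<omega>" by (rule Max_ge, simp, rule imageI, simp)
    then show ?thesis by simp
  qed
  have BA: "?B n \<omega> ^ 4 \<le> ?A 1 n \<omega> ^ 4 + ?A (-1) n \<omega> ^ 4" for n \<omega>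
  proof -
    have "?B n \<omega> \<in> (\<lambda>i. \<bar>?d n i \<omega>\<bar>) ` {..Suc n}" by (intro Max_in) auto
    then obtain i where i: "i \<in> {..Suc n}" "?B n \<omega> = \<bar>?d n i \<omega>\<bar>" by blast
    have "1 * (?d n i \<omega>) \<le> ?A 1 n \<omega>"
      "-1 * (?d n i \<omega>) \<le> ?A (-1) n \<omega>"
      by (rule Max_ge, simp, rule imageI, use i in simp)+
    moreover have "?B n \<omega> = 1 * (?d n i \<omega>) \<or> ?B n \<omega> = -1 * (?d n i \<omega>)"
      unfolding i(2) by (auto simp: abs_if)
    ultimately have "?B n \<omega> \<le> ?A 1 n \<omega> \<or> ?B n \<omega> \<le> ?A (-1) n \<omega>" by argo
    moreover have "0 \<le> ?B n \<omega>" unfolding i(2) by simp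
    ultimately have "?B n \<omega> ^ 4 \<le> ?A 1 n \<omega> ^ 4 \<or> ?B n \<omega> ^ 4 \<le> ?A (-1) n \<omega> ^ 4"
      using power_mono by blast
    moreover have "0 \<le> ?A 1 n \<omega> ^ 4" "0 \<le> ?A (-1) n \<omega> ^ 4" by (intro zero_le_power A_nn)+
    ultimately show ?thesis by linarith
  qed
  have bound: "(\<integral>\<^sup>+\<omega>. ennreal (?B n \<omega> ^ 4) \<partial>M) \<le> ennreal (81 / 4 * h\<^sup>2)" for n
  proof -
    have i: "integrable M (\<lambda>\<omega>. ?A 1 n \<omega> ^ 4)" "integrable M (\<lambda>\<omega>. ?A (-1) n \<omega> ^ 4)"
      using grid_maximum_moment(1)[OF s h, of 1 n] grid_maximum_moment(1)[OF s h, of "-1" n] by simp_all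
    have "(\<integral>\<^sup>+\<omega>. ennreal (?B n \<omega> ^ 4) \<partial>M) \<le> (\<integral>\<^sup>+\<omega>. ennreal (?A 1 n \<omega> ^ 4 + ?A (-1) n \<omega> ^ 4) \<partial>M)"
      by (intro nn_integral_mono ennreal_leI BA)
    also have "\<dots> = ennreal (expectation (\<lambda>\<omega>. ?A 1 n \<omega> ^ 4 + ?A (-1) n \<omega> ^ 4))"
      by (rule nn_integral_eq_integral, rule Bochner_Integration.integrable_add[OF i],
          intro AE_I2 add_nonneg_nonneg zero_le_power A_nn)
    also have "\<dots> \<le> ennreal (81 / 4 * h\<^sup>2)"
      using grid_maximum_moment(2)[OF s h, of 1 n] grid_maximum_moment(2)[OF s h, of "-1" n] i
      by (intro ennreal_leI) simp
    finally show ?thesis .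
  qed
  have "(\<integral>\<^sup>+\<omega>. ennreal (osc s h \<omega> ^ 4) \<partial>M) = (\<integral>\<^sup>+\<omega>. liminf (\<lambda>n. ennreal (?B n \<omega> ^ 4)) \<partial>M)"
    using osc_tendsto[OF _ s h]
    by (intro nn_integral_cong lim_imp_Liminf[symmetric] tendsto_ennrealI tendsto_power) auto
  also have "\<dots> \<le> liminf (\<lambda>n. \<integral>\<^sup>+\<omega>. ennreal (?B n \<omega> ^ 4) \<partial>M)"
    by (rule nn_integral_liminf) measurable
  also have "\<dots> \<le> ennreal (81 / 4 * h\<^sup>2)"
    using bound by (intro Liminf_le) auto
  finally have le: "(\<integral>\<^sup>+\<omega>. ennreal (osc s h \<omega> ^ 4) \<partial>M) \<le> ennreal (81 / 4 * h\<^sup>2)" .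
  show int: "integrable M (\<lambda>\<omega>. osc s h \<omega> ^ 4)"
    using le_less_trans[OF le ennreal_less_top] by (intro integrableI_nonneg) auto
  have "ennreal (expectation (\<lambda>\<omega>. osc s h \<omega> ^ 4)) \<le> ennreal (81 / 4 * h\<^sup>2)"
    using nn_integral_eq_integral[OF int] le by simp
  then show "expectation (\<lambda>\<omega>. osc s h \<omega> ^ 4) \<le> 81 / 4 * h\<^sup>2"
    by (subst (asm) ennreal_le_iff) auto
qed

end

section \<open>The running minimum and the level identity\<close>

definition running_min :: "(real \<Rightarrow> real) \<Rightarrow> real \<Rightarrow> real" where
  "running_min b t = (INF s\<in>{0..t}. b s)"

context continuous_path
begin

lemma running_min_lower: "0 \<le> s \<Longrightarrow> s \<le> t \<Longrightarrow> running_min b t \<le> b s"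
proof -
  assume s: "0 \<le> s" "s \<le> t"
  then show ?thesis unfolding running_min_def by (intro cINF_lower path_bdd_below) auto
qed

lemma running_min_attained:
  assumes "0 \<le> t"
  obtains s where "0 \<le> s" "s \<le> t" "b s = running_min b t"
proof -
  have "continuous_on {0..t} b" using cont by (rule continuous_on_subset) auto
  moreover have "compact {0..t}" "{0..t} \<noteq> {}" using assms by auto
  ultimately obtain s where s: "s \<in> {0..t}" "\<And>u. u \<in> {0..t} \<Longrightarrow> b s \<le> b u"
    using continuous_attains_inf[of "{0..t}" b] by auto
  have "running_min b t = b s" unfolding running_min_def using s by (intro cInf_eq_minimum) auto
  then show ?thesis using s that by auto
qed

lemma running_min_le_iff:
  assumes "0 \<le> t"
  shows "running_min b t \<le> a \<longleftrightarrow> (\<exists>s. 0 \<le> s \<and> s \<le> t \<and> b s \<le> a)"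
proof
  assume "running_min b t \<le> a"
  then show "\<exists>s. 0 \<le> s \<and> s \<le> t \<and> b s \<le> a"
    using running_min_attained[OF assms] by metis
next
  assume "\<exists>s. 0 \<le> s \<and> s \<le> t \<and> b s \<le> a"
  then show "running_min b t \<le> a" using running_min_lower[of _ t] by force
qed

lemma running_min_antimono:
  assumes "0 \<le> s" "s \<le> t"
  shows "running_min b t \<le> running_min b s"
proof -
  obtain u where "0 \<le> u" "u \<le> s" "b u = running_min b s" using running_min_attained[OF assms(1)] .
  then show ?thesis using running_min_lower[of u t] assms by simp
qed

lemma running_min_0: "running_min b 0 = b 0"
  by (simp add: running_min_def)

text \<open>A single time decides all events \<open>running_min b s \<le> a\<close> at once, so
  indicators of the running minimum become indicators of \<tau> \<le> s.\<close>

lemma first_hit: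
  assumes t: "0 \<le> t" and a: "a \<le> b 0" and hit: "running_min b t \<le> a"
  obtains \<tau> where "0 \<le> \<tau>" "\<tau> \<le> t" "b \<tau> = a" "\<And>s. 0 \<le> s \<Longrightarrow> running_min b s \<le> a \<longleftrightarrow> \<tau> \<le> s"
proof -
  define S where "S = {s \<in> {0..t}. b s \<le> a}"
  have "closed S" unfolding S_def
    by (rule continuous_on_closed_Collect_le) (auto intro: continuous_on_subset[OF cont] continuous_on_const)
  moreover have "S \<noteq> {}" using hit running_min_le_iff[OF t] by (auto simp: S_def)
  moreover have bdd: "bdd_below S" by (auto simp: S_def)
  ultimately have inS: "Inf S \<in> S" by (intro closed_contains_Inf)
  have low: "Inf S \<le> s" if "0 \<le> s" "b s \<le> a" for s
  proof (cases "s \<le> t")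
    case True then show ?thesis using that by (intro cInf_lower bdd) (auto simp: S_def)
  next
    case False then show ?thesis using inS by (auto simp: S_def)
  qed
  have "\<exists>x\<ge>0. x \<le> Inf S \<and> b x = a"
    using inS a by (intro IVT2' continuous_on_subset[OF cont]) (auto simp: S_def)
  then obtain u where u: "0 \<le> u" "u \<le> Inf S" "b u = a" by auto
  then have "u = Inf S" using low[of u] by auto
  show ?thesis
  proof (rule that[of "Inf S"])
    show "b (Inf S) = a" using u \<open>u = Inf S\<close> by simp
    show "running_min b s \<le> a \<longleftrightarrow> Inf S \<le> s" if "0 \<le> s" for s
      unfolding running_min_le_iff[OF that] using low inS by (force simp: S_def)
  qed (use inS in \<open>auto simp: S_def\<close>)
qed

text \<open>With the constant \<open>- b 0\<close> in place of the jumps the path starts at 0, and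
  its Skorokhod term is the depth of the running minimum below the start. Continuity of the running
  minimum is then inherited.\<close>

lemma running_min_eq_skorokhod:
  assumes "0 \<le> t"
  shows "running_min b t = b 0 - skorokhod_term (\<lambda>s. b s + - b 0) t"
proof -
  interpret r: reflected_path b "\<lambda>_. - b 0" "\<lambda>s. b s + - b 0"
    by unfold_locales (auto intro: cont)
  obtain s where s: "0 \<le> s" "s \<le> t" "b s = running_min b t" using running_min_attained[OF assms] .
  have "skorokhod_term (\<lambda>s. b s + - b 0) t \<le> b 0 - running_min b t"
  proof (rule r.skorokhod_le)
    show "0 \<le> b 0 - running_min b t" using running_min_lower[of 0 t] assms by simp
    fix u assume "0 \<le> u" "u \<le> max 0 t"
    then show "- (b u + - b 0) \<le> b 0 - running_min b t" using running_min_lower[of u t] assms by simp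
  qed
  moreover have "b 0 - running_min b t \<le> skorokhod_term (\<lambda>s. b s + - b 0) t"
    using r.skorokhod_upper[OF s(1,2)] s by auto
  ultimately show ?thesis by simp
qed

lemma continuous_running_min: "continuous_on {0..} (running_min b)"
proof -
  interpret r: reflected_path b "\<lambda>_. - b 0" "\<lambda>s. b s + - b 0"
    by unfold_locales (auto intro: cont)
  have "continuous_on {0..} (\<lambda>t. b 0 - skorokhod_term (\<lambda>s. b s + - b 0) t)"
    by (intro continuous_intros continuous_on_subset[OF r.continuous_skorokhod]) auto
  then show ?thesis
    by (rule continuous_on_eq) (simp add: running_min_eq_skorokhod)
qed

end

text \<open>A Riemann sum for the integral of \<open>df\<close> over \<open>{\<tau>..t}\<close>, arranged so that the \<open>i\<close>-th coefficient depends
  only on whether \<open>\<tau>\<close> has occurred by the \<open>i\<close>-th grid point.\<close>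

definition late_sum :: "(real \<Rightarrow> real) \<Rightarrow> real \<Rightarrow> real \<Rightarrow> nat \<Rightarrow> real" where
  "late_sum f \<tau> t n = (\<Sum>i<Suc n. (if \<tau> \<le> grid 0 t n i then 1 else 0) * (f (grid 0 t n (Suc i)) - f (grid 0 t n i)))"

text \<open>The coefficients switch from 0 to 1 at the first grid point x at or after \<tau>, and
  from there the sum telescopes.\<close>

lemma late_sum_eq:
  fixes f :: "real \<Rightarrow> real"
  assumes \<tau>: "0 \<le> \<tau>" "\<tau> \<le> t"
  obtains x where "\<tau> \<le> x" "x \<le> \<tau> + t / real (Suc n)" "x \<le> t"
    "late_sum f \<tau> t n = f t - f x"
proof -
  obtain i where i: "i \<le> Suc n" "\<tau> \<le> grid 0 t n i" "grid 0 t n i < \<tau> + (t - 0) / real (Suc n) \<or> grid 0 t n i = \<tau>"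
    "\<And>j. \<tau> \<le> grid 0 t n j \<longleftrightarrow> i \<le> j \<or> 0 = t"
    using grid_above[OF \<tau>, of n] by blast
  show ?thesis
  proof (rule that[of "grid 0 t n i"])
    have t: "0 \<le> t" using \<tau> by simp
    show "\<tau> \<le> grid 0 t n i" by fact
    show "grid 0 t n i \<le> \<tau> + t / real (Suc n)" using i(3) t by (auto simp: add_increasing2)
    show "grid 0 t n i \<le> t" using grid_bounds[OF t i(1)] by simp
    show "late_sum f \<tau> t n
       = f t - f (grid 0 t n i)" (is "?S = _")
    proof (cases "t = 0")
      case True
      then show ?thesis by (simp add: late_sum_def grid_def)
    next
      case False
      have "?S = (\<Sum>j\<in>{i..<Suc n}. f (grid 0 t n (Suc j)) - f (grid 0 t n j))"
        unfolding late_sum_def i(4) using False by (intro sum.mono_neutral_cong_right) auto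
      also have "\<dots> = f t - f (grid 0 t n i)"
        using sum_Suc_diff'[OF i(1), of "\<lambda>j. f (grid 0 t n j)"] by simp
      finally show ?thesis .
    qed
  qed
qed

lemma late_sum_tendsto:
  fixes f :: "real \<Rightarrow> real"
  assumes \<tau>: "0 \<le> \<tau>" "\<tau> \<le> t" and f: "continuous_on {0..t} f"
  shows "(\<lambda>n. late_sum f \<tau> t n)
    \<longlonglongrightarrow> f t - f \<tau>"
proof -
  have "\<forall>n. \<exists>x. \<tau> \<le> x \<and> x \<le> \<tau> + t / real (Suc n) \<and> x \<le> t \<and>
    late_sum f \<tau> t n = f t - f x"
  proof
    fix n
    show "\<exists>x. \<tau> \<le> x \<and> x \<le> \<tau> + t / real (Suc n) \<and> x \<le> t \<and>
    late_sum f \<tau> t n = f t - f x"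
      by (rule late_sum_eq[OF \<tau>, of n f]) blast
  qed
  from choice[OF this] obtain x where x: "\<And>n. \<tau> \<le> x n" "\<And>n. x n \<le> \<tau> + t / real (Suc n)" "\<And>n. x n \<le> t"
    "\<And>n. late_sum f \<tau> t n = f t - f (x n)"
    by blast
  have "(\<lambda>n. \<tau> + t / real (Suc n)) \<longlonglongrightarrow> \<tau>"
    using tendsto_add[OF tendsto_const[of \<tau>] tendsto_mult[OF tendsto_const[of t] LIMSEQ_inverse_real_of_nat]]
    by (simp add: divide_inverse)
  then have "x \<longlonglongrightarrow> \<tau>"
    by (rule tendsto_sandwich[OF _ _ tendsto_const, rotated -1]) (use x in auto)
  then have "(\<lambda>n. f (x n)) \<longlonglongrightarrow> f \<tau>"
    using \<tau> x order_trans[OF \<tau>(1) x(1)] by (intro continuous_on_tendsto_compose[OF f]) auto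
  then show ?thesis unfolding x(4) by (intro tendsto_intros)
qed

lemma le_one_plus_power4:
  fixes x :: real
  assumes "0 \<le> x"
  shows "x \<le> 1 + x ^ 4" "x\<^sup>2 \<le> 1 + x ^ 4"
proof -
  have "0 \<le> (x\<^sup>2 - 1 / 2)\<^sup>2" by simp
  then have 1: "x\<^sup>2 \<le> x ^ 4 + 1 / 4" by (simp add: power2_diff power_mult[symmetric] power_one_over)
  then show "x\<^sup>2 \<le> 1 + x ^ 4" by simp
  have "0 \<le> (x - 1 / 2)\<^sup>2" by simp
  then have "x \<le> x\<^sup>2 + 1 / 4" by (simp add: power2_diff power_one_over)
  then show "x \<le> 1 + x ^ 4" using 1 by simp
qed

lemma abs_le_one_plus_square: "\<bar>x\<bar> \<le> 1 + (x::real)\<^sup>2"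
proof -
  have "0 \<le> (\<bar>x\<bar> - 1 / 2)\<^sup>2" by simp
  then show ?thesis by (simp add: power2_diff power_one_over)
qed

section \<open>Optional stopping at first passage times of the drifted path\<close>

locale drifted_brownian_motion = brownian_motion +
  fixes x0 \<mu> \<sigma> :: real
  assumes \<mu>: "0 < \<mu>" and \<sigma>: "0 < \<sigma>"
begin

abbreviation B :: "real \<Rightarrow> 'a \<Rightarrow> real" where "B \<equiv> drifted_bm x0 \<mu> \<sigma> W"

definition m :: "real \<Rightarrow> 'a \<Rightarrow> real" where
  "m t \<omega> = running_min (\<lambda>s. B s \<omega>) t"

lemma B_meas [measurable]: "0 \<le> t \<Longrightarrow> B t \<in> borel_measurable M"
  unfolding drifted_bm_def by measurable

lemma B_cont: "\<omega> \<in> space M \<Longrightarrow> continuous_on {0..} (\<lambda>t. B t \<omega>)"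
  unfolding drifted_bm_def by (intro continuous_intros W_cont)

lemma B_0: "\<omega> \<in> space M \<Longrightarrow> B 0 \<omega> = x0"
  by (simp add: drifted_bm_def W_0)

lemma path: "\<omega> \<in> space M \<Longrightarrow> continuous_path (\<lambda>t. B t \<omega>)"
  by unfold_locales (rule B_cont)

lemma m_tendsto:
  assumes "\<omega> \<in> space M" "0 \<le> t"
  shows "(\<lambda>n. MIN i\<in>{..Suc n}. B (grid 0 t n i) \<omega>) \<longlonglongrightarrow> m t \<omega>"
  unfolding m_def running_min_def
  by (intro grid_Min_tendsto assms continuous_on_subset[OF B_cont]) auto

lemma m_meas [measurable]:
  assumes t: "0 \<le> t" shows "m t \<in> borel_measurable M"
proof (rule borel_measurable_LIMSEQ_real[OF m_tendsto[OF _ t]])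
  have "0 \<le> grid 0 t n i" for n i using t by (simp add: grid_def)
  then show "(\<lambda>\<omega>. MIN i\<in>{..Suc n}. B (grid 0 t n i) \<omega>) \<in> borel_measurable M" for n
    by (intro borel_measurable_Min B_meas) auto
qed

lemma m_le_grid:
  assumes "\<omega> \<in> space M" "0 \<le> t"
  shows "m t \<omega> \<le> (MIN i\<in>{..Suc n}. B (grid 0 t n i) \<omega>)"
  unfolding m_def using grid_bounds[OF assms(2)]
  by (intro Min.boundedI) (auto intro!: continuous_path.running_min_lower[OF path[OF assms(1)]])

lemma m_le_B: "\<omega> \<in> space M \<Longrightarrow> 0 \<le> s \<Longrightarrow> s \<le> t \<Longrightarrow> m t \<omega> \<le> B s \<omega>"
  unfolding m_def by (intro continuous_path.running_min_lower path)

lemma integrable_osc: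
  assumes "0 \<le> s" "0 \<le> h"
  shows "integrable M (osc s h)" "integrable M (\<lambda>\<omega>. (osc s h \<omega>)\<^sup>2)"
proof -
  note [measurable] = osc_meas[OF assms]
  have *: "integrable M (\<lambda>\<omega>. 1 + osc s h \<omega> ^ 4)" using integrable_osc4[OF assms] by simp
  from * show "integrable M (osc s h)"
    by (rule Bochner_Integration.integrable_bound)
       (use osc_nonneg[OF _ assms] le_one_plus_power4(1)[OF osc_nonneg[OF _ assms]]
         in \<open>auto intro!: AE_I2 simp: abs_of_nonneg add_nonneg_nonneg\<close>)
  from * show "integrable M (\<lambda>\<omega>. (osc s h \<omega>)\<^sup>2)"
    by (rule Bochner_Integration.integrable_bound)
       (use osc_nonneg[OF _ assms] le_one_plus_power4(2)[OF osc_nonneg[OF _ assms]]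
         in \<open>auto intro!: AE_I2 simp: abs_of_nonneg add_nonneg_nonneg\<close>)
qed

lemma W_le_osc: "\<omega> \<in> space M \<Longrightarrow> 0 \<le> s \<Longrightarrow> s \<le> t \<Longrightarrow> \<bar>W s \<omega>\<bar> \<le> osc 0 t \<omega>"
  using osc_upper[of \<omega> 0 s t] by (simp add: W_0)

lemma B_ge_osc:
  assumes "\<omega> \<in> space M" "0 \<le> s" "s \<le> t"
  shows "x0 - \<mu> * t - \<sigma> * osc 0 t \<omega> \<le> B s \<omega>"
proof -
  have "\<mu> * s \<le> \<mu> * t" "\<sigma> * (- osc 0 t \<omega>) \<le> \<sigma> * W s \<omega>"
    using W_le_osc[OF assms] assms \<mu> \<sigma> by (intro mult_left_mono; simp)+
  then show ?thesis by (simp add: drifted_bm_def)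
qed

lemma m_ge_osc:
  assumes "\<omega> \<in> space M" "0 \<le> t"
  shows "x0 - \<mu> * t - \<sigma> * osc 0 t \<omega> \<le> m t \<omega>"
proof -
  obtain s where "0 \<le> s" "s \<le> t" "B s \<omega> = m t \<omega>"
    using continuous_path.running_min_attained[OF path[OF assms(1)] assms(2)] unfolding m_def by blast
  then show ?thesis using B_ge_osc[OF assms(1), of s t] by simp
qed

lemma increment_orthogonal_limit:
  assumes s: "0 \<le> s" "s \<le> t"
    and F: "\<And>n. F n \<in> borel_measurable M" "\<And>n \<omega>. \<bar>F n \<omega>\<bar> \<le> (1 :: real)"
    and orth: "\<And>n. expectation (\<lambda>\<omega>. F n \<omega> * (W t \<omega> - W s \<omega>)) = 0"
    and lim: "\<And>\<omega>. \<omega> \<in> space M \<Longrightarrow> (\<lambda>n. F n \<omega>) \<longlonglongrightarrow> f \<omega>"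
  shows "integrable M (\<lambda>\<omega>. f \<omega> * (W t \<omega> - W s \<omega>))"
    and "expectation (\<lambda>\<omega>. f \<omega> * (W t \<omega> - W s \<omega>)) = 0"
proof -
  have t: "0 \<le> t" using s by simp
  note [measurable] = W_meas[OF s(1)] W_meas[OF t] F(1) borel_measurable_LIMSEQ_real[OF lim F(1)]
  have wint: "integrable M (\<lambda>\<omega>. \<bar>W t \<omega> - W s \<omega>\<bar>)"
    using integrable_increment[OF s, of 1] by simp
  have l: "AE \<omega> in M. (\<lambda>n. F n \<omega> * (W t \<omega> - W s \<omega>)) \<longlonglongrightarrow> f \<omega> * (W t \<omega> - W s \<omega>)"
    using lim by (intro AE_I2 tendsto_intros)
  have b: "AE \<omega> in M. norm (F n \<omega> * (W t \<omega> - W s \<omega>)) \<le> \<bar>W t \<omega> - W s \<omega>\<bar>" for n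
    using F(2) by (auto simp: abs_mult intro!: mult_left_le_one_le)
  show "integrable M (\<lambda>\<omega>. f \<omega> * (W t \<omega> - W s \<omega>))"
    by (rule integrable_dominated_convergence[OF _ _ wint l b]) measurable
  have "(\<lambda>n. expectation (\<lambda>\<omega>. F n \<omega> * (W t \<omega> - W s \<omega>))) \<longlonglongrightarrow> expectation (\<lambda>\<omega>. f \<omega> * (W t \<omega> - W s \<omega>))"
    by (rule integral_dominated_convergence[OF _ _ wint l b]) measurable
  then show "expectation (\<lambda>\<omega>. f \<omega> * (W t \<omega> - W s \<omega>)) = 0" unfolding orth by (simp add: LIMSEQ_const_iff)
qed

text \<open>The strict event is treated before the closed one because grid minima approach m from
  above: their indicators of being < a converge pointwise, while those of being <= a may fail to
  converge to the right value where m = a.\<close>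

lemma increment_orthogonal_min_less:
  assumes s: "0 \<le> s" "s \<le> t"
  shows "integrable M (\<lambda>\<omega>. (if m s \<omega> < a then 1 else 0) * (W t \<omega> - W s \<omega>))" (is "integrable M ?f")
    and "expectation (\<lambda>\<omega>. (if m s \<omega> < a then 1 else 0) * (W t \<omega> - W s \<omega>)) = 0"
proof -
  have t: "0 \<le> t" using s by simp
  note [measurable] = m_meas[OF s(1)] W_meas[OF s(1)] W_meas[OF t]
  define F where "F n \<omega> = (if (MIN i\<in>{..Suc n}. B (grid 0 s n i) \<omega>) < a then 1 else 0 :: real)" for n \<omega>
  have gs: "0 \<le> grid 0 s n i" for n i using s by (simp add: grid_def)
  have F_meas [measurable]: "F n \<in> borel_measurable M" for n
  proof -
    have [measurable]: "(\<lambda>\<omega>. MIN i\<in>{..Suc n}. B (grid 0 s n i) \<omega>) \<in> borel_measurable M"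
      using gs by (intro borel_measurable_Min B_meas) auto
    show ?thesis unfolding F_def by measurable
  qed
  have F_int: "integrable M (F n)" for n
    by (rule integrable_const_bound[of _ 1]) (auto simp: F_def)
  have orth: "expectation (\<lambda>\<omega>. F n \<omega> * (W t \<omega> - W s \<omega>)) = 0" for n
  proof -
    let ?h = "\<lambda>x. MIN i\<in>{..Suc n}. x0 - \<mu> * grid 0 s n i + \<sigma> * (x i :: real)"
    have [measurable]: "?h \<in> borel_measurable (PiM {..Suc n} (\<lambda>_. borel))"
      by (intro borel_measurable_Min borel_measurable_add borel_measurable_const borel_measurable_times
          measurable_component_singleton) auto
    have g: "(\<lambda>x. if ?h x < a then 1 else 0) \<in> borel_measurable (PiM {..Suc n} (\<lambda>_. borel))"
      by measurable
    have G: "F n \<omega> = (if ?h (\<lambda>i\<in>{..Suc n}. W (grid 0 s n i) \<omega> - W (grid 0 s n 0) \<omega>) < a then 1 else 0)"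
      if "\<omega> \<in> space M" for \<omega>
    proof -
      have "(\<lambda>i. B (grid 0 s n i) \<omega>) ` {..Suc n} = (\<lambda>i. x0 - \<mu> * grid 0 s n i +
        \<sigma> * (\<lambda>i\<in>{..Suc n}. W (grid 0 s n i) \<omega> - W (grid 0 s n 0) \<omega>) i) ` {..Suc n}"
        using that by (intro image_cong) (auto simp: drifted_bm_def W_0)
      then show ?thesis unfolding F_def by simp
    qed
    have u: "0 \<le> grid 0 s n 0" "\<And>i. i < Suc n \<Longrightarrow> grid 0 s n i \<le> grid 0 s n (Suc i)" "grid 0 s n (Suc n) \<le> t"
      using s by (auto intro!: grid_mono)
    show ?thesis using increment_orthogonal(2)[OF u g G F_int] by simp
  qed
  have F_lim: "(\<lambda>n. F n \<omega>) \<longlonglongrightarrow> (if m s \<omega> < a then 1 else 0)" if \<omega>: "\<omega> \<in> space M" for \<omega>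
  proof (rule tendsto_eventually)
    show "eventually (\<lambda>n. F n \<omega> = (if m s \<omega> < a then 1 else 0)) sequentially"
    proof (cases "m s \<omega> < a")
      case True
      then show ?thesis using order_tendstoD(2)[OF m_tendsto[OF \<omega> s(1)], of a]
        by (auto simp: F_def elim: eventually_mono)
    next
      case False
      have "a \<le> (MIN i\<in>{..Suc n}. B (grid 0 s n i) \<omega>)" for n
        using m_le_grid[OF \<omega> s(1), of n] False by linarith
      then have "F n \<omega> = 0" for n unfolding F_def by (simp only: not_less[symmetric] if_False)
      then show ?thesis using False by simp
    qed
  qed
  have bd: "\<bar>F n \<omega>\<bar> \<le> 1" for n \<omega> by (simp add: F_def)
  show "integrable M ?f" "expectation ?f = 0"
    using increment_orthogonal_limit[OF s F_meas bd orth F_lim] by simp_all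
qed

text \<open>The closed event is the decreasing limit of the open events m < a + 1 / (n + 1). The
  closed form is the one that matches passage at the level a itself.\<close>

lemma increment_orthogonal_min:
  assumes s: "0 \<le> s" "s \<le> t"
  shows "integrable M (\<lambda>\<omega>. (if m s \<omega> \<le> a then 1 else 0) * (W t \<omega> - W s \<omega>))" (is "integrable M ?f")
    and "expectation (\<lambda>\<omega>. (if m s \<omega> \<le> a then 1 else 0) * (W t \<omega> - W s \<omega>)) = 0"
proof -
  have t: "0 \<le> t" using s by simp
  note [measurable] = m_meas[OF s(1)] W_meas[OF s(1)] W_meas[OF t]
  define F where "F n \<omega> = (if m s \<omega> < a + inverse (real (Suc n)) then 1 else 0 :: real)" for n \<omega>
  have F_meas [measurable]: "F n \<in> borel_measurable M" for n unfolding F_def by measurable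
  have F_lim: "(\<lambda>n. F n \<omega>) \<longlonglongrightarrow> (if m s \<omega> \<le> a then 1 else 0)" for \<omega>
  proof (rule tendsto_eventually)
    show "eventually (\<lambda>n. F n \<omega> = (if m s \<omega> \<le> a then 1 else 0)) sequentially"
    proof (cases "m s \<omega> \<le> a")
      case True
      have "m s \<omega> < a + inverse (real (Suc n))" for n
        using True by (intro le_less_trans[OF True]) simp
      then show ?thesis using True by (auto simp: F_def)
    next
      case False
      have "(\<lambda>n. a + inverse (real (Suc n))) \<longlonglongrightarrow> a + 0" by (intro tendsto_intros LIMSEQ_inverse_real_of_nat)
      then have "eventually (\<lambda>n. a + inverse (real (Suc n)) < m s \<omega>) sequentially"
        using False by (intro order_tendstoD) auto
      then show ?thesis using False by (auto simp: F_def elim: eventually_mono)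
    qed
  qed
  have bd: "\<bar>F n \<omega>\<bar> \<le> 1" for n \<omega> by (simp add: F_def)
  have orth: "expectation (\<lambda>\<omega>. F n \<omega> * (W t \<omega> - W s \<omega>)) = 0" for n
    unfolding F_def by (rule increment_orthogonal_min_less(2)[OF s])
  show "integrable M ?f" "expectation ?f = 0"
    using increment_orthogonal_limit[OF s F_meas bd orth F_lim] by simp_all
qed

definition overtime :: "real \<Rightarrow> real \<Rightarrow> 'a \<Rightarrow> real" where
  "overtime a t \<omega> = measure lborel {s \<in> {0..t}. m s \<omega> \<le> a}"

text \<open>The martingale increment after the passage of a, written through \<open>m\<close>,
  \<open>B\<close> and a Lebesgue measure instead of the passage time. In this form the gaps of all
  passed levels can be summed: the terms B - a form an arithmetic progression, and the overtimes add
  up to the time integral of the number of passed levels.\<close>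

definition level_gap :: "real \<Rightarrow> real \<Rightarrow> 'a \<Rightarrow> real" where
  "level_gap a t \<omega> = (if m t \<omega> \<le> a then B t \<omega> - a else 0) + \<mu> * overtime a t \<omega>"

text \<open>Optional stopping at the first passage time \<open>\<tau>\<close> to \<open>a\<close>: since \<open>B \<tau> = a\<close>, the level gap is
  \<open>\<sigma> (W t - W \<tau>)\<close> on \<open>\<tau> \<le> t\<close>.\<close>

lemma level_gap_cases:
  assumes \<omega>: "\<omega> \<in> space M" and t: "0 \<le> t" and a: "a \<le> x0"
  shows "(m t \<omega> \<le> a \<and> (\<exists>\<tau>. 0 \<le> \<tau> \<and> \<tau> \<le> t \<and> (\<forall>s\<ge>0. m s \<omega> \<le> a \<longleftrightarrow> \<tau> \<le> s) \<and>
      overtime a t \<omega> = t - \<tau> \<and> level_gap a t \<omega> = \<sigma> * (W t \<omega> - W \<tau> \<omega>)))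
    \<or> (\<not> m t \<omega> \<le> a \<and> (\<forall>s. 0 \<le> s \<and> s \<le> t \<longrightarrow> \<not> m s \<omega> \<le> a) \<and> overtime a t \<omega> = 0 \<and> level_gap a t \<omega> = 0)"
proof -
  interpret p: continuous_path "\<lambda>t. B t \<omega>" by (rule path[OF \<omega>])
  show ?thesis
  proof (cases "m t \<omega> \<le> a")
    case True
    obtain \<tau> where \<tau>: "0 \<le> \<tau>" "\<tau> \<le> t" "B \<tau> \<omega> = a" "\<And>s. 0 \<le> s \<Longrightarrow> m s \<omega> \<le> a \<longleftrightarrow> \<tau> \<le> s"
      using p.first_hit[OF t, of a] True a B_0[OF \<omega>] unfolding m_def by auto
    have "{s \<in> {0..t}. m s \<omega> \<le> a} = {\<tau>..t}" using \<tau> by auto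
    then have "overtime a t \<omega> = t - \<tau>" using \<tau> by (simp add: overtime_def)
    moreover have "level_gap a t \<omega> = B t \<omega> - B \<tau> \<omega> + \<mu> * (t - \<tau>)"
      using True \<tau>(3) calculation by (simp add: level_gap_def)
    moreover have "\<dots> = \<sigma> * (W t \<omega> - W \<tau> \<omega>)"
      by (simp add: drifted_bm_def algebra_simps)
    ultimately have "overtime a t \<omega> = t - \<tau>" "level_gap a t \<omega> = \<sigma> * (W t \<omega> - W \<tau> \<omega>)" by simp_all
    then show ?thesis using True \<tau> by (intro disjI1 conjI exI[of _ \<tau>]) auto
  next
    case False
    then have "\<forall>s. 0 \<le> s \<and> s \<le> t \<longrightarrow> \<not> m s \<omega> \<le> a"
      using p.running_min_antimono unfolding m_def by (meson order_trans)
    moreover then have "{s \<in> {0..t}. m s \<omega> \<le> a} = {}" by auto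
    then have "overtime a t \<omega> = 0" unfolding overtime_def by (simp only: measure_empty)
    then have "overtime a t \<omega> = 0 \<and> level_gap a t \<omega> = 0" using False by (simp add: level_gap_def)
    ultimately show ?thesis using False by (intro disjI2 conjI) auto
  qed
qed

text \<open>The gap vanishes for levels not yet passed, so a sum over all levels is dominated by the
  number of passed levels times the oscillation.\<close>

lemma level_gap_bound:
  assumes \<omega>: "\<omega> \<in> space M" and t: "0 \<le> t" and a: "a \<le> x0"
  shows "\<bar>level_gap a t \<omega>\<bar> \<le> (if m t \<omega> \<le> a then 2 * \<sigma> * osc 0 t \<omega> else 0)"
  using level_gap_cases[OF assms]
proof (elim disjE conjE exE)
  fix \<tau> assume \<tau>: "0 \<le> \<tau>" "\<tau> \<le> t" "level_gap a t \<omega> = \<sigma> * (W t \<omega> - W \<tau> \<omega>)" "m t \<omega> \<le> a"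
  have "\<bar>W t \<omega> - W \<tau> \<omega>\<bar> \<le> 2 * osc 0 t \<omega>"
    using W_le_osc[OF \<omega> \<tau>(1,2)] W_le_osc[OF \<omega> t order_refl] by linarith
  then have "\<sigma> * \<bar>W t \<omega> - W \<tau> \<omega>\<bar> \<le> \<sigma> * (2 * osc 0 t \<omega>)" using \<sigma> by (intro mult_left_mono) auto
  then show ?thesis using \<tau> \<sigma> by (simp add: abs_mult)
qed auto

text \<open>\<open>R n\<close> lets the passage take effect only at the next grid point, which makes
  it a sum of increments multiplied by events of their past, hence of mean zero. Along each path
  \<sigma> R n tends to the gap, and a multiple of the oscillation dominates.\<close>

lemma level_gap_expectation:
  assumes t: "0 \<le> t" and a: "a \<le> x0"
  shows "integrable M (level_gap a t)" and "expectation (level_gap a t) = 0"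
proof -
  define R where "R n \<omega> = (\<Sum>i<Suc n. (if m (grid 0 t n i) \<omega> \<le> a then 1 else 0) * (W (grid 0 t n (Suc i)) \<omega> - W (grid 0 t n i) \<omega>))" for n \<omega>
  have gs: "0 \<le> grid 0 t n i" "grid 0 t n i \<le> grid 0 t n (Suc i)" for n i
    using grid_mono[OF t, of i "Suc i" n] grid_mono[OF t, of 0 i n] by simp_all
  have R: "integrable M (R n)" "expectation (R n) = 0" for n
    unfolding R_def using increment_orthogonal_min[OF gs]
    by (simp_all add: Bochner_Integration.integral_sum del: sum.lessThan_Suc grid_Suc_n)
  have [measurable]: "R n \<in> borel_measurable M" for n using R(1) by auto
  have lim: "(\<lambda>n. \<sigma> * R n \<omega>) \<longlonglongrightarrow> level_gap a t \<omega> \<and> (\<forall>n. \<bar>R n \<omega>\<bar> \<le> 2 * osc 0 t \<omega>)" if \<omega>: "\<omega> \<in> space M" for \<omega>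
    using level_gap_cases[OF \<omega> t a]
  proof (elim disjE conjE exE)
    fix \<tau> assume \<tau>: "0 \<le> \<tau>" "\<tau> \<le> t" "level_gap a t \<omega> = \<sigma> * (W t \<omega> - W \<tau> \<omega>)" "\<forall>s\<ge>0. m s \<omega> \<le> a \<longleftrightarrow> \<tau> \<le> s"
    have R: "R n \<omega> = late_sum (\<lambda>t. W t \<omega>) \<tau> t n" for n
      unfolding R_def late_sum_def using \<tau>(4) gs(1) by simp
    have "(\<lambda>n. R n \<omega>) \<longlonglongrightarrow> W t \<omega> - W \<tau> \<omega>"
      unfolding R by (intro late_sum_tendsto[of \<tau> t "\<lambda>t. W t \<omega>"] \<tau> continuous_on_subset[OF W_cont[OF \<omega>]]) auto
    then have "(\<lambda>n. \<sigma> * R n \<omega>) \<longlonglongrightarrow> level_gap a t \<omega>" unfolding \<tau>(3) by (intro tendsto_intros)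
    moreover have "\<bar>R n \<omega>\<bar> \<le> 2 * osc 0 t \<omega>" for n
    proof -
      obtain x where x: "\<tau> \<le> x" "x \<le> t" "R n \<omega> = W t \<omega> - W x \<omega>"
        unfolding R by (rule late_sum_eq[OF \<tau>(1,2), of n "\<lambda>t. W t \<omega>"]) blast
      then show ?thesis using W_le_osc[OF \<omega> _ x(2)] W_le_osc[OF \<omega> t order_refl] \<tau>(1) by force
    qed
    ultimately show ?thesis by blast
  next
    assume none: "\<forall>s. 0 \<le> s \<and> s \<le> t \<longrightarrow> \<not> m s \<omega> \<le> a" and z: "level_gap a t \<omega> = 0"
    have "R n \<omega> = 0" for n
      unfolding R_def using none grid_bounds[OF t] by (intro sum.neutral) auto
    then show ?thesis using z osc_nonneg[OF \<omega> order_refl t] by simp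
  qed
  have [measurable]: "level_gap a t \<in> borel_measurable M"
    by (rule borel_measurable_LIMSEQ_real[where u="\<lambda>n \<omega>. \<sigma> * R n \<omega>"]) (use lim in auto)
  have oint: "integrable M (\<lambda>\<omega>. \<sigma> * (2 * osc 0 t \<omega>))" using integrable_osc[OF order_refl t] by simp
  have l: "AE \<omega> in M. (\<lambda>n. \<sigma> * R n \<omega>) \<longlonglongrightarrow> level_gap a t \<omega>" using lim by auto
  have bd: "AE \<omega> in M. norm (\<sigma> * R n \<omega>) \<le> \<sigma> * (2 * osc 0 t \<omega>)" for n
    using lim \<sigma> by (intro AE_I2) (simp add: abs_mult)
  show "integrable M (level_gap a t)"
    by (rule integrable_dominated_convergence[OF _ _ oint l bd]) measurable
  have "(\<lambda>n. expectation (\<lambda>\<omega>. \<sigma> * R n \<omega>)) \<longlonglongrightarrow> expectation (level_gap a t)"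
    by (rule integral_dominated_convergence[OF _ _ oint l bd]) measurable
  then show "expectation (level_gap a t) = 0" by (simp add: R LIMSEQ_const_iff)
qed

lemma expectation_B:
  assumes "0 \<le> t"
  shows "integrable M (B t)" "expectation (B t) = x0 - \<mu> * t"
    and "integrable M (\<lambda>\<omega>. (B t \<omega>)\<^sup>2)" "expectation (\<lambda>\<omega>. (B t \<omega>)\<^sup>2) = (x0 - \<mu> * t)\<^sup>2 + \<sigma>\<^sup>2 * t"
proof -
  let ?I = "\<lambda>\<omega>. W t \<omega> - W 0 \<omega>"
  have eq: "B t \<omega> = x0 - \<mu> * t + \<sigma> * ?I \<omega>" if "\<omega> \<in> space M" for \<omega>
    using that by (simp add: drifted_bm_def W_0)
  have eq2: "(B t \<omega>)\<^sup>2 = (x0 - \<mu> * t)\<^sup>2 + 2 * (x0 - \<mu> * t) * \<sigma> * ?I \<omega> + \<sigma>\<^sup>2 * (?I \<omega>)\<^sup>2" if "\<omega> \<in> space M" for \<omega>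
  proof -
    have "(p + \<sigma> * i)\<^sup>2 = p\<^sup>2 + 2 * p * \<sigma> * i + \<sigma>\<^sup>2 * i\<^sup>2" for p i :: real by algebra
    then show ?thesis unfolding eq[OF that] .
  qed
  note i = integrable_increment[OF order_refl assms, of 1] integrable_increment[OF order_refl assms, of 2]
    expectation_increment[OF order_refl assms] expectation_increment2[OF order_refl assms]
  show "integrable M (B t)" using i(1) by (simp cong: Bochner_Integration.integrable_cong add: eq)
  show "integrable M (\<lambda>\<omega>. (B t \<omega>)\<^sup>2)" using i(1,2) by (simp cong: Bochner_Integration.integrable_cong add: eq2)
  show "expectation (B t) = x0 - \<mu> * t"
    using i by (simp cong: Bochner_Integration.integral_cong add: eq prob_space)
  show "expectation (\<lambda>\<omega>. (B t \<omega>)\<^sup>2) = (x0 - \<mu> * t)\<^sup>2 + \<sigma>\<^sup>2 * t"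
    using i by (simp cong: Bochner_Integration.integral_cong add: eq2 prob_space)
qed

text \<open>A substitute for the zero-one law at time 0. The mean-zero gap of the level x0 - e is at
  most B t - (x0 - e), plus \<mu> t on the event m t <= x0 - e. Taking expectations gives this event
  probability at least 1 - e / (\<mu> t), and e tends to 0.\<close>

lemma AE_m_less:
  assumes t: "0 < t"
  shows "AE \<omega> in M. m t \<omega> < x0"
proof -
  have t0: "0 \<le> t" using t by simp
  note [measurable] = m_meas[OF t0]
  have ge: "1 - e / (\<mu> * t) \<le> prob {\<omega> \<in> space M. m t \<omega> < x0}" if e: "0 < e" for e
  proof -
    let ?a = "x0 - e"
    have a: "?a \<le> x0" using e by simp
    let ?p = "prob {\<omega> \<in> space M. m t \<omega> \<le> ?a}"
    have "0 = expectation (level_gap ?a t)" using level_gap_expectation(2)[OF t0 a] by simp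
    also have "\<dots> \<le> expectation (\<lambda>\<omega>. B t \<omega> - ?a + \<mu> * t * indicator {\<omega> \<in> space M. m t \<omega> \<le> ?a} \<omega>)"
    proof (rule integral_mono)
      show "integrable M (level_gap ?a t)" by (rule level_gap_expectation(1)[OF t0 a])
      show "integrable M (\<lambda>\<omega>. B t \<omega> - ?a + \<mu> * t * indicator {\<omega> \<in> space M. m t \<omega> \<le> ?a} \<omega>)"
        using expectation_B(1)[OF t0] by (auto simp: less_top[symmetric])
      fix \<omega> assume \<omega>: "\<omega> \<in> space M"
      show "level_gap ?a t \<omega> \<le> B t \<omega> - ?a + \<mu> * t * indicator {\<omega> \<in> space M. m t \<omega> \<le> ?a} \<omega>"
        using level_gap_cases[OF \<omega> t0 a]
      proof (elim disjE conjE exE)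
        fix \<tau> assume "0 \<le> \<tau>" "overtime ?a t \<omega> = t - \<tau>" "m t \<omega> \<le> ?a"
        then show ?thesis using \<omega> \<mu> by (simp add: level_gap_def)
      next
        assume "\<not> m t \<omega> \<le> ?a" "level_gap ?a t \<omega> = 0"
        then show ?thesis using m_le_B[OF \<omega> t0 order_refl] by simp
      qed
    qed
    also have "\<dots> = e - \<mu> * t + \<mu> * t * ?p"
      using expectation_B[OF t0] by (simp add: less_top[symmetric] prob_space)
    finally have "\<mu> * t * (1 - e / (\<mu> * t)) \<le> \<mu> * t * ?p" using \<mu> t by (simp add: right_diff_distrib)
    then have "1 - e / (\<mu> * t) \<le> ?p" using \<mu> t by (simp add: mult_le_cancel_left_pos)
    also have "\<dots> \<le> prob {\<omega> \<in> space M. m t \<omega> < x0}" using e by (intro finite_measure_mono) auto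
    finally show ?thesis .
  qed
  have "1 \<le> prob {\<omega> \<in> space M. m t \<omega> < x0}"
  proof (rule field_le_epsilon)
    fix e :: real assume e: "0 < e"
    show "1 \<le> prob {\<omega> \<in> space M. m t \<omega> < x0} + e"
      using ge[of "e * (\<mu> * t)"] e \<mu> t by simp
  qed
  then have "prob {\<omega> \<in> space M. m t \<omega> < x0} = 1" using prob_le_1 by (intro antisym) auto
  then show ?thesis by (subst (asm) prob_Collect_eq_1) auto
qed

lemma AE_first_passage_start: "AE \<omega> in M. first_passage (\<lambda>t. B t \<omega>) x0 = 0"
proof -
  have "AE \<omega> in M. \<forall>n. m (inverse (real (Suc n))) \<omega> < x0"
    unfolding AE_all_countable by (intro allI AE_m_less) simp
  then show ?thesis
  proof (rule AE_mp, intro AE_I2 impI)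
    fix \<omega> assume \<omega>: "\<omega> \<in> space M" and lt: "\<forall>n. m (inverse (real (Suc n))) \<omega> < x0"
    interpret p: continuous_path "\<lambda>t. B t \<omega>" by (rule path[OF \<omega>])
    have "first_passage (\<lambda>t. B t \<omega>) x0 \<le> 0"
    proof (rule ennreal_le_epsilon)
      fix e :: real assume "0 < e"
      then obtain n where n: "inverse (real (Suc n)) < e" using reals_Archimedean by blast
      let ?t = "inverse (real (Suc n))"
      obtain s where s: "0 \<le> s" "s \<le> ?t" "B s \<omega> = m ?t \<omega>"
        using p.running_min_attained[of ?t] unfolding m_def by auto
      then have "B s \<omega> < x0" using lt by auto
      then have "0 < s" using s(1) B_0[OF \<omega>] by (cases "s = 0") auto
      then have "first_passage (\<lambda>t. B t \<omega>) x0 \<le> ennreal s" using \<open>B s \<omega> < x0\<close> by (intro first_passage_lower) auto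
      also have "\<dots> \<le> ennreal e" using s n by (intro ennreal_leI) simp
      finally show "first_passage (\<lambda>t. B t \<omega>) x0 \<le> 0 + ennreal e" by simp
    qed
    then show "first_passage (\<lambda>t. B t \<omega>) x0 = 0" by simp
  qed
qed

end

section \<open>Long-run averages of the controlled process\<close>

text \<open>Rounding time up to multiples of 1 / Suc n leaves countably many times, where joint
  measurability is clear; path continuity passes to the limit. Cutting time at 0 defines the process
  for all real times.\<close>

lemma measurable_continuous_process:
  fixes X :: "real \<Rightarrow> 'a \<Rightarrow> real"
  assumes meas: "\<And>t. 0 \<le> t \<Longrightarrow> X t \<in> borel_measurable M"
    and cont: "\<And>\<omega>. \<omega> \<in> space M \<Longrightarrow> continuous_on {0..} (\<lambda>t. X t \<omega>)"
  shows "(\<lambda>p. X (max 0 (fst p)) (snd p)) \<in> borel_measurable ((borel :: real measure) \<Otimes>\<^sub>M M)"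
proof (rule borel_measurable_LIMSEQ_real)
  define r where "r n s = real (nat \<lceil>real (Suc n) * max 0 s\<rceil>) / real (Suc n)" for n and s :: real
  show "(\<lambda>p. X (r n (fst p)) (snd p)) \<in> borel_measurable ((borel :: real measure) \<Otimes>\<^sub>M M)" for n
  proof -
    have g: "(\<lambda>p. nat \<lceil>real (Suc n) * max 0 (fst p)\<rceil>) \<in> measurable ((borel :: real measure) \<Otimes>\<^sub>M M) (count_space UNIV)"
      by measurable
    have f: "(\<lambda>p. X (real i / real (Suc n)) (snd p)) \<in> borel_measurable ((borel :: real measure) \<Otimes>\<^sub>M M)" for i
      by (rule measurable_compose[OF measurable_snd meas]) simp
    show ?thesis unfolding r_def by (rule measurable_compose_countable[OF f g])
  qed
  fix p assume "p \<in> space ((borel :: real measure) \<Otimes>\<^sub>M M)"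
  then have \<omega>: "snd p \<in> space M" by (auto simp: space_pair_measure)
  let ?s = "max 0 (fst p)"
  have le: "?s \<le> r n (fst p)" "r n (fst p) \<le> ?s + 1 / real (Suc n)" for n
  proof -
    define s where "s = ?s"
    let ?x = "real (Suc n) * s"
    have x: "0 \<le> ?x" by (simp add: s_def)
    have i: "real (nat \<lceil>?x\<rceil>) = of_int \<lceil>?x\<rceil>" using x by simp
    have "?x \<le> of_int \<lceil>?x\<rceil>" "of_int \<lceil>?x\<rceil> \<le> ?x + 1" by linarith+
    then show "?s \<le> r n (fst p)" "r n (fst p) \<le> ?s + 1 / real (Suc n)"
      unfolding r_def s_def[symmetric] i by (simp_all add: field_simps del: of_nat_Suc)
  qed
  have "(\<lambda>n. ?s + 1 / real (Suc n)) \<longlonglongrightarrow> ?s + 0"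
    using LIMSEQ_inverse_real_of_nat by (intro tendsto_intros) (simp add: inverse_eq_divide)
  then have "(\<lambda>n. r n (fst p)) \<longlonglongrightarrow> ?s"
    by (intro tendsto_sandwich[OF _ _ tendsto_const, of ?s "\<lambda>n. r n (fst p)"]) (use le in auto)
  then show "(\<lambda>n. X (r n (fst p)) (snd p)) \<longlonglongrightarrow> X ?s (snd p)"
    using le(1) by (intro continuous_on_tendsto_compose[OF cont[OF \<omega>]])
      (auto intro!: always_eventually order_trans[OF _ le(1)])
qed

text \<open>The \<open>+ 1\<close> counts the level with index 0, and \<open>nat\<close> gives 0
  while x is still above c.\<close>

definition count_levels :: "real \<Rightarrow> real \<Rightarrow> real \<Rightarrow> nat" where
  "count_levels c q x = nat (\<lfloor>(c - x) / q\<rfloor> + 1)"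

lemma less_count_levels_iff:
  assumes "0 < q"
  shows "k < count_levels c q x \<longleftrightarrow> x \<le> c - real k * q"
proof -
  have "k < count_levels c q x \<longleftrightarrow> int k \<le> \<lfloor>(c - x) / q\<rfloor>"
    unfolding count_levels_def by linarith
  also have "\<dots> \<longleftrightarrow> real k \<le> (c - x) / q" by (simp add: le_floor_iff)
  also have "\<dots> \<longleftrightarrow> x \<le> c - real k * q" using assms by (auto simp: field_simps)
  finally show ?thesis .
qed

lemma real_count_levels: "real (count_levels c q x) = max 0 (of_int \<lfloor>(c - x) / q\<rfloor> + 1)"
  by (auto simp: count_levels_def)

lemma count_levels_bounds:
  assumes q: "0 < q"
  shows "c - x < q * real (count_levels c q x)" "q * real (count_levels c q x) \<le> max 0 (c - x + q)"
proof -
  have c: "c - x = q * ((c - x) / q)" using q by simp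
  have "q * ((c - x) / q) < q * real (count_levels c q x)"
    unfolding real_count_levels using q by (intro mult_strict_left_mono) linarith+
  then show "c - x < q * real (count_levels c q x)" using c by simp
  have "q * real (count_levels c q x) \<le> q * max 0 ((c - x) / q + 1)"
    unfolding real_count_levels using q by (intro mult_left_mono) linarith+
  also have "\<dots> = max 0 (c - x + q)" using q by (auto simp: max_def field_simps)
  finally show "q * real (count_levels c q x) \<le> max 0 (c - x + q)" .
qed

lemma count_levels_antimono: "0 < q \<Longrightarrow> x \<le> x' \<Longrightarrow> count_levels c q x' \<le> count_levels c q x"
  unfolding count_levels_def by (intro nat_mono add_right_mono floor_mono divide_right_mono) auto

section \<open>Mean time integral of the path and sublinearity of its drawup\<close>

context drifted_brownian_motion
begin

abbreviation drawup2 :: "real \<Rightarrow> real" where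
  "drawup2 t \<equiv> expectation (\<lambda>\<omega>. (B t \<omega> - m t \<omega>)\<^sup>2)"

lemma m_cont: "\<omega> \<in> space M \<Longrightarrow> continuous_on {0..} (\<lambda>t. m t \<omega>)"
  unfolding m_def by (rule continuous_path.continuous_running_min[OF path])

lemma m_le_x0: "\<omega> \<in> space M \<Longrightarrow> 0 \<le> t \<Longrightarrow> m t \<omega> \<le> x0"
  using m_le_B[of \<omega> 0 t] by (simp add: B_0)

lemma expectation_integral_B:
  assumes t: "0 \<le> t"
  shows "integrable M (\<lambda>\<omega>. LINT s:{0..t}|lborel. B s \<omega>)"
    and "expectation (\<lambda>\<omega>. LINT s:{0..t}|lborel. B s \<omega>) = x0 * t - \<mu> * t\<^sup>2 / 2"
proof -
  interpret P: pair_sigma_finite lborel M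
    by (intro pair_sigma_finite.intro sigma_finite_lborel sigma_finite_measure_axioms)
  define f where "f p = indicator {0..t} (fst p) * B (max 0 (fst p)) (snd p)" for p
  have f: "f (s, \<omega>) = indicator {0..t} s *\<^sub>R B s \<omega>" for s \<omega>
    by (simp add: f_def indicator_def)
  have f_meas [measurable]: "f \<in> borel_measurable (lborel \<Otimes>\<^sub>M M)"
  proof -
    have [measurable]: "(\<lambda>p. B (max 0 (fst p)) (snd p)) \<in> borel_measurable (lborel \<Otimes>\<^sub>M M)"
      using measurable_continuous_process[of B M, OF B_meas B_cont] by (simp cong: measurable_cong_sets sets_pair_measure_cong)
    show ?thesis unfolding f_def by measurable
  qed
  have fi: "integrable M (\<lambda>\<omega>. f (s, \<omega>))" for s
    unfolding f using expectation_B(1)[of s] by (cases "s \<in> {0..t}") auto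
  have fe: "expectation (\<lambda>\<omega>. f (s, \<omega>)) = indicator {0..t} s * (x0 - \<mu> * s)" for s
    unfolding f using expectation_B(1,2)[of s] by (cases "s \<in> {0..t}") auto
  \<comment> \<open>A bound for E|B s| that is uniform over s in [0,t], from |x| <= 1 + x^2 and the
    second moment.\<close>
  define K where "K = 1 + (\<bar>x0\<bar> + \<mu> * t)\<^sup>2 + \<sigma>\<^sup>2 * t"
  have bound: "expectation (\<lambda>\<omega>. norm (f (s, \<omega>))) \<le> indicator {0..t} s * K" for s
  proof (cases "s \<in> {0..t}")
    case True
    have "expectation (\<lambda>\<omega>. norm (f (s, \<omega>))) \<le> expectation (\<lambda>\<omega>. 1 + (B s \<omega>)\<^sup>2)"
      using True expectation_B(1,3)[of s]
      by (intro integral_mono integrable_norm fi) (auto simp: f abs_le_one_plus_square)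
    also have "\<dots> = 1 + ((x0 - \<mu> * s)\<^sup>2 + \<sigma>\<^sup>2 * s)"
      using True expectation_B(3,4)[of s] by (simp add: prob_space)
    also have "\<dots> \<le> K"
    proof -
      have "0 \<le> \<mu> * s" "\<mu> * s \<le> \<mu> * t" using True \<mu> by auto
      then have "\<bar>x0 - \<mu> * s\<bar> \<le> \<bar>x0\<bar> + \<mu> * t" by linarith
      then have "\<bar>x0 - \<mu> * s\<bar>\<^sup>2 \<le> (\<bar>x0\<bar> + \<mu> * t)\<^sup>2" by (intro power_mono) auto
      moreover have "\<sigma>\<^sup>2 * s \<le> \<sigma>\<^sup>2 * t" using True by (intro mult_left_mono) auto
      ultimately show ?thesis by (simp add: K_def)
    qed
    finally show ?thesis using True by simp
  qed (simp add: f)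
  have "integrable lborel (\<lambda>s. indicator {0..t} s * K)" using t by simp
  then have "integrable lborel (\<lambda>s. expectation (\<lambda>\<omega>. norm (f (s, \<omega>))))"
    by (rule Bochner_Integration.integrable_bound)
       (use bound order_trans[OF bound abs_ge_self] in \<open>auto intro!: AE_I2 simp: Bochner_Integration.integral_nonneg\<close>)
  then have int: "integrable (lborel \<Otimes>\<^sub>M M) f"
    by (intro P.Fubini_integrable f_meas AE_I2 fi)
  have eq: "(\<integral>s. f (s, \<omega>) \<partial>lborel) = (LINT s:{0..t}|lborel. B s \<omega>)" for \<omega>
    by (simp add: f set_lebesgue_integral_def)
  show "integrable M (\<lambda>\<omega>. LINT s:{0..t}|lborel. B s \<omega>)"
    using P.integrable_snd[of "\<lambda>s \<omega>. f (s, \<omega>)"] int by (simp add: eq case_prod_eta)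
  have "expectation (\<lambda>\<omega>. LINT s:{0..t}|lborel. B s \<omega>) = (\<integral>s. expectation (\<lambda>\<omega>. f (s, \<omega>)) \<partial>lborel)"
    using P.Fubini_integral[of "\<lambda>s \<omega>. f (s, \<omega>)"] int by (simp add: eq case_prod_eta)
  also have "\<dots> = (\<integral>s. (x0 - \<mu> * s) * indicator {0..t} s \<partial>lborel)"
    by (simp add: fe mult.commute)
  also have "\<dots> = (x0 * t - \<mu> * t\<^sup>2 / 2) - (x0 * 0 - \<mu> * 0\<^sup>2 / 2)"
    by (rule integral_FTC_Icc_real[OF t]) (auto intro!: derivative_eq_intros continuous_intros simp: power2_eq_square)
  finally show "expectation (\<lambda>\<omega>. LINT s:{0..t}|lborel. B s \<omega>) = x0 * t - \<mu> * t\<^sup>2 / 2" by simp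
qed

text \<open>The distance to the running minimum is the maximum of \<open>B t - B s\<close> over \<open>s \<le> t\<close>. On the last \<open>h\<close> time
  units it is at most an oscillation; further back the drift makes it negative unless \<open>2 \<sigma> sup \<bar>W\<bar> \<ge> \<mu> h\<close>.\<close>

lemma distance_to_minimum_bound:
  assumes \<omega>: "\<omega> \<in> space M" and h: "0 < h" "h \<le> t"
  shows "(B t \<omega> - m t \<omega>)\<^sup>2 \<le> 4 * \<sigma>\<^sup>2 * (osc (t - h) h \<omega>)\<^sup>2 + 16 * \<sigma> ^ 4 * osc 0 t \<omega> ^ 4 / (\<mu> * h)\<^sup>2"
proof -
  interpret p: continuous_path "\<lambda>t. B t \<omega>" by (rule path[OF \<omega>])
  have t: "0 \<le> t" using h by simp
  obtain s where s: "0 \<le> s" "s \<le> t" "B s \<omega> = m t \<omega>"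
    using p.running_min_attained[OF t] unfolding m_def by auto
  have eq: "B t \<omega> - m t \<omega> = \<sigma> * (W t \<omega> - W s \<omega>) - \<mu> * (t - s)"
    unfolding s(3)[symmetric] by (simp add: drifted_bm_def algebra_simps)
  have D0: "0 \<le> B t \<omega> - m t \<omega>" using m_le_B[OF \<omega> t order_refl] by simp
  have nn: "0 \<le> 16 * \<sigma> ^ 4 * osc 0 t \<omega> ^ 4 / (\<mu> * h)\<^sup>2" "0 \<le> 4 * \<sigma>\<^sup>2 * (osc (t - h) h \<omega>)\<^sup>2"
    using \<sigma> osc_nonneg[OF \<omega> order_refl t] by auto
  show ?thesis
  proof (cases "t - h \<le> s")
    case True
    have "\<bar>W t \<omega> - W (t - h) \<omega>\<bar> \<le> osc (t - h) h \<omega>" "\<bar>W s \<omega> - W (t - h) \<omega>\<bar> \<le> osc (t - h) h \<omega>"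
      using True s h by (auto intro!: osc_upper[OF \<omega>])
    then have "W t \<omega> - W s \<omega> \<le> 2 * osc (t - h) h \<omega>" by linarith
    then have "\<sigma> * (W t \<omega> - W s \<omega>) \<le> \<sigma> * (2 * osc (t - h) h \<omega>)" using \<sigma> by (intro mult_left_mono) auto
    moreover have "0 \<le> \<mu> * (t - s)" using \<mu> s by simp
    ultimately have "B t \<omega> - m t \<omega> \<le> \<sigma> * (2 * osc (t - h) h \<omega>)" unfolding eq by linarith
    then have "(B t \<omega> - m t \<omega>)\<^sup>2 \<le> (\<sigma> * (2 * osc (t - h) h \<omega>))\<^sup>2" using D0 by (intro power_mono)
    also have "\<dots> = 4 * \<sigma>\<^sup>2 * (osc (t - h) h \<omega>)\<^sup>2" by (simp add: power_mult_distrib)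
    finally show ?thesis using nn(1) by linarith
  next
    case False
    define Z where "Z = \<sigma> * (2 * osc 0 t \<omega>)"
    have "W t \<omega> - W s \<omega> \<le> 2 * osc 0 t \<omega>"
      using W_le_osc[OF \<omega> s(1,2)] W_le_osc[OF \<omega> t order_refl] by linarith
    then have "\<sigma> * (W t \<omega> - W s \<omega>) \<le> Z" unfolding Z_def using \<sigma> by (intro mult_left_mono) auto
    moreover have "\<mu> * h \<le> \<mu> * (t - s)" using False \<mu> by (intro mult_left_mono) auto
    moreover have "0 \<le> \<mu> * h" using \<mu> h by simp
    ultimately have Z: "B t \<omega> - m t \<omega> \<le> Z" "\<mu> * h \<le> Z" using D0 unfolding eq by linarith+
    have "(B t \<omega> - m t \<omega>)\<^sup>2 \<le> Z\<^sup>2" using D0 Z by (intro power_mono)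
    \<comment> \<open>A pathwise Markov inequality: Z >= \<mu> h allows a factor (Z / (\<mu> h))^2
      >= 1, which trades a second power of the oscillation for a fourth and gains h^(-2).\<close>
    also have "Z\<^sup>2 \<le> Z\<^sup>2 * (Z\<^sup>2 / (\<mu> * h)\<^sup>2)"
    proof -
      have "(\<mu> * h)\<^sup>2 \<le> Z\<^sup>2" using Z \<open>0 \<le> \<mu> * h\<close> by (intro power_mono)
      then have "1 \<le> Z\<^sup>2 / (\<mu> * h)\<^sup>2" using \<mu> h by simp
      then show ?thesis using mult_left_mono[of 1 "Z\<^sup>2 / (\<mu> * h)\<^sup>2" "Z\<^sup>2"] by simp
    qed
    also have "\<dots> = 16 * \<sigma> ^ 4 * osc 0 t \<omega> ^ 4 / (\<mu> * h)\<^sup>2"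
      by (simp add: Z_def power_mult_distrib power2_eq_square power4_eq_xxxx)
    finally show ?thesis using nn(2) by linarith
  qed
qed

text \<open>The interpolation x^2 <= h + x^4 / h keeps the Brownian scaling in h; 1 + 81/4 is
  rounded up to 22.\<close>

lemma expectation_osc2:
  assumes s: "0 \<le> s" and h: "0 < h"
  shows "expectation (\<lambda>\<omega>. (osc s h \<omega>)\<^sup>2) \<le> 22 * h"
proof -
  have h0: "0 \<le> h" using h by simp
  have "expectation (\<lambda>\<omega>. (osc s h \<omega>)\<^sup>2) \<le> expectation (\<lambda>\<omega>. h + osc s h \<omega> ^ 4 / h)"
  proof (rule integral_mono)
    fix \<omega>
    have "0 \<le> ((osc s h \<omega>)\<^sup>2 - h / 2)\<^sup>2" by simp
    then have "(osc s h \<omega>)\<^sup>2 * h \<le> osc s h \<omega> ^ 4 + h\<^sup>2 / 4"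
      by (simp add: power2_diff power_mult[symmetric] power_divide)
    also have "\<dots> \<le> (h + osc s h \<omega> ^ 4 / h) * h" using h by (simp add: power2_eq_square field_simps)
    finally show "(osc s h \<omega>)\<^sup>2 \<le> h + osc s h \<omega> ^ 4 / h" using h by simp
  qed (use integrable_osc[OF s h0] integrable_osc4[OF s h0] in auto)
  also have "\<dots> = h + expectation (\<lambda>\<omega>. osc s h \<omega> ^ 4) / h"
    using integrable_osc4[OF s h0] by (simp add: prob_space)
  also have "\<dots> \<le> h + (81 / 4 * h\<^sup>2) / h"
    using expectation_osc4[OF s h0] h by (intro add_left_mono divide_right_mono) auto
  also have "\<dots> \<le> 22 * h" using h by (simp add: power2_eq_square)
  finally show ?thesis .
qed

lemma expectation_distance_to_minimum:
  assumes h: "0 < h" "h \<le> t"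
  shows "integrable M (\<lambda>\<omega>. (B t \<omega> - m t \<omega>)\<^sup>2)"
    and "drawup2 t \<le> 88 * \<sigma>\<^sup>2 * h + 324 * \<sigma> ^ 4 * t\<^sup>2 / (\<mu> * h)\<^sup>2"
proof -
  have t: "0 \<le> t" and h0: "0 \<le> h" and th: "0 \<le> t - h" using h by auto
  note [measurable] = m_meas[OF t] B_meas[OF t]
  let ?R = "\<lambda>\<omega>. 4 * \<sigma>\<^sup>2 * (osc (t - h) h \<omega>)\<^sup>2 + 16 * \<sigma> ^ 4 / (\<mu> * h)\<^sup>2 * osc 0 t \<omega> ^ 4"
  have R: "(B t \<omega> - m t \<omega>)\<^sup>2 \<le> ?R \<omega>" if "\<omega> \<in> space M" for \<omega>
    using distance_to_minimum_bound[OF that h] by simp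
  have Ri: "integrable M ?R" using integrable_osc[OF th h0] integrable_osc4[OF order_refl t] by simp
  show i: "integrable M (\<lambda>\<omega>. (B t \<omega> - m t \<omega>)\<^sup>2)"
    by (rule Bochner_Integration.integrable_bound[OF Ri]) (auto intro!: AE_I2 order_trans[OF R])
  have "drawup2 t \<le> expectation ?R"
    by (rule integral_mono[OF i Ri R])
  also have "\<dots> = 4 * \<sigma>\<^sup>2 * expectation (\<lambda>\<omega>. (osc (t - h) h \<omega>)\<^sup>2) + 16 * \<sigma> ^ 4 / (\<mu> * h)\<^sup>2 * expectation (\<lambda>\<omega>. osc 0 t \<omega> ^ 4)"
    using integrable_osc[OF th h0] integrable_osc4[OF order_refl t] by simp
  \<comment> \<open>The constants of the next bound are 88 = 4 * 22 and 324 = 16 * 81/4.\<close>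
  also have "\<dots> \<le> 4 * \<sigma>\<^sup>2 * (22 * h) + 16 * \<sigma> ^ 4 / (\<mu> * h)\<^sup>2 * (81 / 4 * t\<^sup>2)"
    using expectation_osc2[OF th h(1)] expectation_osc4[OF order_refl t]
    by (intro add_mono mult_left_mono) auto
  also have "\<dots> = 88 * \<sigma>\<^sup>2 * h + 324 * \<sigma> ^ 4 * t\<^sup>2 / (\<mu> * h)\<^sup>2" by simp
  finally show "drawup2 t \<le> 88 * \<sigma>\<^sup>2 * h + 324 * \<sigma> ^ 4 * t\<^sup>2 / (\<mu> * h)\<^sup>2" .
qed

lemma distance_to_minimum_sublinear:
  "((\<lambda>t. drawup2 t / t) \<longlongrightarrow> 0) at_top"
proof (rule tendsto_sandwich[OF _ _ tendsto_const])
  let ?K = "88 * \<sigma>\<^sup>2 + 324 * \<sigma> ^ 4 / \<mu>\<^sup>2"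
  show "eventually (\<lambda>t. 0 \<le> drawup2 t / t) at_top"
    using eventually_ge_at_top[of 0] by eventually_elim (auto intro!: divide_nonneg_nonneg)
  show "eventually (\<lambda>t. drawup2 t / t \<le> ?K * t powr (- 1 / 3)) at_top"
    using eventually_ge_at_top[of 1]
  proof eventually_elim
    case (elim t)
    \<comment> \<open>The two error terms are of order h and t^2 / h^2; h = t^(2/3) balances them,
      so that division by t leaves t^(-1/3).\<close>
    define h where "h = t powr (2 / 3)"
    have h: "0 < h" "h \<le> t" using elim powr_mono[of "2/3" 1 t] by (auto simp: h_def)
    have t: "0 < t" using elim by simp
    have "h\<^sup>2 = t powr (4 / 3)" unfolding h_def power2_eq_square by (simp add: powr_add[symmetric])
    moreover have "t\<^sup>2 = t powr (4 / 3) * h"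
      unfolding h_def using t by (simp add: powr_add[symmetric] powr_numeral)
    ultimately have th: "t\<^sup>2 / (\<mu> * h)\<^sup>2 = h / \<mu>\<^sup>2" using t by (simp add: power_mult_distrib)
    have "drawup2 t \<le> 88 * \<sigma>\<^sup>2 * h + 324 * \<sigma> ^ 4 * (t\<^sup>2 / (\<mu> * h)\<^sup>2)"
      using expectation_distance_to_minimum(2)[OF h] by simp
    also have "\<dots> = ?K * h" unfolding th by (simp add: algebra_simps)
    finally have "drawup2 t / t \<le> ?K * h / t" using t by (intro divide_right_mono) auto
    also have "\<dots> = ?K * (h / t powr 1)" using t by simp
    also have "h / t powr 1 = t powr (- 1 / 3)" unfolding h_def by (subst powr_diff[symmetric]) simp
    finally show ?case .
  qed
  have "((\<lambda>t::real. t powr (- 1 / 3)) \<longlongrightarrow> 0) at_top"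
    by (rule tendsto_neg_powr) (auto intro: filterlim_ident)
  then show "((\<lambda>t. ?K * t powr (- 1 / 3)) \<longlongrightarrow> 0) at_top"
    by (rule tendsto_mult_right_zero)
qed

end

section \<open>The level process V and its long-run averages\<close>

text \<open>With \<open>q = z - y\<close> and \<open>c = min x0 y\<close>, the process \<open>V\<close> below is the inventory under the \<open>(y,z)\<close> policy up to
  the constant \<open>y - c\<close>, and \<open>N t\<close> is the number of orders up to \<open>t\<close>.\<close>

locale order_levels = drifted_brownian_motion +
  fixes c q :: real
  assumes c: "c \<le> x0" and q: "0 < q"
begin

abbreviation lev :: "nat \<Rightarrow> real" where "lev k \<equiv> c - real k * q"

definition N :: "real \<Rightarrow> 'a \<Rightarrow> real" where
  "N t \<omega> = real (count_levels c q (m t \<omega>))"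

definition V :: "real \<Rightarrow> 'a \<Rightarrow> real" where
  "V t \<omega> = B t \<omega> + q * N t \<omega>"

abbreviation V2 :: "real \<Rightarrow> real" where
  "V2 t \<equiv> expectation (\<lambda>\<omega>. (V t \<omega>)\<^sup>2)"

abbreviation IV :: "real \<Rightarrow> real" where
  "IV t \<equiv> expectation (\<lambda>\<omega>. LINT s:{0..t}|lborel. V s \<omega>)"

lemma lev_le: "lev k \<le> x0"
  using c q by (smt (verit) mult_nonneg_nonneg of_nat_0_le_iff)

lemma N_nonneg: "0 \<le> N t \<omega>"
  by (simp add: N_def)

lemma N_meas [measurable]: "0 \<le> t \<Longrightarrow> N t \<in> borel_measurable M"
  using m_meas[of t] unfolding N_def real_count_levels by measurable

lemma V_meas [measurable]: "0 \<le> t \<Longrightarrow> V t \<in> borel_measurable M"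
  using B_meas[of t] N_meas[of t] unfolding V_def by measurable

lemma V_bounds:
  assumes \<omega>: "\<omega> \<in> space M" and t: "0 \<le> t"
  shows "c < V t \<omega>" "V t \<omega> \<le> B t \<omega> - m t \<omega> + (\<bar>c\<bar> + q + \<bar>x0\<bar>)"
  using count_levels_bounds[OF q, of c "m t \<omega>"] m_le_B[OF \<omega> t order_refl] m_le_x0[OF \<omega> t] q
  unfolding V_def N_def by linarith+

lemma V_abs_bound:
  assumes \<omega>: "\<omega> \<in> space M" and t: "0 \<le> t"
  shows "\<bar>V t \<omega>\<bar> \<le> B t \<omega> - m t \<omega> + (\<bar>c\<bar> + q + \<bar>x0\<bar>)"
  using V_bounds[OF assms] m_le_B[OF \<omega> t order_refl] q by linarith

lemma V_square_bound:
  assumes \<omega>: "\<omega> \<in> space M" and t: "0 \<le> t"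
  shows "(V t \<omega>)\<^sup>2 \<le> 2 * (B t \<omega> - m t \<omega>)\<^sup>2 + 2 * (\<bar>c\<bar> + q + \<bar>x0\<bar>)\<^sup>2"
proof -
  let ?D = "B t \<omega> - m t \<omega>" and ?K = "\<bar>c\<bar> + q + \<bar>x0\<bar>"
  have "(V t \<omega>)\<^sup>2 = \<bar>V t \<omega>\<bar>\<^sup>2" by simp
  also have "\<dots> \<le> (?D + ?K)\<^sup>2" by (intro power_mono V_abs_bound assms) simp
  also have "\<dots> \<le> 2 * ?D\<^sup>2 + 2 * ?K\<^sup>2"
  proof -
    have "(a + b)\<^sup>2 \<le> 2 * a\<^sup>2 + 2 * b\<^sup>2" for a b :: real
      using sum_squares_bound[of a b] by (simp add: power2_sum)
    then show ?thesis .
  qed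
  finally show ?thesis .
qed

lemma N_bound:
  assumes \<omega>: "\<omega> \<in> space M" and t: "0 \<le> t"
  shows "q * N t \<omega> \<le> \<mu> * t + \<sigma> * osc 0 t \<omega> + q"
proof -
  have "0 \<le> \<mu> * t + \<sigma> * osc 0 t \<omega> + q" using \<mu> \<sigma> q t osc_nonneg[OF \<omega> order_refl t] by simp
  then show ?thesis
    using count_levels_bounds(2)[OF q, of c "m t \<omega>"] m_ge_osc[OF \<omega> t] c by (auto simp: N_def)
qed

lemma V_integrable:
  assumes t: "0 \<le> t"
  shows "integrable M (\<lambda>\<omega>. (V t \<omega>)\<^sup>2)" "integrable M (V t)" "integrable M (N t)"
proof -
  note [measurable] = V_meas[OF t] N_meas[OF t] B_meas[OF t] m_meas[OF t]
  have "integrable M (\<lambda>\<omega>. (B t \<omega> - m t \<omega>)\<^sup>2)"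
  proof (cases "t = 0")
    case True
    have "B 0 \<omega> - m 0 \<omega> = 0" if "\<omega> \<in> space M" for \<omega>
      by (simp add: m_def continuous_path.running_min_0[OF path[OF that]])
    then show ?thesis using True by (subst Bochner_Integration.integrable_cong[OF refl, where g="\<lambda>_. 0"]) auto
  next
    case False
    then show ?thesis using t expectation_distance_to_minimum(1)[of t t] by simp
  qed
  then have R: "integrable M (\<lambda>\<omega>. 2 * (B t \<omega> - m t \<omega>)\<^sup>2 + 2 * (\<bar>c\<bar> + q + \<bar>x0\<bar>)\<^sup>2)" by simp
  show V2: "integrable M (\<lambda>\<omega>. (V t \<omega>)\<^sup>2)"
    by (rule Bochner_Integration.integrable_bound[OF R]) (auto intro!: AE_I2 order_trans[OF V_square_bound[OF _ t]])
  show V1: "integrable M (V t)" by (rule square_integrable_imp_integrable[OF _ V2]) measurable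
  have "integrable M (\<lambda>\<omega>. (V t \<omega> - B t \<omega>) / q)" using V1 expectation_B(1)[OF t] by simp
  also have "(\<lambda>\<omega>. (V t \<omega> - B t \<omega>) / q) = N t" using q by (simp add: V_def fun_eq_iff)
  finally show "integrable M (N t)" .
qed

lemma expectation_V:
  assumes t: "0 \<le> t"
  shows "expectation (V t) = x0 - \<mu> * t + q * expectation (N t)"
  unfolding V_def using expectation_B[OF t] V_integrable(3)[OF t] by simp

text \<open>A layer-cake formula: N s is the sum over k of the indicators of m s <=
  \<open>lev k\<close>, and for s <= t only the levels passed by time t contribute.\<close>

lemma integral_N:
  assumes \<omega>: "\<omega> \<in> space M" and t: "0 \<le> t"
  shows "set_integrable lborel {0..t} (\<lambda>s. N s \<omega>)"
    and "(LINT s:{0..t}|lborel. N s \<omega>) = (\<Sum>k<count_levels c q (m t \<omega>). overtime (lev k) t \<omega>)"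
proof -
  let ?K = "count_levels c q (m t \<omega>)"
  define S where "S k = {s \<in> {0..t}. m s \<omega> \<le> lev k}" for k
  have S_meas [measurable]: "S k \<in> sets lborel" for k
  proof -
    have "closed (S k)" unfolding S_def
      by (rule continuous_on_closed_Collect_le) (auto intro: continuous_on_subset[OF m_cont[OF \<omega>]] continuous_on_const)
    then show ?thesis by simp
  qed
  have S_fin: "emeasure lborel (S k) < \<infinity>" for k
  proof -
    have "emeasure lborel (S k) \<le> emeasure lborel {0..t}" by (rule emeasure_mono) (auto simp: S_def)
    then show ?thesis using t by (simp add: le_less_trans)
  qed
  have eq: "indicator {0..t} s *\<^sub>R N s \<omega> = (\<Sum>k<?K. indicat_real (S k) s)" for s
  proof (cases "s \<in> {0..t}")
    case True
    have le: "count_levels c q (m s \<omega>) \<le> ?K"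
      using True continuous_path.running_min_antimono[OF path[OF \<omega>], of s t]
      by (intro count_levels_antimono q) (simp add: m_def)
    have "(\<Sum>k<?K. indicat_real (S k) s) = (\<Sum>k<?K. if k < count_levels c q (m s \<omega>) then 1 else 0)"
      using True by (intro sum.cong) (auto simp: S_def less_count_levels_iff[OF q])
    also have "\<dots> = (\<Sum>k<count_levels c q (m s \<omega>). 1)"
      using le by (intro sum.mono_neutral_cong_right) auto
    finally show ?thesis using True by (simp add: N_def)
  qed (auto simp: S_def indicator_def)
  have i: "integrable lborel (indicator (S k) :: real \<Rightarrow> real)" for k
    by (rule integrable_real_indicator[OF S_meas S_fin])
  show "set_integrable lborel {0..t} (\<lambda>s. N s \<omega>)"
    unfolding set_integrable_def eq using i by simp
  show "(LINT s:{0..t}|lborel. N s \<omega>) = (\<Sum>k<?K. overtime (lev k) t \<omega>)"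
    unfolding set_lebesgue_integral_def eq using i by (simp add: overtime_def S_def)
qed

lemma sum_lev: "(\<Sum>k<n. lev k) = real n * c - q * (real n * (real n - 1) / 2)"
  by (induction n) (auto simp: algebra_simps field_simps)

text \<open>With n passed levels the terms B - lev k sum to a quadratic polynomial in n, which the
  substitution q n = V - B turns into a difference of squares. The q / 2 beside c comes from n (n -
  1) / 2.\<close>

lemma quadratic_identity:
  assumes \<omega>: "\<omega> \<in> space M" and t: "0 \<le> t"
  shows "q * (\<Sum>k<count_levels c q (m t \<omega>). level_gap (lev k) t \<omega>) =
    ((V t \<omega>)\<^sup>2 - (B t \<omega>)\<^sup>2) / 2 - (c + q / 2) * (V t \<omega> - B t \<omega>) + \<mu> * q * (LINT s:{0..t}|lborel. N s \<omega>)"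
proof -
  let ?K = "count_levels c q (m t \<omega>)"
  have "(\<Sum>k<?K. level_gap (lev k) t \<omega>) = (\<Sum>k<?K. B t \<omega> - lev k + \<mu> * overtime (lev k) t \<omega>)"
    by (rule sum.cong) (auto simp: level_gap_def less_count_levels_iff[OF q])
  also have "\<dots> = real ?K * B t \<omega> - (\<Sum>k<?K. lev k) + \<mu> * (\<Sum>k<?K. overtime (lev k) t \<omega>)"
    by (simp add: sum.distrib sum_subtractf sum_distrib_left)
  also have "\<dots> = real ?K * B t \<omega> - (real ?K * c - q * (real ?K * (real ?K - 1) / 2)) + \<mu> * (LINT s:{0..t}|lborel. N s \<omega>)"
    unfolding sum_lev integral_N(2)[OF assms] ..
  finally have g: "(\<Sum>k<?K. level_gap (lev k) t \<omega>) = \<dots>" .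
  have "q * (n * b - (n * c - q * (n * (n - 1) / 2)) + \<mu> * I) =
    ((b + q * n)\<^sup>2 - b\<^sup>2) / 2 - (c + q / 2) * (b + q * n - b) + \<mu> * q * I" for n b I :: real
    by (simp add: field_simps power2_eq_square)
  then show ?thesis unfolding g V_def N_def[of t] .
qed

text \<open>The number of nonzero terms is random, so linearity alone does not give the mean. All
  partial sums are at most 2 \<sigma> times N t times the oscillation; as N t grows at most linearly
  in the oscillation, its second moment suffices for domination.\<close>

lemma expectation_sum_level_gap:
  assumes t: "0 \<le> t"
  defines "g \<equiv> \<lambda>\<omega>. \<Sum>k<count_levels c q (m t \<omega>). level_gap (lev k) t \<omega>"
  shows "integrable M g" and "expectation g = 0"
proof -
  note L = level_gap_expectation[OF t lev_le]
  have [measurable]: "level_gap (lev k) t \<in> borel_measurable M" for k using L(1) by auto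
  note [measurable] = m_meas[OF t] osc_meas[OF order_refl t]
  let ?G = "\<lambda>\<omega>. (\<mu> * t / q + \<sigma> / q * osc 0 t \<omega> + 1) * (2 * \<sigma> * osc 0 t \<omega>)"
  have Gi: "integrable M ?G"
    using integrable_osc[OF order_refl t] by (simp add: algebra_simps power2_eq_square[symmetric])
  have zero: "level_gap (lev k) t \<omega> = 0" if "\<omega> \<in> space M" "\<not> k < count_levels c q (m t \<omega>)" for k \<omega>
    using level_gap_cases[OF that(1) t lev_le[of k]] that(2) by (auto simp: less_count_levels_iff[OF q])
  have lim: "(\<lambda>n. \<Sum>k<n. level_gap (lev k) t \<omega>) \<longlonglongrightarrow> g \<omega>" if "\<omega> \<in> space M" for \<omega>
  proof (rule tendsto_eventually)
    show "eventually (\<lambda>n. (\<Sum>k<n. level_gap (lev k) t \<omega>) = g \<omega>) sequentially"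
      using eventually_ge_at_top[of "count_levels c q (m t \<omega>)"]
      unfolding g_def by eventually_elim (use zero[OF that] in \<open>auto intro!: sum.mono_neutral_right\<close>)
  qed
  have bd: "norm (\<Sum>k<n. level_gap (lev k) t \<omega>) \<le> ?G \<omega>" if \<omega>: "\<omega> \<in> space M" for n \<omega>
  proof -
    let ?K = "count_levels c q (m t \<omega>)"
    have o: "0 \<le> osc 0 t \<omega>" by (rule osc_nonneg[OF \<omega> order_refl t])
    have "norm (\<Sum>k<n. level_gap (lev k) t \<omega>) \<le> (\<Sum>k<n. \<bar>level_gap (lev k) t \<omega>\<bar>)"
      by (simp add: sum_abs)
    also have "\<dots> \<le> (\<Sum>k<n. if k < ?K then 2 * \<sigma> * osc 0 t \<omega> else 0)"
      by (intro sum_mono order_trans[OF level_gap_bound[OF \<omega> t lev_le]]) (simp add: less_count_levels_iff[OF q])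
    also have "\<dots> \<le> (\<Sum>k<?K. 2 * \<sigma> * osc 0 t \<omega>)"
    proof -
      have "(\<Sum>k<n. if k < ?K then 2 * \<sigma> * osc 0 t \<omega> else 0) = (\<Sum>k\<in>{..<n} \<inter> {..<?K}. 2 * \<sigma> * osc 0 t \<omega>)"
        by (intro sum.mono_neutral_cong_right) auto
      also have "\<dots> \<le> (\<Sum>k<?K. 2 * \<sigma> * osc 0 t \<omega>)"
        using \<sigma> o by (intro sum_mono2) auto
      finally show ?thesis .
    qed
    also have "\<dots> = N t \<omega> * (2 * \<sigma> * osc 0 t \<omega>)" by (simp add: N_def)
    also have "\<dots> \<le> ?G \<omega>"
    proof (rule mult_right_mono)
      have "N t \<omega> = q * N t \<omega> / q" using q by simp
      also have "\<dots> \<le> (\<mu> * t + \<sigma> * osc 0 t \<omega> + q) / q"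
        using N_bound[OF \<omega> t] q by (intro divide_right_mono) auto
      also have "\<dots> = \<mu> * t / q + \<sigma> / q * osc 0 t \<omega> + 1" using q by (simp add: field_simps)
      finally show "N t \<omega> \<le> \<mu> * t / q + \<sigma> / q * osc 0 t \<omega> + 1" .
    qed (use o \<sigma> in auto)
    finally show ?thesis .
  qed
  have [measurable]: "g \<in> borel_measurable M"
    by (rule borel_measurable_LIMSEQ_real[OF lim]) auto
  have l: "AE \<omega> in M. (\<lambda>n. \<Sum>k<n. level_gap (lev k) t \<omega>) \<longlonglongrightarrow> g \<omega>"
    by (intro AE_I2 lim)
  have b: "AE \<omega> in M. norm (\<Sum>k<n. level_gap (lev k) t \<omega>) \<le> ?G \<omega>" for n
    by (intro AE_I2 bd)
  show "integrable M g" by (rule integrable_dominated_convergence[OF _ _ Gi l b]) measurable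
  have "(\<lambda>n. expectation (\<lambda>\<omega>. \<Sum>k<n. level_gap (lev k) t \<omega>)) \<longlonglongrightarrow> expectation g"
    by (rule integral_dominated_convergence[OF _ _ Gi l b]) measurable
  then show "expectation g = 0" using L by (simp add: LIMSEQ_const_iff)
qed

lemma set_integrable_B: "\<omega> \<in> space M \<Longrightarrow> set_integrable lborel {0..t} (\<lambda>s. B s \<omega>)"
  by (intro borel_integrable_atLeastAtMost' continuous_on_subset[OF B_cont]) auto

lemma integral_V:
  assumes \<omega>: "\<omega> \<in> space M" and t: "0 \<le> t"
  shows "set_integrable lborel {0..t} (\<lambda>s. V s \<omega>)"
    and "(LINT s:{0..t}|lborel. V s \<omega>) = (LINT s:{0..t}|lborel. B s \<omega>) + q * (LINT s:{0..t}|lborel. N s \<omega>)"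
proof -
  have i: "set_integrable lborel {0..t} (\<lambda>s. q * N s \<omega>)"
    using integral_N(1)[OF assms] by simp
  show "set_integrable lborel {0..t} (\<lambda>s. V s \<omega>)"
    unfolding V_def by (rule set_integral_add(1)[OF set_integrable_B[OF \<omega>] i])
  show "(LINT s:{0..t}|lborel. V s \<omega>) = (LINT s:{0..t}|lborel. B s \<omega>) + q * (LINT s:{0..t}|lborel. N s \<omega>)"
    unfolding V_def using set_integral_add(2)[OF set_integrable_B[OF \<omega>] i] by simp
qed

text \<open>Solving the pathwise identity for the integral of N and adding the integral of B leaves
  the moments of V and known means of B. The terms of order t^2 cancel between E[B_t^2] and the mean
  integral of B, so the result can be divided by t.\<close>

lemma expectation_integral_V:
  assumes t: "0 \<le> t"
  shows "integrable M (\<lambda>\<omega>. LINT s:{0..t}|lborel. V s \<omega>)"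
    and "\<mu> * IV t =
      x0\<^sup>2 / 2 + \<sigma>\<^sup>2 * t / 2 + (c + q / 2) * (expectation (V t) - x0 + \<mu> * t) - V2 t / 2"
proof -
  let ?g = "\<lambda>\<omega>. \<Sum>k<count_levels c q (m t \<omega>). level_gap (lev k) t \<omega>"
  let ?R = "\<lambda>\<omega>. q / \<mu> * ?g \<omega> - ((V t \<omega>)\<^sup>2 - (B t \<omega>)\<^sup>2) / (2 * \<mu>) + (c + q / 2) / \<mu> * (V t \<omega> - B t \<omega>)
      + (LINT s:{0..t}|lborel. B s \<omega>)"
  note i = expectation_sum_level_gap[OF t] V_integrable[OF t] expectation_B[OF t] expectation_integral_B[OF t]
  have eq: "(LINT s:{0..t}|lborel. V s \<omega>) = ?R \<omega>" if "\<omega> \<in> space M" for \<omega>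
  proof -
    let ?qI = "q * (LINT s:{0..t}|lborel. N s \<omega>)"
    have "\<mu> * ?qI = q * ?g \<omega> - ((V t \<omega>)\<^sup>2 - (B t \<omega>)\<^sup>2) / 2 + (c + q / 2) * (V t \<omega> - B t \<omega>)"
      using quadratic_identity[OF that t] by (simp only: mult.assoc)
    moreover have "?qI = \<mu> * ?qI / \<mu>" using \<mu> by simp
    ultimately have "?qI = (q * ?g \<omega> - ((V t \<omega>)\<^sup>2 - (B t \<omega>)\<^sup>2) / 2 + (c + q / 2) * (V t \<omega> - B t \<omega>)) / \<mu>"
      by (simp only:)
    moreover have "(q * g - d / 2 + k * v) / \<mu> = q / \<mu> * g - d / (2 * \<mu>) + k / \<mu> * v" for g d k v :: real
      using \<mu> by (simp add: field_simps)
    ultimately show ?thesis unfolding integral_V(2)[OF that t] by (simp only: add.commute)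
  qed
  have Ri: "integrable M ?R" using i by simp
  then show "integrable M (\<lambda>\<omega>. LINT s:{0..t}|lborel. V s \<omega>)"
    by (subst Bochner_Integration.integrable_cong[OF refl eq])
  have "IV t = expectation ?R"
    by (rule Bochner_Integration.integral_cong[OF refl eq])
  also have "\<dots> = ((x0 - \<mu> * t)\<^sup>2 + \<sigma>\<^sup>2 * t - V2 t) / (2 * \<mu>)
      + (c + q / 2) / \<mu> * (expectation (V t) - (x0 - \<mu> * t)) + (x0 * t - \<mu> * t\<^sup>2 / 2)"
    using i by (simp add: minus_divide_left)
  finally have E: "IV t = \<dots>" .
  have "\<mu> * (((x0 - \<mu> * t)\<^sup>2 + \<sigma>\<^sup>2 * t - w) / (2 * \<mu>) + k / \<mu> * (v - (x0 - \<mu> * t)) + (x0 * t - \<mu> * t\<^sup>2 / 2))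
    = x0\<^sup>2 / 2 + \<sigma>\<^sup>2 * t / 2 + k * (v - x0 + \<mu> * t) - w / 2" for w k v :: real
    using \<mu> by (simp add: field_simps power2_eq_square)
  then show "\<mu> * IV t =
      x0\<^sup>2 / 2 + \<sigma>\<^sup>2 * t / 2 + (c + q / 2) * (expectation (V t) - x0 + \<mu> * t) - V2 t / 2"
    unfolding E .
qed

lemma tendsto_const_over_t: "((\<lambda>t::real. K / t) \<longlongrightarrow> 0) at_top"
  by (intro tendsto_divide_0[OF tendsto_const] filterlim_at_top_imp_at_infinity filterlim_ident)

lemma V_square_sublinear: "((\<lambda>t. V2 t / t) \<longlongrightarrow> 0) at_top"
proof (rule tendsto_sandwich[OF _ _ tendsto_const])
  let ?K = "2 * (\<bar>c\<bar> + q + \<bar>x0\<bar>)\<^sup>2"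
  show "eventually (\<lambda>t. 0 \<le> V2 t / t) at_top"
    using eventually_ge_at_top[of 0] by eventually_elim (auto intro!: divide_nonneg_nonneg)
  show "eventually (\<lambda>t. V2 t / t \<le> 2 * (drawup2 t / t) + ?K / t) at_top"
    using eventually_gt_at_top[of 0]
  proof eventually_elim
    case (elim t)
    then have t: "0 \<le> t" by simp
    have i: "integrable M (\<lambda>\<omega>. (B t \<omega> - m t \<omega>)\<^sup>2)" using expectation_distance_to_minimum(1)[of t t] elim by simp
    have "V2 t \<le> expectation (\<lambda>\<omega>. 2 * (B t \<omega> - m t \<omega>)\<^sup>2 + ?K)"
      using i by (intro integral_mono V_integrable t V_square_bound) auto
    also have "\<dots> = 2 * drawup2 t + ?K" using i by (simp add: prob_space)
    finally show ?case using elim by (simp add: field_simps)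
  qed
  show "((\<lambda>t. 2 * (drawup2 t / t) + ?K / t) \<longlongrightarrow> 0) at_top"
    using tendsto_add[OF tendsto_mult_right_zero[OF distance_to_minimum_sublinear] tendsto_const_over_t] by simp
qed

lemma V_sublinear: "((\<lambda>t. expectation (V t) / t) \<longlongrightarrow> 0) at_top"
proof (rule Lim_null_comparison)
  show "eventually (\<lambda>t. norm (expectation (V t) / t) \<le> 1 / t + V2 t / t) at_top"
    using eventually_gt_at_top[of 0]
  proof eventually_elim
    case (elim t)
    then have t: "0 \<le> t" by simp
    have "\<bar>expectation (V t)\<bar> \<le> expectation (\<lambda>\<omega>. \<bar>V t \<omega>\<bar>)" by (rule integral_abs_bound)
    also have "\<dots> \<le> expectation (\<lambda>\<omega>. 1 + (V t \<omega>)\<^sup>2)"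
      using V_integrable[OF t] by (intro integral_mono abs_le_one_plus_square) auto
    also have "\<dots> = 1 + V2 t" using V_integrable[OF t] by (simp add: prob_space)
    finally show ?case using elim by (simp add: field_simps)
  qed
  show "((\<lambda>t. 1 / t + V2 t / t) \<longlongrightarrow> 0) at_top"
    using tendsto_add[OF tendsto_const_over_t[of 1] V_square_sublinear] by simp
qed

text \<open>Since E V_t is o(t), the refills have to compensate the drift: q E N_t equals \<mu> t up
  to o(t).\<close>

lemma average_N: "((\<lambda>t. expectation (N t) / t) \<longlongrightarrow> \<mu> / q) at_top"
proof -
  have "((\<lambda>t. (expectation (V t) / t - x0 / t + \<mu>) / q) \<longlongrightarrow> (0 - 0 + \<mu>) / q) at_top"
    using q by (intro tendsto_intros V_sublinear tendsto_const_over_t) auto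
  then have "((\<lambda>t. (expectation (V t) / t - x0 / t + \<mu>) / q) \<longlongrightarrow> \<mu> / q) at_top" by simp
  then show ?thesis
  proof (rule Lim_transform_eventually)
    show "eventually (\<lambda>t. (expectation (V t) / t - x0 / t + \<mu>) / q = expectation (N t) / t) at_top"
      using eventually_gt_at_top[of 0]
    proof eventually_elim
      case (elim t)
      then show ?case using expectation_V[of t] q by (simp add: field_simps)
    qed
  qed
qed

lemma average_V:
  "((\<lambda>t. IV t / t) \<longlongrightarrow> \<sigma>\<^sup>2 / (2 * \<mu>) + c + q / 2) at_top"
proof -
  let ?f = "\<lambda>t. (x0\<^sup>2 / 2 / t + \<sigma>\<^sup>2 / 2 + (c + q / 2) * (expectation (V t) / t - x0 / t + \<mu>)
    - V2 t / t / 2) / \<mu>"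
  have "(?f \<longlongrightarrow> (0 + \<sigma>\<^sup>2 / 2 + (c + q / 2) * (0 - 0 + \<mu>) - 0 / 2) / \<mu>) at_top"
    using \<mu> by (intro tendsto_intros V_sublinear V_square_sublinear tendsto_const_over_t) auto
  also have "(0 + \<sigma>\<^sup>2 / 2 + (c + q / 2) * (0 - 0 + \<mu>) - 0 / 2) / \<mu> = \<sigma>\<^sup>2 / (2 * \<mu>) + c + q / 2"
    using \<mu> by (simp add: field_simps)
  finally show ?thesis
  proof (rule Lim_transform_eventually)
    show "eventually (\<lambda>t. ?f t = IV t / t) at_top"
      using eventually_gt_at_top[of 0]
    proof eventually_elim
      case (elim t)
      have "IV t =
        (x0\<^sup>2 / 2 + \<sigma>\<^sup>2 * t / 2 + (c + q / 2) * (expectation (V t) - x0 + \<mu> * t) - V2 t / 2) / \<mu>"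
        using expectation_integral_V(2)[of t] elim \<mu> by (simp add: eq_divide_eq mult.commute)
      moreover have "(x / t + s / 2 + k * (v / t - x0 / t + \<mu>) - w / t / 2) / \<mu>
        = (x + s * t / 2 + k * (v - x0 + \<mu> * t) - w / 2) / \<mu> / t" for x s k v w :: real
        using elim \<mu> by (simp add: field_simps)
      ultimately show ?case by (simp only:)
    qed
  qed
qed

end

section \<open>Costs along a path\<close>

lemma holding_cost_integral:
  fixes X Z :: "real \<Rightarrow> real"
  assumes h: "0 \<le> c_h" and eq: "\<And>s. 0 < s \<Longrightarrow> s \<le> t \<Longrightarrow> Z s = X s"
    and nn: "\<And>s. 0 \<le> s \<Longrightarrow> s \<le> t \<Longrightarrow> 0 \<le> X s" and int: "set_integrable lborel {0..t} X"
  shows "(\<integral>\<^sup>+ s\<in>{0..t}. ennreal (holding_cost c_h (Z s)) \<partial>lborel) = ennreal (c_h * (LINT s:{0..t}|lborel. X s))"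
    and "0 \<le> c_h * (LINT s:{0..t}|lborel. X s)"
proof -
  have nn': "0 \<le> indicator {0..t} s * (c_h * X s)" for s
    using nn[of s] h by (simp add: indicator_def)
  have i: "integrable lborel (\<lambda>s. indicator {0..t} s * (c_h * X s))"
    using integrable_mult_right[OF int[unfolded set_integrable_def], of c_h] by (simp add: mult.left_commute)
  have lint: "(\<integral>s. indicator {0..t} s * (c_h * X s) \<partial>lborel) = c_h * (LINT s:{0..t}|lborel. X s)"
    by (simp add: set_lebesgue_integral_def mult.left_commute)
  have "(\<integral>\<^sup>+ s\<in>{0..t}. ennreal (holding_cost c_h (Z s)) \<partial>lborel)
     = (\<integral>\<^sup>+ s. ennreal (indicator {0..t} s * (c_h * X s)) \<partial>lborel)"
  proof (rule nn_integral_cong_AE)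
    show "AE s in lborel. ennreal (holding_cost c_h (Z s)) * indicator {0..t} s
      = ennreal (indicator {0..t} s * (c_h * X s))"
      \<comment> \<open>The inventory is identified at positive times; the single time 0 is a null
        set for the integral.\<close>
      using AE_lborel_singleton[of 0]
    proof eventually_elim
      case (elim s)
      have "Z s = X s" if "s \<in> {0..t}" using elim that by (intro eq) auto
      then show ?case by (auto simp: holding_cost_def indicator_def)
    qed
  qed
  also have "\<dots> = ennreal (\<integral>s. indicator {0..t} s * (c_h * X s) \<partial>lborel)"
    by (rule nn_integral_eq_integral[OF i]) (use nn' in auto)
  finally show "(\<integral>\<^sup>+ s\<in>{0..t}. ennreal (holding_cost c_h (Z s)) \<partial>lborel) = ennreal (c_h * (LINT s:{0..t}|lborel. X s))"
    unfolding lint .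
  show "0 \<le> c_h * (LINT s:{0..t}|lborel. X s)"
    unfolding lint[symmetric] by (rule Bochner_Integration.integral_nonneg[OF nn'])
qed

context yz_path
begin

text \<open>For \<open>b 0 = y\<close> the first order is placed at once only if the path goes below \<open>y\<close> immediately.\<close>

lemma \<tau>_le_iff:
  assumes start: "first_passage b (b 0) = 0" and t: "0 < t"
  shows "\<tau> k \<le> ennreal t \<longleftrightarrow> k < count_levels (min (b 0) y) (z - y) (running_min b t)"
proof -
  have t0: "0 \<le> t" using t by simp
  have "\<tau> k \<le> ennreal t \<longleftrightarrow> running_min b t \<le> min (b 0) y - real k * (z - y)"
  proof (cases "k = 0 \<and> b 0 \<le> y")
    case True
    then have "\<tau> k \<le> first_passage b (b 0)"
      unfolding \<tau>_def by (intro first_passage_antimono) (simp add: level_0)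
    then have "\<tau> k \<le> ennreal t" using start by simp
    moreover have "running_min b t \<le> b 0" by (intro running_min_lower t0) auto
    ultimately show ?thesis using True by simp
  next
    case False
    then have lev: "level k = min (b 0) y - real k * (z - y)" "level k < b 0"
      using level_Suc_less by (cases k; simp add: level_0 level_Suc; fail)+
    have "\<tau> k \<le> ennreal t \<longleftrightarrow> (\<exists>s. 0 < s \<and> s \<le> t \<and> b s \<le> level k)"
      unfolding \<tau>_def by (rule first_passage_le_iff[OF t])
    \<comment> \<open>Time 0 may be added, because the path starts strictly above this
      level.\<close>
    also have "\<dots> \<longleftrightarrow> (\<exists>s. 0 \<le> s \<and> s \<le> t \<and> b s \<le> level k)"
      using lev(2) by (metis less_eq_real_def not_less)
    finally show ?thesis unfolding running_min_le_iff[OF t0] lev(1) .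
  qed
  then show ?thesis using yz by (simp add: less_count_levels_iff)
qed

text \<open>The exceptional first size contributes the surplus \<open>y - min (b 0) y\<close> once.
  With no order placed the surplus has to vanish, and it does, since then b 0 > y.\<close>

lemma sum_size_count:
  assumes t: "0 \<le> t"
  defines "K \<equiv> count_levels (min (b 0) y) (z - y) (running_min b t)"
  shows "(\<Sum>k<K. size k) = y - min (b 0) y + (z - y) * real K"
proof (cases K)
  case 0
  then have "\<not> running_min b t \<le> min (b 0) y"
    using less_count_levels_iff[of "z - y" 0 "min (b 0) y" "running_min b t"] yz by (simp add: K_def)
  moreover have "running_min b t \<le> b 0" by (intro running_min_lower t) auto
  ultimately show ?thesis using 0 by simp
next
  case (Suc n)
  have "(\<Sum>k<K. size k) = y - level K" by (simp add: level_def)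
  then show ?thesis unfolding Suc level_Suc by (simp add: algebra_simps)
qed

lemma inventory_yz_eq:
  assumes start: "first_passage b (b 0) = 0" and t: "0 < t"
  shows "inventory b (yz_orders b y z) t = b t +
    (z - y) * real (count_levels (min (b 0) y) (z - y) (running_min b t)) + (y - min (b 0) y)"
proof -
  let ?K = "count_levels (min (b 0) y) (z - y) (running_min b t)"
  have "total_jumps t = jumps ?K t"
    by (rule order_jumps_yz) (simp add: \<tau>_le_iff[OF assms] not_le[symmetric])
  also have "\<dots> = (\<Sum>k<?K. size k)"
    unfolding jumps_def by (rule sum.cong) (simp_all add: \<tau>_le_iff[OF assms])
  finally show ?thesis using sum_size_count[of t] t by (simp add: inventory_yz)
qed

lemma cost_yz:
  assumes start: "first_passage b (b 0) = 0" and t: "0 < t" and k: "0 \<le> k1" "0 \<le> k2" "0 \<le> c_h"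
  defines "X \<equiv> \<lambda>s. b s + (z - y) * real (count_levels (min (b 0) y) (z - y) (running_min b s)) + (y - min (b 0) y)"
    and "K \<equiv> count_levels (min (b 0) y) (z - y) (running_min b t)"
  assumes int: "set_integrable lborel {0..t} X"
  shows "cost_up_to (holding_cost c_h) (order_cost k1 k2) k5 b (yz_orders b y z) t =
    ennreal (c_h * (LINT s:{0..t}|lborel. X s) + (k1 * real K + k2 * (y - min (b 0) y + (z - y) * real K)))"
    and "0 \<le> c_h * (LINT s:{0..t}|lborel. X s) + (k1 * real K + k2 * (y - min (b 0) y + (z - y) * real K))"
proof -
  have X_nn: "0 \<le> X s" if "0 \<le> s" "s \<le> t" for s
  proof -
    have "running_min b s \<le> b s" using running_min_lower[of s s] that by simp
    then show ?thesis
      using count_levels_bounds(1)[of "z - y" "min (b 0) y" "running_min b s"] yz y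
      unfolding X_def by linarith
  qed
  have inv: "inventory b (yz_orders b y z) s = X s" if "0 < s" "s \<le> t" for s
    unfolding X_def by (rule inventory_yz_eq[OF start that(1)])
  note hold = holding_cost_integral[OF k(3) inv X_nn int]
  let ?c = "\<lambda>k. ennreal (order_cost k1 k2 (inventory_left b (yz_orders b y z) (enn2real (\<tau> k)))
      (inventory b (yz_orders b y z) (enn2real (\<tau> k))))"
  have c: "?c k = ennreal (k1 + k2 * size k)" if le: "\<tau> k \<le> ennreal t" for k
  proof -
    obtain s where s: "\<tau> k = ennreal s" "0 \<le> s" using le by (cases "\<tau> k") (auto simp: top_unique)
    show ?thesis using inventory_at_order[OF s] s by (simp add: order_cost_def)
  qed
  have "(\<Sum>k. if \<tau> k \<le> ennreal t then ?c k else 0) = (\<Sum>k<K. if \<tau> k \<le> ennreal t then ?c k else 0)"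
    unfolding K_def by (intro suminf_finite) (auto simp: \<tau>_le_iff[OF start t])
  also have "\<dots> = (\<Sum>k<K. ennreal (k1 + k2 * size k))"
    by (intro sum.cong) (auto simp: c \<tau>_le_iff[OF start t, symmetric] K_def)
  also have "\<dots> = ennreal (\<Sum>k<K. k1 + k2 * size k)"
    by (intro sum_ennreal add_nonneg_nonneg mult_nonneg_nonneg less_imp_le[OF size_pos] k)
  also have "(\<Sum>k<K. k1 + k2 * size k) = k1 * real K + k2 * (\<Sum>k<K. size k)"
    by (simp add: sum.distrib sum_distrib_left)
  also have "(\<Sum>k<K. size k) = y - min (b 0) y + (z - y) * real K"
    unfolding K_def using t by (intro sum_size_count) simp
  finally have ord: "(\<Sum>k. if \<tau> k \<le> ennreal t then ?c k else 0) =
    ennreal (k1 * real K + k2 * (y - min (b 0) y + (z - y) * real K))" .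
  have nn: "0 \<le> c_h * (LINT s:{0..t}|lborel. X s)" "0 \<le> k1 * real K + k2 * (y - min (b 0) y + (z - y) * real K)"
    using hold(2) k yz by simp_all
  then show "cost_up_to (holding_cost c_h) (order_cost k1 k2) k5 b (yz_orders b y z) t =
    ennreal (c_h * (LINT s:{0..t}|lborel. X s) + (k1 * real K + k2 * (y - min (b 0) y + (z - y) * real K)))"
    unfolding cost_up_to_def fst_yz_orders ord local_time_yz
    by (simp add: hold(1) ennreal_plus[symmetric] del: ennreal_plus)
  show "0 \<le> c_h * (LINT s:{0..t}|lborel. X s) + (k1 * real K + k2 * (y - min (b 0) y + (z - y) * real K))"
    using nn by (rule add_nonneg_nonneg)
qed

end

context continuous_path
begin

lemma order_jumps_no_orders: "order_jumps no_orders t = 0"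
  by (simp add: order_jumps_def no_orders_def top_unique)

lemma local_time_no_orders:
  assumes b0: "0 \<le> b 0"
    and t: "0 \<le> t"
  shows "local_time b no_orders t = max 0 (- running_min b t)"
proof -
  interpret r: reflected_path b "\<lambda>_. 0" "\<lambda>t. b t + 0"
    by unfold_locales (use cont b0 in auto)
  have "local_time b no_orders t = skorokhod_term (\<lambda>t. b t + 0) t"
    unfolding local_time_def order_jumps_no_orders r.reflection_term_eq ..
  also have "\<dots> = max 0 (- running_min b t)"
  proof (rule antisym)
    show "skorokhod_term (\<lambda>t. b t + 0) t \<le> max 0 (- running_min b t)"
      using running_min_lower[of _ t] t by (intro r.skorokhod_le) (auto simp: le_max_iff_disj)
    obtain s where "0 \<le> s" "s \<le> t" "b s = running_min b t" using running_min_attained[OF t] .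
    then show "max 0 (- running_min b t) \<le> skorokhod_term (\<lambda>t. b t + 0) t"
      using r.skorokhod_upper[of s t] by simp
  qed
  finally show ?thesis .
qed

lemma cost_no_orders:
  assumes b0: "0 \<le> b 0" and t: "0 \<le> t" and k: "0 \<le> c_h" "0 \<le> k5"
  shows "cost_up_to (holding_cost c_h) c1 k5 b no_orders t =
    ennreal (c_h * (LINT s:{0..t}|lborel. b s + max 0 (- running_min b s)) + k5 * max 0 (- running_min b t))"
    and "0 \<le> c_h * (LINT s:{0..t}|lborel. b s + max 0 (- running_min b s)) + k5 * max 0 (- running_min b t)"
proof -
  let ?X = "\<lambda>s. b s + max 0 (- running_min b s)"
  have X_nn: "0 \<le> ?X s" if "0 \<le> s" "s \<le> t" for s
    using running_min_lower[of s s] that by simp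
  have int: "set_integrable lborel {0..t} ?X"
    by (intro borel_integrable_atLeastAtMost' continuous_intros continuous_on_subset[OF cont]
        continuous_on_subset[OF continuous_running_min]) auto
  have inv: "inventory b no_orders s = ?X s" if "0 < s" "s \<le> t" for s
    using that by (simp add: inventory_def order_jumps_no_orders local_time_no_orders[OF b0])
  note hold = holding_cost_integral[OF k(1) inv X_nn int]
  have ord: "(\<Sum>k. if fst no_orders (Suc k) \<le> ennreal t
           then ennreal (c1 (inventory_left b no_orders (enn2real (fst no_orders (Suc k))))
                            (inventory b no_orders (enn2real (fst no_orders (Suc k)))))
           else 0) = 0"
    by (simp add: no_orders_def top_unique)
  have nn: "0 \<le> c_h * (LINT s:{0..t}|lborel. ?X s)" "0 \<le> k5 * max 0 (- running_min b t)"
    using hold(2) k by simp_all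
  then show "cost_up_to (holding_cost c_h) c1 k5 b no_orders t =
    ennreal (c_h * (LINT s:{0..t}|lborel. ?X s) + k5 * max 0 (- running_min b t))"
    unfolding cost_up_to_def ord local_time_no_orders[OF b0 t]
    by (simp add: hold(1) ennreal_plus[symmetric] del: ennreal_plus)
  show "0 \<le> c_h * (LINT s:{0..t}|lborel. ?X s) + k5 * max 0 (- running_min b t)"
    using nn by (rule add_nonneg_nonneg)
qed

end

text \<open>Moves the computation from [0, \<infinity>] to real expectations. Almost sure agreement
  is the right requirement because an immediate passage of x0 is known only almost surely.\<close>

lemma (in prob_space) long_term_average_cost_eqI:
  assumes cost: "\<And>t. 0 < t \<Longrightarrow> AE \<omega> in M. cost_up_to c0 c1 k5 (\<lambda>s. B s \<omega>) (P \<omega>) t = ennreal (R t \<omega>) \<and> 0 \<le> R t \<omega>"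
    and int: "\<And>t. 0 < t \<Longrightarrow> integrable M (R t)"
    and lim: "((\<lambda>t. expectation (R t) / t) \<longlongrightarrow> L) at_top"
  shows "long_term_average_cost M B c0 c1 k5 P = ennreal L"
  unfolding long_term_average_cost_def
proof (rule lim_imp_Limsup)
  let ?E = "\<lambda>t. \<integral>\<^sup>+ \<omega>. cost_up_to c0 c1 k5 (\<lambda>s. B s \<omega>) (P \<omega>) t \<partial>M"
  show "((\<lambda>t. ?E t / ennreal t) \<longlongrightarrow> ennreal L) at_top"
  proof (rule Lim_transform_eventually[OF tendsto_ennrealI[OF lim]])
    show "eventually (\<lambda>t. ennreal (expectation (R t) / t) = ?E t / ennreal t) at_top"
      using eventually_gt_at_top[of 0]
    proof eventually_elim
      case (elim t)
      have nn: "AE \<omega> in M. 0 \<le> R t \<omega>" using cost[OF elim] by eventually_elim simp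
      have "?E t = (\<integral>\<^sup>+ \<omega>. ennreal (R t \<omega>) \<partial>M)"
        using cost[OF elim] by (intro nn_integral_cong_AE) auto
      also have "\<dots> = ennreal (expectation (R t))" by (rule nn_integral_eq_integral[OF int[OF elim] nn])
      finally show ?case using elim integral_nonneg_AE[OF nn] by (simp add: divide_ennreal)
    qed
  qed
qed simp

section \<open>Admissibility of the \<open>(y,z)\<close> policies\<close>

context drifted_brownian_motion
begin

abbreviation F :: "ennreal \<Rightarrow> 'a measure" where "F \<equiv> augmented_filtration M B"

lemma generator_subset:
  "{B s -` A \<inter> space M | s A. 0 \<le> s \<and> ennreal s \<le> t \<and> A \<in> sets borel} \<union> null_sets M \<subseteq> sets M"
  using B_meas by (auto intro: measurable_sets)

lemma space_F: "space (F t) = space M"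
  unfolding augmented_filtration_def using generator_subset[of t] sets.space_closed[of M]
  by (intro space_measure_of) blast

lemma sets_F: "sets (F t) = sigma_sets (space M)
    ({B s -` A \<inter> space M | s A. 0 \<le> s \<and> ennreal s \<le> t \<and> A \<in> sets borel} \<union> null_sets M)"
  unfolding augmented_filtration_def using generator_subset[of t] sets.space_closed[of M]
  by (intro sets_measure_of) blast

lemma sets_F_subset: "sets (F t) \<subseteq> sets M"
  unfolding sets_F by (intro sets.sigma_sets_subset generator_subset)

lemma null_sets_in_F: "A \<in> null_sets M \<Longrightarrow> A \<in> sets (F t)"
  unfolding sets_F by (intro sigma_sets.Basic) auto

sublocale filtration "space M" F
proof
  show "space (F t) = space M" for t by (rule space_F)
  show "sets (F s) \<subseteq> sets (F t)" if "s \<le> t" for s t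
    unfolding sets_F using that by (intro sigma_sets_mono') (auto intro: order_trans)
qed

lemma B_adapted: "0 \<le> s \<Longrightarrow> ennreal s \<le> t \<Longrightarrow> B s \<in> borel_measurable (F t)"
  by (rule measurableI) (auto simp: space_F sets_F intro!: sigma_sets.Basic)

text \<open>Passage by time r means that for some n the infimum over [r / (n + 1), r] is at most a.
  These intervals avoid time 0, as the definition demands, and are compact, so each infimum is
  attained and is a limit of minima over grid times up to r.\<close>

lemma first_passage_adapted:
  assumes r: "0 < r"
  shows "Measurable.pred (F (ennreal r)) (\<lambda>\<omega>. first_passage (\<lambda>t. B t \<omega>) a \<le> ennreal r)"
proof -
  define I where "I n \<omega> = (INF s\<in>{r / real (Suc n)..r}. B s \<omega>)" for n \<omega>
  have rn: "0 < r / real (Suc n)" "r / real (Suc n) \<le> r" for n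
    using r mult_left_mono[of 1 "real (Suc n)" r] by (auto simp: divide_le_eq simp del: of_nat_Suc)
  have lim: "(\<lambda>k. MIN i\<in>{..Suc k}. B (grid (r / real (Suc n)) r k i) \<omega>) \<longlonglongrightarrow> I n \<omega>" if "\<omega> \<in> space M" for n \<omega>
    unfolding I_def using rn[of n]
    by (intro grid_Min_tendsto continuous_on_subset[OF B_cont[OF that]]) auto
  have [measurable]: "I n \<in> borel_measurable (F (ennreal r))" for n
  proof (rule borel_measurable_LIMSEQ_real)
    fix \<omega> assume "\<omega> \<in> space (F (ennreal r))"
    then show "(\<lambda>k. MIN i\<in>{..Suc k}. B (grid (r / real (Suc n)) r k i) \<omega>) \<longlonglongrightarrow> I n \<omega>"
      by (intro lim) (simp add: space_F)
  next
    fix k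
    show "(\<lambda>\<omega>. MIN i\<in>{..Suc k}. B (grid (r / real (Suc n)) r k i) \<omega>) \<in> borel_measurable (F (ennreal r))"
    proof (rule borel_measurable_Min)
      fix i assume "i \<in> {..Suc k}"
      then have "r / real (Suc n) \<le> grid (r / real (Suc n)) r k i" "grid (r / real (Suc n)) r k i \<le> r"
        using grid_bounds[OF rn(2)[of n], of i k] by auto
      then show "(\<lambda>\<omega>. B (grid (r / real (Suc n)) r k i) \<omega>) \<in> borel_measurable (F (ennreal r))"
        using rn(1)[of n] by (intro B_adapted ennreal_leI) auto
    qed simp
  qed
  have iff: "first_passage (\<lambda>t. B t \<omega>) a \<le> ennreal r \<longleftrightarrow> (\<exists>n. I n \<omega> \<le> a)" if \<omega>: "\<omega> \<in> space (F (ennreal r))" for \<omega>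
  proof -
    have \<omega>': "\<omega> \<in> space M" using \<omega> by (simp add: space_F)
    interpret p: continuous_path "\<lambda>t. B t \<omega>" by (rule path[OF \<omega>'])
    have c: "continuous_on {r / real (Suc n)..r} (\<lambda>s. B s \<omega>)" for n
      using rn(1)[of n] by (intro continuous_on_subset[OF B_cont[OF \<omega>']]) auto
    show ?thesis
      unfolding p.first_passage_le_iff[OF r]
    proof
      assume "\<exists>s. 0 < s \<and> s \<le> r \<and> B s \<omega> \<le> a"
      then obtain s where s: "0 < s" "s \<le> r" "B s \<omega> \<le> a" by auto
      obtain n where n: "inverse (real (Suc n)) < s / r" using s r reals_Archimedean[of "s / r"] by auto
      then have "r / real (Suc n) \<le> s" using r by (simp add: field_simps)
      moreover have "bdd_below ((\<lambda>s. B s \<omega>) ` {r / real (Suc n)..r})"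
        by (intro bounded_imp_bdd_below compact_imp_bounded compact_continuous_image c) auto
      ultimately have "I n \<omega> \<le> B s \<omega>" unfolding I_def using s by (intro cINF_lower) auto
      then show "\<exists>n. I n \<omega> \<le> a" using s by (intro exI[of _ n]) simp
    next
      assume "\<exists>n. I n \<omega> \<le> a"
      then obtain n where n: "I n \<omega> \<le> a" ..
      have "compact {r / real (Suc n)..r}" "{r / real (Suc n)..r} \<noteq> {}" using rn(2)[of n] by auto
      then obtain s where s: "s \<in> {r / real (Suc n)..r}" "\<And>u. u \<in> {r / real (Suc n)..r} \<Longrightarrow> B s \<omega> \<le> B u \<omega>"
        using continuous_attains_inf[OF _ _ c] by meson
      have "I n \<omega> = B s \<omega>" unfolding I_def using s by (intro cInf_eq_minimum) auto
      then show "\<exists>s. 0 < s \<and> s \<le> r \<and> B s \<omega> \<le> a"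
        using n s(1) rn(1)[of n] by (intro exI[of _ s]) auto
    qed
  qed
  show ?thesis by (subst measurable_cong[OF iff]) measurable
qed

text \<open>For a different from x0 the event is all or nothing. For a = x0 it depends on the path
  immediately after time 0 but has probability one, so its complement is a null set and belongs to
  the augmented filtration at 0.\<close>

lemma first_passage_at_0_adapted:
  "Measurable.pred (F 0) (\<lambda>\<omega>. first_passage (\<lambda>t. B t \<omega>) a \<le> 0)"
proof -
  let ?T = "\<lambda>\<omega>. first_passage (\<lambda>t. B t \<omega>) a"
  have pth: "?T \<omega> \<le> 0 \<longleftrightarrow> x0 < a" if "a \<noteq> x0" "\<omega> \<in> space M" for \<omega>
    using continuous_path.first_passage_zero[OF path[OF that(2)], of a]
      continuous_path.first_passage_pos[OF path[OF that(2)], of a] that B_0[OF that(2)] by fastforce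
  show ?thesis
  proof (cases "a = x0")
    case False
    show ?thesis
      by (subst measurable_cong[where g="\<lambda>_. x0 < a"]) (simp_all add: pth[OF False, simplified] space_F)
  next
    case True
    \<comment> \<open>\<open>null_sets\<close> contains measurable sets only, so measurability in M
      is established first, from the passage events at the times 1 / (n + 1).\<close>
    have meas: "{\<omega> \<in> space M. ?T \<omega> \<le> 0} \<in> sets M"
    proof -
      have "?T \<omega> \<le> 0 \<longleftrightarrow> (\<forall>n. ?T \<omega> \<le> ennreal (inverse (real (Suc n))))" for \<omega>
      proof
        assume all: "\<forall>n. ?T \<omega> \<le> ennreal (inverse (real (Suc n)))"
        show "?T \<omega> \<le> 0"
        proof (rule ennreal_le_epsilon)
          fix e :: real assume "0 < e"
          then obtain n where "inverse (real (Suc n)) < e" using reals_Archimedean by blast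
          then have "ennreal (inverse (real (Suc n))) \<le> ennreal e" by (intro ennreal_leI) simp
          then show "?T \<omega> \<le> 0 + ennreal e" using all order_trans by fastforce
        qed
      qed simp
      then have "{\<omega> \<in> space M. ?T \<omega> \<le> 0} = {\<omega> \<in> space M. \<forall>n. ?T \<omega> \<le> ennreal (inverse (real (Suc n)))}" by simp
      also have "\<dots> \<in> sets M"
      proof (rule sets.sets_Collect_countable_All)
        fix n
        have "{\<omega> \<in> space (F (ennreal (inverse (real (Suc n))))). ?T \<omega> \<le> ennreal (inverse (real (Suc n)))}
            \<in> sets (F (ennreal (inverse (real (Suc n)))))"
          by (rule predE[OF first_passage_adapted]) simp
        then show "{\<omega> \<in> space M. ?T \<omega> \<le> ennreal (inverse (real (Suc n)))} \<in> sets M"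
          using sets_F_subset by (auto simp: space_F)
      qed
      finally show ?thesis .
    qed
    have "AE \<omega> in M. ?T \<omega> \<le> 0" using AE_first_passage_start unfolding True by eventually_elim simp
    then have "{\<omega> \<in> space M. \<not> ?T \<omega> \<le> 0} \<in> null_sets M"
      using meas by (subst (asm) AE_iff_null) auto
    then have "{\<omega> \<in> space M. \<not> ?T \<omega> \<le> 0} \<in> sets (F 0)" by (rule null_sets_in_F)
    then have "Measurable.pred (F 0) (\<lambda>\<omega>. \<not> ?T \<omega> \<le> 0)" by (simp add: pred_def space_F)
    then have "Measurable.pred (F 0) (\<lambda>\<omega>. \<not> \<not> ?T \<omega> \<le> 0)" by (rule pred_intros_logic)
    then show ?thesis by simp
  qed
qed

lemma stopping_time_first_passage: "stopping_time F (\<lambda>\<omega>. first_passage (\<lambda>t. B t \<omega>) a)"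
proof (rule stopping_timeI)
  fix t
  show "Measurable.pred (F t) (\<lambda>\<omega>. first_passage (\<lambda>t. B t \<omega>) a \<le> t)"
  proof (cases t)
    case (real r)
    then show ?thesis using first_passage_adapted[of r a] first_passage_at_0_adapted[of a] by (cases "r = 0") auto
  qed simp
qed

lemma yz_path: "\<omega> \<in> space M \<Longrightarrow> 0 < x0 \<Longrightarrow> 0 \<le> y \<Longrightarrow> y < z \<Longrightarrow> yz_path (\<lambda>t. B t \<omega>) y z"
  by (intro yz_path.intro path yz_path_axioms.intro) (simp_all add: B_0)

text \<open>As the path starts at the constant x0, every order time is the first passage to a
  deterministic level and every order size is a deterministic number on the event that the order is
  placed. The size is therefore a function of the order time, which gives its measurability at that
  time.\<close>

lemma ordering_policy_yz:
  assumes x0: "0 < x0" and yz: "0 \<le> y" "y < z"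
  shows "ordering_policy M B (yz_policy B y z)"
  unfolding ordering_policy_def
proof (intro allI impI conjI ballI)
  fix k :: nat assume "1 \<le> k"
  then obtain j where k: "k = Suc j" by (cases k) auto
  define a where "a = (if j = 0 then y else min x0 y - real j * (z - y))"
  define d where "d = (if j = 0 then z - min x0 y else z - y)"
  let ?T = "\<lambda>\<omega>. first_passage (\<lambda>t. B t \<omega>) a"
  have T: "fst (yz_policy B y z \<omega>) k = ?T \<omega>" and S: "snd (yz_policy B y z \<omega>) k = (if ?T \<omega> = \<infinity> then 0 else d)"
    if \<omega>: "\<omega> \<in> space M" for \<omega>
  proof -
    interpret p: yz_path "\<lambda>t. B t \<omega>" y z by (rule yz_path[OF \<omega> x0 yz])
    have "p.level j = a" by (cases j) (simp_all add: a_def p.level_0 p.level_Suc B_0[OF \<omega>] del: of_nat_Suc)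
    then have \<tau>: "p.\<tau> j = ?T \<omega>" by (simp add: p.\<tau>_def)
    then show "fst (yz_policy B y z \<omega>) k = ?T \<omega>" by (simp add: yz_policy_def k p.fst_yz_orders)
    show "snd (yz_policy B y z \<omega>) k = (if ?T \<omega> = \<infinity> then 0 else d)"
      by (simp add: yz_policy_def k p.snd_yz_orders \<tau>[symmetric] d_def p.size_def B_0[OF \<omega>])
  qed
  have st: "stopping_time F (\<lambda>\<omega>. fst (yz_policy B y z \<omega>) k)"
    using stopping_time_cong[of F "\<lambda>\<omega>. fst (yz_policy B y z \<omega>) k" ?T] stopping_time_first_passage[of a] T
    by (simp add: space_F)
  then show "stopping_time (augmented_filtration M B) (\<lambda>\<omega>. fst (yz_policy B y z \<omega>) k)" .
  have [measurable]: "(\<lambda>\<omega>. fst (yz_policy B y z \<omega>) k) \<in> borel_measurable (pre_sigma (\<lambda>\<omega>. fst (yz_policy B y z \<omega>) k))"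
    by (rule measurable_stopping_time_pre_sigma[OF st])
  have "(\<lambda>\<omega>. if fst (yz_policy B y z \<omega>) k = \<infinity> then 0 else d) \<in> borel_measurable (pre_sigma (\<lambda>\<omega>. fst (yz_policy B y z \<omega>) k))"
    by measurable
  then show "(\<lambda>\<omega>. snd (yz_policy B y z \<omega>) k) \<in> borel_measurable (pre_sigma (\<lambda>\<omega>. fst (yz_policy B y z \<omega>) k))"
    by (subst measurable_cong[where g="\<lambda>\<omega>. if fst (yz_policy B y z \<omega>) k = \<infinity> then 0 else d"])
       (simp_all add: space_pre_sigma S T)
  fix \<omega> assume \<omega>: "\<omega> \<in> space M"
  interpret p: yz_path "\<lambda>t. B t \<omega>" y z by (rule yz_path[OF \<omega> x0 yz])
  show "0 \<le> snd (yz_policy B y z \<omega>) k"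
    using p.size_pos[of j] by (simp add: yz_policy_def k p.snd_yz_orders)
  show "fst (yz_policy B y z \<omega>) k \<le> fst (yz_policy B y z \<omega>) (Suc k)"
    by (simp add: yz_policy_def k p.fst_yz_orders p.\<tau>_Suc_le)
  show "fst (yz_policy B y z \<omega>) k < fst (yz_policy B y z \<omega>) (Suc k)" if "fst (yz_policy B y z \<omega>) k < \<infinity>"
    using that by (simp add: yz_policy_def k p.fst_yz_orders p.\<tau>_Suc)
qed

end

section \<open>Long-term average costs\<close>

context drifted_brownian_motion
begin

text \<open>The inventory is V + (y - c) and the average of V contains c, so the initial value drops
  out. The surplus k2 (y - c) of the first order is a constant and vanishes after division by
  t.\<close>

lemma long_term_average_cost_yz:
  assumes x0: "0 < x0" and yz: "0 \<le> y" "y < z" and k: "0 \<le> k1" "0 \<le> k2" "0 \<le> c_h"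
  shows "long_term_average_cost M B (holding_cost c_h) (order_cost k1 k2) k5 (yz_policy B y z) =
    ennreal (c_h * (\<sigma>\<^sup>2 / (2 * \<mu>) + (y + z) / 2) + (k1 + k2 * (z - y)) * (\<mu> / (z - y)))"
proof -
  define c where "c = min x0 y"
  interpret V: order_levels M W x0 \<mu> \<sigma> c "z - y"
    by unfold_locales (use yz in \<open>auto simp: c_def\<close>)
  let ?IV = "\<lambda>t \<omega>. LINT s:{0..t}|lborel. V.V s \<omega>"
  define R where "R t \<omega> = c_h * (?IV t \<omega> + (y - c) * t) + ((k1 + k2 * (z - y)) * V.N t \<omega> + k2 * (y - c))" for t \<omega>
  have cost: "cost_up_to (holding_cost c_h) (order_cost k1 k2) k5 (\<lambda>s. B s \<omega>) (yz_policy B y z \<omega>) t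
      = ennreal (R t \<omega>) \<and> 0 \<le> R t \<omega>"
    if \<omega>: "\<omega> \<in> space M" and start: "first_passage (\<lambda>t. B t \<omega>) x0 = 0" and t: "0 < t" for t \<omega>
  proof -
    interpret p: yz_path "\<lambda>t. B t \<omega>" y z by (rule yz_path[OF \<omega> x0 yz])
    have t0: "0 \<le> t" using t by simp
    have X: "B s \<omega> + (z - y) * real (count_levels (min (B 0 \<omega>) y) (z - y) (running_min (\<lambda>t. B t \<omega>) s)) + (y - min (B 0 \<omega>) y)
      = V.V s \<omega> + (y - c)" for s
      by (simp add: V.V_def V.N_def m_def B_0[OF \<omega>] c_def[symmetric])
    have K: "real (count_levels (min (B 0 \<omega>) y) (z - y) (running_min (\<lambda>t. B t \<omega>) t)) = V.N t \<omega>"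
      by (simp add: V.N_def m_def B_0[OF \<omega>] c_def[symmetric])
    have const: "set_integrable lborel {0..t} (\<lambda>s. y - c)"
      by (intro borel_integrable_atLeastAtMost' continuous_intros)
    have int: "set_integrable lborel {0..t} (\<lambda>s. V.V s \<omega> + (y - c))"
      by (rule set_integral_add(1)[OF V.integral_V(1)[OF \<omega> t0] const])
    have I: "(LINT s:{0..t}|lborel. V.V s \<omega> + (y - c)) = ?IV t \<omega> + (y - c) * t"
      using set_integral_add(2)[OF V.integral_V(1)[OF \<omega> t0] const] t0
      by (simp add: set_lebesgue_integral_def)
    have "first_passage (\<lambda>t. B t \<omega>) (B 0 \<omega>) = 0" using start by (simp add: B_0[OF \<omega>])
    note p.cost_yz(1)[OF this t k, where ?k5.0=k5, unfolded X K I, OF int]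
      p.cost_yz(2)[OF this t k, unfolded X K I, OF int]
    moreover have "c_h * (?IV t \<omega> + (y - c) * t) + (k1 * V.N t \<omega> + k2 * (y - min (B 0 \<omega>) y + (z - y) * V.N t \<omega>)) = R t \<omega>"
      unfolding R_def by (simp add: B_0[OF \<omega>] c_def algebra_simps)
    ultimately show ?thesis by (simp only: yz_policy_def simp_thms)
  qed
  have Rint: "integrable M (R t)" if "0 \<le> t" for t
    unfolding R_def using V.expectation_integral_V(1)[OF that] V.V_integrable(3)[OF that] by simp
  have RC: "expectation (R t) = c_h * (expectation (?IV t) + (y - c) * t) + ((k1 + k2 * (z - y)) * expectation (V.N t) + k2 * (y - c))"
    if "0 \<le> t" for t
    unfolding R_def using V.expectation_integral_V(1)[OF that] V.V_integrable(3)[OF that] by (simp add: prob_space)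
  have "((\<lambda>t. c_h * (expectation (?IV t) / t + (y - c)) + ((k1 + k2 * (z - y)) * (expectation (V.N t) / t) + k2 * (y - c) / t))
      \<longlongrightarrow> c_h * (\<sigma>\<^sup>2 / (2 * \<mu>) + c + (z - y) / 2 + (y - c)) + ((k1 + k2 * (z - y)) * (\<mu> / (z - y)) + 0)) at_top"
    by (intro tendsto_intros V.average_V V.average_N V.tendsto_const_over_t)
  also have "c_h * (\<sigma>\<^sup>2 / (2 * \<mu>) + c + (z - y) / 2 + (y - c)) + ((k1 + k2 * (z - y)) * (\<mu> / (z - y)) + 0)
    = c_h * (\<sigma>\<^sup>2 / (2 * \<mu>) + (y + z) / 2) + (k1 + k2 * (z - y)) * (\<mu> / (z - y))" by (simp add: field_simps)
  finally have lim: "((\<lambda>t. expectation (R t) / t) \<longlongrightarrow> c_h * (\<sigma>\<^sup>2 / (2 * \<mu>) + (y + z) / 2) + (k1 + k2 * (z - y)) * (\<mu> / (z - y))) at_top"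
  proof (rule Lim_transform_eventually)
    show "eventually (\<lambda>t. c_h * (expectation (?IV t) / t + (y - c)) + ((k1 + k2 * (z - y)) * (expectation (V.N t) / t) + k2 * (y - c) / t)
      = expectation (R t) / t) at_top"
      using eventually_gt_at_top[of 0]
    proof eventually_elim
      case (elim t)
      have "c_h * (e / t + d) + (k * (n / t) + l / t) = (c_h * (e + d * t) + (k * n + l)) / t" for e d k n l :: real
        using elim by (simp add: field_simps)
      then show ?case using elim by (simp only: RC less_imp_le)
    qed
  qed
  show ?thesis
  proof (rule long_term_average_cost_eqI[OF _ Rint lim])
    show "AE \<omega> in M. cost_up_to (holding_cost c_h) (order_cost k1 k2) k5 (\<lambda>s. B s \<omega>) (yz_policy B y z \<omega>) t = ennreal (R t \<omega>) \<and> 0 \<le> R t \<omega>"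
      if "0 < t" for t
      using AE_first_passage_start AE_space by eventually_elim (rule cost[OF _ _ that])
  qed simp
qed

lemma long_term_average_cost_just_in_time:
  assumes x0: "0 < x0" and k: "0 \<le> c_h" "0 \<le> k5"
  shows "long_term_average_cost M B (holding_cost c_h) c1 k5 just_in_time_policy =
    ennreal (c_h * (\<sigma>\<^sup>2 / (2 * \<mu>)) + k5 * \<mu>)"
proof -
  define L where "L t \<omega> = max 0 (- m t \<omega>)" for t \<omega>
  define X where "X t \<omega> = B t \<omega> + L t \<omega>" for t \<omega>
  have lev: "order_levels M W x0 \<mu> \<sigma> 0 q" if "0 < q" for q
    by unfold_locales (use that x0 in auto)
  text \<open>Reflection is the limit of the \<open>(0,q)\<close> ordering policies as \<open>q\<close> tends to 0.\<close>
  have X_V: "order_levels.V W x0 \<mu> \<sigma> 0 q t \<omega> - q \<le> X t \<omega>" "X t \<omega> \<le> order_levels.V W x0 \<mu> \<sigma> 0 q t \<omega>"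
    if q: "0 < q" for q t \<omega>
  proof -
    interpret V: order_levels M W x0 \<mu> \<sigma> 0 q by (rule lev[OF q])
    have "0 \<le> q * V.N t \<omega>" using q V.N_nonneg by simp
    then show "V.V t \<omega> - q \<le> X t \<omega>" "X t \<omega> \<le> V.V t \<omega>"
      using count_levels_bounds[OF q, of 0 "m t \<omega>"] q unfolding V.V_def X_def L_def V.N_def by linarith+
  qed
  have X_cont: "continuous_on {0..} (\<lambda>t. X t \<omega>)" if "\<omega> \<in> space M" for \<omega>
    unfolding X_def L_def by (intro continuous_intros B_cont m_cont that)
  have L_meas: "L t \<in> borel_measurable M" if "0 \<le> t" for t
    using m_meas[OF that] unfolding L_def by measurable
  have X_meas: "X t \<in> borel_measurable M" if "0 \<le> t" for t
    using L_meas[OF that] B_meas[OF that] unfolding X_def by measurable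
  have X_set_int: "set_integrable lborel {0..t} (\<lambda>s. X s \<omega>)" if "\<omega> \<in> space M" for t \<omega>
    by (intro borel_integrable_atLeastAtMost' continuous_on_subset[OF X_cont[OF that]]) auto
  let ?IX = "\<lambda>t \<omega>. LINT s:{0..t}|lborel. X s \<omega>"
  have IX_V: "(LINT s:{0..t}|lborel. order_levels.V W x0 \<mu> \<sigma> 0 q s \<omega>) - q * t \<le> ?IX t \<omega>"
    "?IX t \<omega> \<le> (LINT s:{0..t}|lborel. order_levels.V W x0 \<mu> \<sigma> 0 q s \<omega>)"
    if q: "0 < q" and \<omega>: "\<omega> \<in> space M" and t: "0 \<le> t" for q t \<omega>
  proof -
    interpret V: order_levels M W x0 \<mu> \<sigma> 0 q by (rule lev[OF q])
    note i = V.integral_V(1)[OF \<omega> t]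
    have const: "set_integrable lborel {0..t} (\<lambda>s. q)"
      by (intro borel_integrable_atLeastAtMost' continuous_intros)
    have "(LINT s:{0..t}|lborel. V.V s \<omega>) - q * t = (LINT s:{0..t}|lborel. V.V s \<omega> - q)"
      using set_integral_diff(2)[OF i const] t by (simp add: set_lebesgue_integral_def)
    also have "\<dots> \<le> ?IX t \<omega>"
      by (rule set_integral_mono[OF set_integral_diff(1)[OF i const] X_set_int[OF \<omega>]]) (rule X_V[OF q])
    finally show "(LINT s:{0..t}|lborel. V.V s \<omega>) - q * t \<le> ?IX t \<omega>" .
    show "?IX t \<omega> \<le> (LINT s:{0..t}|lborel. V.V s \<omega>)"
      by (rule set_integral_mono[OF X_set_int[OF \<omega>] i]) (rule X_V[OF q])
  qed
  have IX_meas: "?IX t \<in> borel_measurable M" if t: "0 \<le> t" for t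
  proof -
    have J: "(\<lambda>p. X (max 0 (fst p)) (snd p)) \<in> borel_measurable ((borel :: real measure) \<Otimes>\<^sub>M M)"
      by (rule measurable_continuous_process[OF X_meas X_cont])
    have J': "(\<lambda>(\<omega>, s). indicator {0..t} s *\<^sub>R X (max 0 s) \<omega>) \<in> borel_measurable (M \<Otimes>\<^sub>M lborel)"
    proof -
      have "(\<lambda>p. (snd p, fst p)) \<in> measurable (M \<Otimes>\<^sub>M lborel) ((borel :: real measure) \<Otimes>\<^sub>M M)" by simp
      from measurable_compose[OF this J]
      have [measurable]: "(\<lambda>p. X (max 0 (snd p)) (fst p)) \<in> borel_measurable (M \<Otimes>\<^sub>M lborel)" by simp
      show ?thesis unfolding case_prod_beta by measurable
    qed
    have "(\<lambda>\<omega>. \<integral>s. indicator {0..t} s *\<^sub>R X (max 0 s) \<omega> \<partial>lborel) \<in> borel_measurable M"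
      using lborel.borel_measurable_lebesgue_integral[OF J'] by simp
    also have "(\<lambda>\<omega>. \<integral>s. indicator {0..t} s *\<^sub>R X (max 0 s) \<omega> \<partial>lborel) = ?IX t"
      unfolding set_lebesgue_integral_def
      by (intro ext Bochner_Integration.integral_cong) (auto simp: indicator_def)
    finally show ?thesis .
  qed
  have between: "integrable M f" if "integrable M g" "f \<in> borel_measurable M"
    "\<And>\<omega>. \<omega> \<in> space M \<Longrightarrow> g \<omega> - K \<le> f \<omega>" "\<And>\<omega>. \<omega> \<in> space M \<Longrightarrow> f \<omega> \<le> g \<omega>" for f g :: "'a \<Rightarrow> real" and K
  proof (rule Bochner_Integration.integrable_bound)
    show "integrable M (\<lambda>\<omega>. \<bar>g \<omega>\<bar> + \<bar>K\<bar>)" using that(1) by simp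
    show "AE \<omega> in M. norm (f \<omega>) \<le> norm (\<bar>g \<omega>\<bar> + \<bar>K\<bar>)"
      using that(3,4) by (intro AE_I2) fastforce
  qed (rule that(2))
  \<comment> \<open>One fixed spacing is enough for integrability and sublinear growth; the average
    inventory is where q has to tend to 0.\<close>
  interpret V1: order_levels M W x0 \<mu> \<sigma> 0 1 by (rule lev) simp
  have IX_int: "integrable M (?IX t)" if t: "0 \<le> t" for t
    by (rule between[OF V1.expectation_integral_V(1)[OF t] IX_meas[OF t], of "1 * t"])
       (use IX_V[OF _ _ t, of 1] in auto)
  have X_int: "integrable M (X t)" if t: "0 \<le> t" for t
    by (rule between[OF V1.V_integrable(2)[OF t] X_meas[OF t], of 1]) (use X_V[of 1 t] in auto)
  have L_int: "integrable M (L t)" if t: "0 \<le> t" for t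
    using Bochner_Integration.integrable_diff[OF X_int[OF t] expectation_B(1)[OF t]] by (simp add: X_def)
  \<comment> \<open>The mean local time is read off from X = B + L; as E X_t is sublinear, it grows
    at rate \<mu>.\<close>
  have EL: "expectation (L t) = expectation (X t) - x0 + \<mu> * t" if t: "0 \<le> t" for t
    unfolding X_def using L_int[OF t] expectation_B[OF t] by simp
  have avg_X: "((\<lambda>t. expectation (?IX t) / t) \<longlongrightarrow> \<sigma>\<^sup>2 / (2 * \<mu>)) at_top"
  proof (rule tendstoI)
    fix e :: real assume e: "0 < e"
    \<comment> \<open>Both errors are governed by q: the limiting average for (0,q) exceeds the
      target by q / 2, and the reflected process lies at most q below V. With q = e / 2 the
      deviation stays below e.\<close>
    define q where "q = e / 2"
    have q: "0 < q" using e by (simp add: q_def)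
    interpret V: order_levels M W x0 \<mu> \<sigma> 0 q by (rule lev[OF q])
    have "eventually (\<lambda>t. dist (expectation (\<lambda>\<omega>. LINT s:{0..t}|lborel. V.V s \<omega>) / t) (\<sigma>\<^sup>2 / (2 * \<mu>) + 0 + q / 2) < q / 2) at_top"
      using q by (intro tendstoD V.average_V) simp
    then show "eventually (\<lambda>t. dist (expectation (?IX t) / t) (\<sigma>\<^sup>2 / (2 * \<mu>)) < e) at_top"
      using eventually_gt_at_top[of 0]
    proof eventually_elim
      case (elim t)
      then have t: "0 \<le> t" by simp
      let ?v = "expectation (\<lambda>\<omega>. LINT s:{0..t}|lborel. V.V s \<omega>)"
      have "expectation (\<lambda>\<omega>. (LINT s:{0..t}|lborel. V.V s \<omega>) - q * t) \<le> expectation (?IX t)"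
        using V.expectation_integral_V(1)[OF t] by (intro integral_mono IX_int t IX_V q) auto
      then have "?v - q * t \<le> expectation (?IX t)"
        using V.expectation_integral_V(1)[OF t] by (simp add: prob_space)
      then have "(?v - q * t) / t \<le> expectation (?IX t) / t" using t by (rule divide_right_mono)
      then have "?v / t - q \<le> expectation (?IX t) / t" using elim(2) by (simp add: diff_divide_distrib)
      moreover have "expectation (?IX t) \<le> ?v"
        by (intro integral_mono IX_int t IX_V q V.expectation_integral_V(1))
      then have "expectation (?IX t) / t \<le> ?v / t" using t by (rule divide_right_mono)
      ultimately show ?case using elim(1) e unfolding dist_real_def q_def by linarith
    qed
  qed
  have sub_X: "((\<lambda>t. expectation (X t) / t) \<longlongrightarrow> 0) at_top"
  proof (rule tendsto_sandwich[OF _ _ _ V1.V_sublinear])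
    show "((\<lambda>t. expectation (V1.V t) / t - 1 / t) \<longlongrightarrow> 0) at_top"
      using tendsto_diff[OF V1.V_sublinear V1.tendsto_const_over_t[of 1]] by simp
    show "eventually (\<lambda>t. expectation (V1.V t) / t - 1 / t \<le> expectation (X t) / t) at_top"
      using eventually_gt_at_top[of 0]
    proof eventually_elim
      case (elim t)
      then have t: "0 \<le> t" by simp
      have "expectation (\<lambda>\<omega>. V1.V t \<omega> - 1) \<le> expectation (X t)"
        using V1.V_integrable(2)[OF t] by (intro integral_mono X_int t X_V) auto
      then have "expectation (V1.V t) - 1 \<le> expectation (X t)"
        using V1.V_integrable(2)[OF t] by (simp add: prob_space)
      then show ?case using elim by (simp add: diff_divide_distrib[symmetric] divide_right_mono)
    qed
    show "eventually (\<lambda>t. expectation (X t) / t \<le> expectation (V1.V t) / t) at_top"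
      using eventually_gt_at_top[of 0]
    proof eventually_elim
      case (elim t)
      then have t: "0 \<le> t" by simp
      have "expectation (X t) \<le> expectation (V1.V t)"
        by (intro integral_mono X_int t X_V V1.V_integrable(2)) simp
      then show ?case using t by (rule divide_right_mono)
    qed
  qed
  define R where "R t \<omega> = c_h * ?IX t \<omega> + k5 * L t \<omega>" for t \<omega>
  have Rint: "integrable M (R t)" and RC: "expectation (R t) = c_h * expectation (?IX t) + k5 * expectation (L t)"
    if "0 \<le> t" for t
    unfolding R_def using IX_int[OF that] L_int[OF that] by simp_all
  have "((\<lambda>t. c_h * (expectation (?IX t) / t) + k5 * (expectation (X t) / t - x0 / t + \<mu>))
    \<longlongrightarrow> c_h * (\<sigma>\<^sup>2 / (2 * \<mu>)) + k5 * (0 - 0 + \<mu>)) at_top"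
    by (intro tendsto_intros avg_X sub_X V1.tendsto_const_over_t)
  then have "((\<lambda>t. c_h * (expectation (?IX t) / t) + k5 * (expectation (X t) / t - x0 / t + \<mu>))
    \<longlongrightarrow> c_h * (\<sigma>\<^sup>2 / (2 * \<mu>)) + k5 * \<mu>) at_top" by simp
  then have lim: "((\<lambda>t. expectation (R t) / t) \<longlongrightarrow> c_h * (\<sigma>\<^sup>2 / (2 * \<mu>)) + k5 * \<mu>) at_top"
  proof (rule Lim_transform_eventually)
    show "eventually (\<lambda>t. c_h * (expectation (?IX t) / t) + k5 * (expectation (X t) / t - x0 / t + \<mu>) = expectation (R t) / t) at_top"
      using eventually_gt_at_top[of 0]
    proof eventually_elim
      case (elim t)
      have "c_h * (i / t) + k5 * (v / t - x0 / t + \<mu>) = (c_h * i + k5 * (v - x0 + \<mu> * t)) / t" for i v :: real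
        using elim by (simp add: field_simps)
      then show ?case using elim by (simp only: RC EL less_imp_le)
    qed
  qed
  show ?thesis
  proof (rule long_term_average_cost_eqI[OF _ Rint lim])
    show "AE \<omega> in M. cost_up_to (holding_cost c_h) c1 k5 (\<lambda>s. B s \<omega>) (just_in_time_policy \<omega>) t
      = ennreal (R t \<omega>) \<and> 0 \<le> R t \<omega>" if "0 < t" for t
    proof (rule AE_I2)
      fix \<omega> assume \<omega>: "\<omega> \<in> space M"
      show "cost_up_to (holding_cost c_h) c1 k5 (\<lambda>s. B s \<omega>) (just_in_time_policy \<omega>) t = ennreal (R t \<omega>) \<and> 0 \<le> R t \<omega>"
        using continuous_path.cost_no_orders(1)[OF path[OF \<omega>], of t c_h k5 c1]
          continuous_path.cost_no_orders(2)[OF path[OF \<omega>], of t c_h k5] x0 that k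
        by (simp add: just_in_time_policy_def R_def X_def L_def m_def B_0[OF \<omega>])
    qed
  qed simp
qed

end

text \<open>With q = z - y, completing the square writes the cost as c_h y + k2 \<mu> + c_h zs + c_h
  (q - zs)^2 / (2 q). Both the minimal value and strictness away from (0, zs) are visible there: y >
  0 costs c_h y, and y = 0 with z different from zs costs the square.\<close>

lemma economic_order_quantity:
  fixes k1 k2 c_h \<mu> y z :: real
  assumes pos: "0 < \<mu>" "0 < c_h" "0 < k1" and yz: "0 \<le> y" "y < z"
  defines "zs \<equiv> sqrt (2 * k1 * \<mu> / c_h)"
  defines "cost \<equiv> \<lambda>y z. c_h * ((y + z) / 2) + (k1 + k2 * (z - y)) * (\<mu> / (z - y))"
  shows "cost 0 zs = sqrt (2 * k1 * c_h * \<mu>) + k2 * \<mu>"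
    and "(y, z) \<noteq> (0, zs) \<Longrightarrow> cost 0 zs < cost y z"
proof -
  have zs: "0 < zs" using pos by (simp add: zs_def)
  have zs2: "c_h * zs\<^sup>2 = 2 * k1 * \<mu>" using pos by (simp add: zs_def)
  have split: "cost y z = c_h * y + k2 * \<mu> + c_h * zs + c_h * (z - y - zs)\<^sup>2 / (2 * (z - y))" if "y < z" for y z
  proof -
    define q where "q = z - y"
    have q: "0 < q" using that by (simp add: q_def)
    have "cost y z = c_h * y + c_h * q / 2 + k2 * \<mu> + k1 * \<mu> / q"
      unfolding cost_def q_def[symmetric] using q by (simp add: q_def field_simps)
    also have "k1 * \<mu> / q = c_h * zs\<^sup>2 / (2 * q)" using zs2 q by (simp add: field_simps)
    also have "c_h * y + c_h * q / 2 + k2 * \<mu> + c_h * zs\<^sup>2 / (2 * q) = c_h * y + k2 * \<mu> + c_h * zs + c_h * (q - zs)\<^sup>2 / (2 * q)"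
      using q by (simp add: field_simps power2_eq_square)
    finally show ?thesis by (simp add: q_def)
  qed
  have at: "cost 0 zs = k2 * \<mu> + c_h * zs" using split[OF zs] by simp
  also have "c_h * zs = sqrt (2 * k1 * c_h * \<mu>)"
  proof (rule real_sqrt_unique[symmetric])
    show "(c_h * zs)\<^sup>2 = 2 * k1 * c_h * \<mu>"
      using zs2 by (simp add: power_mult_distrib power2_eq_square mult.assoc mult.left_commute)
  qed (use pos zs in simp)
  finally show "cost 0 zs = sqrt (2 * k1 * c_h * \<mu>) + k2 * \<mu>" by simp
  assume ne: "(y, z) \<noteq> (0, zs)"
  have "0 < c_h * y + c_h * (z - y - zs)\<^sup>2 / (2 * (z - y))"
  proof (cases "y = 0")
    case True
    then have "z - y - zs \<noteq> 0" using ne by auto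
    then have "0 < c_h * (z - y - zs)\<^sup>2 / (2 * (z - y))" using pos yz by simp
    then show ?thesis using True by simp
  next
    case False
    then show ?thesis using pos yz by (intro add_pos_nonneg) auto
  qed
  then show "cost 0 zs < cost y z" unfolding at split[OF yz(2)] by simp
qed

theorem mainTheorem6:
  fixes M :: "'a measure" and W :: "real \<Rightarrow> 'a \<Rightarrow> real" and B :: "real \<Rightarrow> 'a \<Rightarrow> real"
    and J :: "('a \<Rightarrow> orders) \<Rightarrow> ennreal"
    and \<mu> \<sigma> c_h k1 k2 k5 k5_premium x0 z_star F_star F_hat :: real
  assumes "standard_brownian_motion M W"
    and "0 < \<mu>" "0 < \<sigma>" "0 < c_h" "0 < k1" "0 < k2" "0 < x0"
    and "0 < k5_premium" "k5 = k2 + k5_premium"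
    and B: "B = drifted_bm x0 \<mu> \<sigma> W"
    and J: "J = long_term_average_cost M B (holding_cost c_h) (order_cost k1 k2) k5"
    and z_star: "z_star = sqrt (2 * k1 * \<mu> / c_h)"
    and F_star: "F_star = sqrt (2 * k1 * c_h * \<mu>) + k2 * \<mu> + \<sigma>\<^sup>2 * c_h / (2 * \<mu>)"
    and F_hat: "F_hat = \<sigma>\<^sup>2 * c_h / (2 * \<mu>) + k5 * \<mu>"
  shows "(\<forall>y z. 0 \<le> y \<and> y < z \<longrightarrow> ordering_policy M B (yz_policy B y z)) \<and>
         0 < z_star \<and>
         J (yz_policy B 0 z_star) = ennreal F_star \<and>
         (\<forall>y z. 0 \<le> y \<and> y < z \<and> (y, z) \<noteq> (0, z_star) \<longrightarrow>
            J (yz_policy B 0 z_star) < J (yz_policy B y z)) \<and>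
         J just_in_time_policy = ennreal F_hat \<and>
         (J just_in_time_policy < J (yz_policy B 0 z_star) \<longleftrightarrow> k5_premium < c_h * z_star / \<mu>)"
proof -
  have "prob_space M" using assms(1) by (simp add: standard_brownian_motion_def)
  then interpret D: drifted_brownian_motion M W x0 \<mu> \<sigma>
    by (intro drifted_brownian_motion.intro brownian_motion.intro brownian_motion_axioms.intro
        drifted_brownian_motion_axioms.intro assms)
  define c where "c y z = c_h * ((y + z) / 2) + (k1 + k2 * (z - y)) * (\<mu> / (z - y))" for y z
  define s where "s = \<sigma>\<^sup>2 * c_h / (2 * \<mu>)"
  have z0: "0 < z_star" using assms by simp
  have s: "0 \<le> s" using assms by (simp add: s_def)
  have Jyz: "J (yz_policy B y z) = ennreal (s + c y z)" if "0 \<le> y" "y < z" for y z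
    unfolding J B using D.long_term_average_cost_yz[of y z k1 k2 c_h k5] assms that
    by (simp add: s_def c_def algebra_simps)
  have eoq: "c 0 z_star = sqrt (2 * k1 * c_h * \<mu>) + k2 * \<mu>"
    "\<And>y z. 0 \<le> y \<Longrightarrow> y < z \<Longrightarrow> (y, z) \<noteq> (0, z_star) \<Longrightarrow> c 0 z_star < c y z"
    unfolding c_def z_star
    \<comment> \<open>The values 0 and 1 are sample levels that discharge the assumptions shared by
      both claims.\<close>
    using economic_order_quantity(1)[of \<mu> c_h k1 0 1 k2] economic_order_quantity(2)[of \<mu> c_h k1 _ _ k2] assms(2-5)
    by auto
  have star: "J (yz_policy B 0 z_star) = ennreal F_star"
    using Jyz[of 0 z_star] z0 by (simp add: eoq(1) F_star s_def add.commute)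
  have F_nn: "0 \<le> F_star" "0 \<le> F_hat" unfolding F_star F_hat using assms(2-9) by simp_all
  have hat: "J just_in_time_policy = ennreal F_hat"
    unfolding J B F_hat using D.long_term_average_cost_just_in_time[of c_h k5] assms(2-9)
    by (simp add: mult.commute)
  \<comment> \<open>The terms \<open>k2 * \<mu>\<close> and
    \<open>\<sigma>\<^sup>2 * c_h / (2 * \<mu>)\<close> are common to both costs, so the premium
    rate is compared with the fixed-cost square root, which equals
    \<open>c_h * z_star\<close>.\<close>
  have "F_hat < F_star \<longleftrightarrow> k5_premium * \<mu> < sqrt (2 * k1 * c_h * \<mu>)"
    unfolding F_hat F_star assms(9) by (simp add: algebra_simps)
  also have "sqrt (2 * k1 * c_h * \<mu>) = c_h * z_star"
  proof (rule real_sqrt_unique)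
    show "(c_h * z_star)\<^sup>2 = 2 * k1 * c_h * \<mu>"
      unfolding z_star power_mult_distrib using assms(2-5) by (simp add: power2_eq_square field_simps)
  qed (use assms z0 in simp)
  also have "k5_premium * \<mu> < c_h * z_star \<longleftrightarrow> k5_premium < c_h * z_star / \<mu>"
    using assms(2) by (simp add: pos_less_divide_eq)
  finally have iff: "F_hat < F_star \<longleftrightarrow> k5_premium < c_h * z_star / \<mu>" .
  have "J (yz_policy B 0 z_star) < J (yz_policy B y z)" if "0 \<le> y" "y < z" "(y, z) \<noteq> (0, z_star)" for y z
  proof -
    have "0 \<le> c 0 z_star" unfolding eoq(1) using assms(2-6) by simp
    then show ?thesis unfolding Jyz[OF that(1,2)] Jyz[OF order_refl z0]
      using eoq(2)[OF that] s by (intro ennreal_lessI) auto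
  qed
  moreover have "ordering_policy M B (yz_policy B y z)" if "0 \<le> y" "y < z" for y z
    unfolding B using that assms(7) by (intro D.ordering_policy_yz)
  ultimately show ?thesis
    using z0 star hat iff F_nn by (auto simp: ennreal_less_iff)
qed

end
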